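(* Let $f,g:\mathbb{C}\to\mathbb{C}$ be non-injective entire maps sharing a bounded periodic Fatou component $D$ (that is, $D$ is a bounded Fatou component of both $f$ and $g$, and is periodic for both $f$ and $g$). If the semigroup $\langle f,g\rangle$ generated by $f$ and $g$ under composition contains neither free non-cyclic nor free abelian non-cyclic subsemigroups, then $f$ and $g$ have the same set of preperiodic points.
   Context: A Fatou component $D$ of $f$ is periodic if $f^p(D)\subseteq D$ for some $p\geq 1$. A point is preperiodic for a map if its forward orbit is finite. "Free non-cyclic" means free on at least two generators; "free abelian non-cyclic" means a free abelian semigroup of rank at least two. *)

theory Defs
  imports "HOL-Complex_Analysis.Complex_Analysis" "HOL-Library.Multiset"
begin

definition locally_uniformly_to_infinity_on ::
    "complex set \<Rightarrow> (nat \<Rightarrow> complex \<Rightarrow> complex) \<Rightarrow> bool" where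
  "locally_uniformly_to_infinity_on U F \<longleftrightarrow>
     (\<forall>K. compact K \<and> K \<subseteq> U \<longrightarrow>
        (\<forall>B. \<forall>\<^sub>F n in sequentially. \<forall>z\<in>K. norm (F n z) > B))"

(* Normality in Montel's sense, for holomorphic functions on a domain U: the constant infinity
   is an admissible limit. *)
definition normal_family_on ::
    "complex set \<Rightarrow> (complex \<Rightarrow> complex) set \<Rightarrow> bool" where
  "normal_family_on U \<F> \<longleftrightarrow>
     (\<forall>F. range F \<subseteq> \<F> \<longrightarrow>
        (\<exists>r :: nat \<Rightarrow> nat. strict_mono r \<and>
           ((\<exists>h. h holomorphic_on U \<and>
               (\<forall>K. compact K \<and> K \<subseteq> U \<longrightarrow> uniform_limit K (F \<circ> r) h sequentially)) \<or>
            locally_uniformly_to_infinity_on U (F \<circ> r))))"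

definition Fatou_set :: "(complex \<Rightarrow> complex) \<Rightarrow> complex set" where
  "Fatou_set f =
     {z. \<exists>U. open U \<and> connected U \<and> z \<in> U \<and> normal_family_on U (range (\<lambda>n. f ^^ n))}"

definition Fatou_component :: "(complex \<Rightarrow> complex) \<Rightarrow> complex set \<Rightarrow> bool" where
  "Fatou_component f D \<longleftrightarrow> D \<in> components (Fatou_set f)"

definition periodic_Fatou_component :: "(complex \<Rightarrow> complex) \<Rightarrow> complex set \<Rightarrow> bool" where
  "periodic_Fatou_component f D \<longleftrightarrow>
     Fatou_component f D \<and> (\<exists>p\<ge>1. (f ^^ p) ` D \<subseteq> D)"

definition preperiodic_points :: "('a \<Rightarrow> 'a) \<Rightarrow> 'a set" where
  "preperiodic_points f = {z. finite (range (\<lambda>n. (f ^^ n) z))}"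

inductive_set generated_semigroup :: "('a \<Rightarrow> 'a) set \<Rightarrow> ('a \<Rightarrow> 'a) set"
  for S where
  generator: "s \<in> S \<Longrightarrow> s \<in> generated_semigroup S"
| compose: "s \<in> generated_semigroup S \<Longrightarrow> t \<in> generated_semigroup S \<Longrightarrow>
    s \<circ> t \<in> generated_semigroup S"

(* T is isomorphic, by a map fixing the generators X, to the free semigroup on X, i.e. the
   nonempty words under concatenation. There is no identity element in a free semigroup. *)
definition free_semigroup_on :: "('a \<Rightarrow> 'a) set \<Rightarrow> ('a \<Rightarrow> 'a) set \<Rightarrow> bool" where
  "free_semigroup_on X T \<longleftrightarrow>
     (\<exists>\<phi>. bij_betw \<phi> {w. w \<noteq> [] \<and> set w \<subseteq> X} T \<and>
          (\<forall>x\<in>X. \<phi> [x] = x) \<and>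
          (\<forall>v w. v \<noteq> [] \<and> set v \<subseteq> X \<and> w \<noteq> [] \<and> set w \<subseteq> X \<longrightarrow> \<phi> (v @ w) = \<phi> v \<circ> \<phi> w))"

(* The same for the free abelian semigroup on X: the nonempty finite multisets under addition. *)
definition free_abelian_semigroup_on :: "('a \<Rightarrow> 'a) set \<Rightarrow> ('a \<Rightarrow> 'a) set \<Rightarrow> bool" where
  "free_abelian_semigroup_on X T \<longleftrightarrow>
     (\<exists>\<phi>. bij_betw \<phi> {A. A \<noteq> {#} \<and> set_mset A \<subseteq> X} T \<and>
          (\<forall>x\<in>X. \<phi> {#x#} = x) \<and>
          (\<forall>A B. A \<noteq> {#} \<and> set_mset A \<subseteq> X \<and> B \<noteq> {#} \<and> set_mset B \<subseteq> X \<longrightarrow>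
             \<phi> (A + B) = \<phi> A \<circ> \<phi> B))"

(* "At least two generators" is not written with card, which is 0 for an infinite X. *)
definition free_noncyclic :: "('a \<Rightarrow> 'a) set \<Rightarrow> bool" where
  "free_noncyclic T \<longleftrightarrow> (\<exists>X. (\<exists>a\<in>X. \<exists>b\<in>X. a \<noteq> b) \<and> free_semigroup_on X T)"

definition free_abelian_noncyclic :: "('a \<Rightarrow> 'a) set \<Rightarrow> bool" where
  "free_abelian_noncyclic T \<longleftrightarrow>
     (\<exists>X. (\<exists>a\<in>X. \<exists>b\<in>X. a \<noteq> b) \<and> free_abelian_semigroup_on X T)"

end

theory Submission
  imports Defs "HOL-Library.Real_Mod"
begin

text \<open>Some common powers \<open>F = f\<^sup>N\<close> and \<open>G = g\<^sup>N\<close> map the bounded component \<open>D\<close> into itself, and passing to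
  powers changes neither the hypotheses nor the preperiodic points. By the maximum principle \<open>D\<close> is
  simply connected, and because the Fatou set is backward invariant \<open>F\<close> and \<open>G\<close> are proper on \<open>D\<close>.
  A Riemann map \<open>\<psi>\<close> of \<open>D\<close> therefore turns \<open>F\<close> and \<open>G\<close> into finite Blaschke products. An element of
  the semigroup \<open>S\<close> generated by \<open>F\<close> and \<open>G\<close> is determined by the boundary values of its Blaschke
  product on any infinite subset of the circle, so all that matters is a semigroup of monotone
  circle maps with multiplicative degrees.

  Absence of free subsemigroups enters mainly through one consequence. Nonconstant entire maps can be
  cancelled on the right, so a coincidence between two different words in \<open>a\<close> and \<open>b\<close> yields
  \<open>u \<circ> a = v \<circ> b\<close> (\<open>common_left_multiple\<close>). Absence of free abelian subsemigroups says that
  commuting elements have a common power (\<open>commuting_imp_common_power\<close>).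

  Suppose that one generator, say \<open>G\<close>, has degree at least two on \<open>D\<close>. A lift \<open>\<alpha>\<close> of a circle map of degree \<open>d \<ge> 2\<close> has the
  linearisation \<open>lim \<alpha>\<^sup>n / d\<^sup>n\<close>. Pulling back by \<open>a\<^sup>N\<close> contracts functions modulo constants by the
  \<open>N\<close>-th power of its degree, and \<open>u \<circ> a\<^sup>N = v \<circ> b\<^sup>N\<close> says that the pullbacks by \<open>a\<^sup>N\<close> and \<open>b\<^sup>N\<close>
  have a common value; hence all elements of degree at least two share one linearisation \<open>H\<close> up to constants
  (\<open>linearisations_differ_by_constant\<close>). So \<open>H\<close> semiconjugates \<open>S\<close> to affine maps \<open>x \<mapsto> d x + c\<close> of
  \<open>\<real>/\<int>\<close>. The function \<open>H\<close> may be constant on arcs, but only countably many, so this affine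
  representation is still faithful. What remains is arithmetic. Take a fixed point of the affine map of \<open>G\<close> as origin and
  let \<open>F\<close> act as \<open>x \<mapsto> d x + c\<close>. For irrational \<open>c\<close> the words in \<open>F \<circ> G\<close> and \<open>G \<circ> F\<close> are told apart by
  digit expansions and generate a free semigroup. For rational \<open>c\<close> the maps \<open>G\<^sup>n\<close> and \<open>G\<^sup>n \<circ> F\<close> commute
  for suitable \<open>n\<close>, a common power makes the degrees multiplicatively dependent, and suitable
  powers \<open>P\<close> of \<open>F\<close> and \<open>Q\<close> of \<open>G\<close> satisfy \<open>Q \<circ> P = Q \<circ> Q\<close> and \<open>P \<circ> Q = P \<circ> P\<close>. One cannot
  hope for \<open>P = Q\<close>, as the pair \<open>z\<^sup>2\<close>, \<open>- z\<^sup>2\<close> shows, but these two identities force equal sets of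
  preperiodic points (\<open>preperiodic_points_subset_if_absorbing\<close>).

  If both degrees are one, \<open>F\<close> and \<open>G\<close> act on \<open>D\<close> by elements of SU(1,1). A loxodromic element of \<open>S\<close>
  would play ping-pong with an element that moves one of its fixed points, or with the square of that
  element, giving a free semigroup; so \<open>F\<close> and \<open>G\<close> share these fixed points and commute. Without loxodromic elements all traces
  are bounded by two, which again forces \<open>F\<close> and \<open>G\<close> to commute. Commuting generators have a common
  power, and then the same preperiodic points.\<close>

section \<open>Words and collisions in semigroups of maps\<close>

text \<open>Words in two letters are lists of booleans rather than lists of maps, so that no case
  distinction is needed when the two maps coincide.\<close>

definition pair_word :: "('a \<Rightarrow> 'a) \<Rightarrow> ('a \<Rightarrow> 'a) \<Rightarrow> bool list \<Rightarrow> 'a \<Rightarrow> 'a" where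
  "pair_word a b w = foldr (\<lambda>c s. (if c then a else b) \<circ> s) w id"

lemma pair_word_simps [simp]:
  "pair_word a b [] = id"
  "pair_word a b (c # w) = (if c then a else b) \<circ> pair_word a b w"
  by (simp_all add: pair_word_def)

lemma pair_word_append: "pair_word a b (v @ w) = pair_word a b v \<circ> pair_word a b w"
  by (induction v) (auto simp: comp_assoc)

lemma pair_word_in_generated_semigroup:
  assumes "a \<in> generated_semigroup S" "b \<in> generated_semigroup S" "w \<noteq> []"
  shows "pair_word a b w \<in> generated_semigroup S"
  using assms(3)
proof (induction w)
  case (Cons c w)
  define x where "x = (if c then a else b)"
  have x: "x \<in> generated_semigroup S"
    using assms(1,2) by (simp add: x_def)
  have eq: "pair_word a b (c # w) = x \<circ> pair_word a b w"
    by (simp add: x_def)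
  show ?case
  proof (cases "w = []")
    case True
    then show ?thesis using x unfolding eq by simp
  next
    case False
    then show ?thesis unfolding eq by (intro generated_semigroup.compose x Cons.IH)
  qed
qed simp

lemma funpow_in_generated_semigroup:
  assumes "a \<in> generated_semigroup S" "n \<ge> 1"
  shows "(a ^^ n) \<in> generated_semigroup S"
  using assms(2)
proof (induction n rule: nat_induct_at_least)
  case (Suc n)
  then show ?case
    unfolding funpow.simps by (intro generated_semigroup.compose assms(1))
qed (use assms(1) in simp)

lemma generated_semigroup_mono_closed:
  assumes "S \<subseteq> generated_semigroup S'"
  shows "generated_semigroup S \<subseteq> generated_semigroup S'"
proof
  fix s assume "s \<in> generated_semigroup S"
  then show "s \<in> generated_semigroup S'"
    by induction (use assms generated_semigroup.compose in blast)+
qed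

lemma pair_word_collision_if_no_free_subsemigroup:
  assumes nofree: "\<not> (\<exists>T \<subseteq> generated_semigroup S. free_noncyclic T)"
    and a: "a \<in> generated_semigroup S" and b: "b \<in> generated_semigroup S"
  obtains v w where "v \<noteq> []" "w \<noteq> []" "v \<noteq> w" "pair_word a b v = pair_word a b w"
proof (cases "a = b")
  case True
  then show ?thesis
    using that[of "[True]" "[False]"] by simp
next
  case False
  define W where "W = {w. w \<noteq> [] \<and> set w \<subseteq> {a, b}}"
  define enc where "enc = map (\<lambda>x. x = a)"
  define \<phi> where "\<phi> = (\<lambda>w. pair_word a b (enc w))"
  have "\<not> inj_on \<phi> W"
  proof
    assume "inj_on \<phi> W"
    then have "bij_betw \<phi> W (\<phi> ` W)"
      by (simp add: bij_betw_def)
    moreover have "\<forall>x\<in>{a,b}. \<phi> [x] = x"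
      by (auto simp: \<phi>_def enc_def)
    moreover have "\<forall>v w. \<phi> (v @ w) = \<phi> v \<circ> \<phi> w"
      by (simp add: \<phi>_def enc_def pair_word_append)
    ultimately have "free_semigroup_on {a, b} (\<phi> ` W)"
      unfolding free_semigroup_on_def W_def by blast
    then have "free_noncyclic (\<phi> ` W)"
      unfolding free_noncyclic_def using False by (intro exI[of _ "{a, b}"]) auto
    moreover have "\<phi> ` W \<subseteq> generated_semigroup S"
      using pair_word_in_generated_semigroup[OF a b] by (simp add: \<phi>_def W_def enc_def image_subset_iff)
    ultimately show False
      using nofree by blast
  qed
  then obtain v w where vw: "v \<in> W" "w \<in> W" "v \<noteq> w" "\<phi> v = \<phi> w"
    unfolding inj_on_def by blast
  have "inj_on enc W"
  proof (rule inj_onI)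
    fix v w assume "v \<in> W" "w \<in> W" "enc v = enc w"
    then have "list_all2 (\<lambda>x y. (x = a) = (y = a)) v w"
      by (simp add: enc_def list_all2_conv_all_nth map_equality_iff)
    then have "list_all2 (=) v w"
      by (rule list.rel_mono_strong) (use \<open>v \<in> W\<close> \<open>w \<in> W\<close> in \<open>auto simp: W_def\<close>)
    then show "v = w"
      by (simp add: list.rel_eq)
  qed
  then have "enc v \<noteq> enc w"
    using vw by (auto simp: inj_on_def)
  then show ?thesis
    using that[of "enc v" "enc w"] vw by (auto simp: W_def \<phi>_def enc_def)
qed

lemma comm_comp_funpow:
  assumes "a \<circ> b = b \<circ> a"
  shows "(a ^^ m) \<circ> (b ^^ n) = (b ^^ n) \<circ> (a ^^ m)"
proof -
  have 1: "(a ^^ m) \<circ> b = b \<circ> (a ^^ m)" if "a \<circ> b = b \<circ> a" for a b :: "'a \<Rightarrow> 'a" and m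
  proof (induction m)
    case (Suc m)
    have "(a ^^ Suc m) \<circ> b = a \<circ> ((a ^^ m) \<circ> b)"
      by (simp add: comp_assoc)
    also have "\<dots> = (a \<circ> b) \<circ> (a ^^ m)"
      by (simp only: Suc comp_assoc)
    also have "\<dots> = b \<circ> (a ^^ Suc m)"
      by (simp only: that funpow.simps comp_assoc)
    finally show ?case .
  qed simp
  show ?thesis
    using 1[OF 1[OF assms, of m, symmetric], of n] by simp
qed

text \<open>The free abelian semigroup on \<open>a\<close> and \<open>b\<close> maps onto the products \<open>a\<^sup>i \<circ> b\<^sup>j\<close>, so failure of
  freeness is a coincidence between two such products.\<close>

lemma commuting_power_collision_if_no_free_abelian_subsemigroup:
  assumes nofree: "\<not> (\<exists>T \<subseteq> generated_semigroup S. free_abelian_noncyclic T)"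
    and a: "a \<in> generated_semigroup S" and b: "b \<in> generated_semigroup S"
    and comm: "a \<circ> b = b \<circ> a"
  obtains i j k l where "(i, j) \<noteq> (k, l)" "(a ^^ i) \<circ> (b ^^ j) = (a ^^ k) \<circ> (b ^^ l)"
proof (cases "a = b")
  case True
  then show ?thesis
    using that[of 1 0 0 1] by simp
next
  case False
  define W where "W = {A. A \<noteq> {#} \<and> set_mset A \<subseteq> {a, b}}"
  define \<phi> where "\<phi> = (\<lambda>A. (a ^^ count A a) \<circ> (b ^^ count A b))"
  have "\<not> inj_on \<phi> W"
  proof
    assume "inj_on \<phi> W"
    then have "bij_betw \<phi> W (\<phi> ` W)"
      by (simp add: bij_betw_def)
    moreover have "\<forall>x\<in>{a,b}. \<phi> {#x#} = x"
      using False by (auto simp: \<phi>_def)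
    moreover have "\<phi> (A + B) = \<phi> A \<circ> \<phi> B" for A B
    proof -
      have "\<phi> A \<circ> \<phi> B
          = (a ^^ count A a) \<circ> ((b ^^ count A b) \<circ> (a ^^ count B a)) \<circ> (b ^^ count B b)"
        by (simp add: \<phi>_def comp_assoc)
      also have "(b ^^ count A b) \<circ> (a ^^ count B a) = (a ^^ count B a) \<circ> (b ^^ count A b)"
        using comm_comp_funpow[OF comm] by simp
      finally have "\<phi> A \<circ> \<phi> B
          = (a ^^ count A a) \<circ> ((a ^^ count B a) \<circ> (b ^^ count A b)) \<circ> (b ^^ count B b)" .
      then show ?thesis
        by (simp only: \<phi>_def funpow_add count_union comp_assoc)
    qed
    ultimately have "free_abelian_semigroup_on {a, b} (\<phi> ` W)"
      unfolding free_abelian_semigroup_on_def W_def by blast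
    then have "free_abelian_noncyclic (\<phi> ` W)"
      unfolding free_abelian_noncyclic_def using False by (intro exI[of _ "{a, b}"]) auto
    moreover have "\<phi> ` W \<subseteq> generated_semigroup S"
    proof (rule image_subsetI)
      fix A assume A: "A \<in> W"
      then obtain x where "x \<in># A" "x \<in> {a, b}"
        by (auto simp: W_def elim!: multiset_nonemptyE)
      then have "count A a > 0 \<or> count A b > 0"
        by auto
      moreover have "(a ^^ i) \<circ> (b ^^ j) \<in> generated_semigroup S" if "i > 0 \<or> j > 0" for i j
        using that a b funpow_in_generated_semigroup[of a S i] funpow_in_generated_semigroup[of b S j]
        by (cases "i = 0"; cases "j = 0") (simp_all add: generated_semigroup.compose)
      ultimately show "\<phi> A \<in> generated_semigroup S"
        unfolding \<phi>_def by simp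
    qed
    ultimately show False
      using nofree by blast
  qed
  then obtain A B where AB: "A \<in> W" "B \<in> W" "A \<noteq> B" "\<phi> A = \<phi> B"
    unfolding inj_on_def by blast
  have "(count A a, count A b) \<noteq> (count B a, count B b)"
  proof
    assume eq: "(count A a, count A b) = (count B a, count B b)"
    have "count A x = count B x" for x
    proof (cases "x \<in> {a, b}")
      case True
      then show ?thesis using eq by auto
    next
      case False
      then have "x \<notin># A" "x \<notin># B"
        using AB(1,2) by (auto simp: W_def)
      then show ?thesis
        by (simp add: not_in_iff)
    qed
    then show False
      using AB(3) multiset_eqI by blast
  qed
  then show ?thesis
    using that AB(4) by (auto simp: \<phi>_def)
qed

section \<open>Right cancellation and common multiples\<close>

definition nonconst_entire :: "(complex \<Rightarrow> complex) \<Rightarrow> bool" where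
  "nonconst_entire f \<longleftrightarrow> f holomorphic_on UNIV \<and> \<not> f constant_on UNIV"

lemma entire_compose:
  "f holomorphic_on UNIV \<Longrightarrow> g holomorphic_on UNIV \<Longrightarrow> f \<circ> g holomorphic_on UNIV"
  by (meson holomorphic_on_compose_gen subset_UNIV)

text \<open>Left cancellation fails for non-injective maps, but the range of \<open>a\<close> is open and the identity
  theorem applies on it.\<close>

lemma entire_right_cancel:
  assumes u: "u holomorphic_on UNIV" and v: "v holomorphic_on UNIV"
    and a: "nonconst_entire a" and eq: "u \<circ> a = v \<circ> a"
  shows "u = v"
proof -
  have "open (range a)"
    using a open_mapping_thm[of a UNIV UNIV] by (auto simp: nonconst_entire_def)
  have "u w - v w = 0" for w
  proof (rule analytic_continuation_open[of "range a" UNIV "\<lambda>w. u w - v w" "\<lambda>_. 0"])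
    show "u z - v z = 0" if "z \<in> range a" for z
      using that eq by (auto simp: fun_eq_iff)
  qed (use \<open>open (range a)\<close> u v in \<open>auto intro: holomorphic_intros\<close>)
  then show ?thesis
    by (auto simp: fun_eq_iff)
qed

lemma nonconst_entire_compose:
  assumes f: "nonconst_entire f" and g: "nonconst_entire g"
  shows "nonconst_entire (f \<circ> g)"
proof -
  have "\<not> (f \<circ> g) constant_on UNIV"
  proof
    assume "(f \<circ> g) constant_on UNIV"
    then obtain c where "f \<circ> g = (\<lambda>_. c) \<circ> g"
      by (auto simp: constant_on_def fun_eq_iff)
    then have "f = (\<lambda>_. c)"
      using entire_right_cancel[OF _ _ g] f by (simp add: nonconst_entire_def)
    then show False
      using f by (auto simp: nonconst_entire_def constant_on_def)
  qed
  then show ?thesis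
    using f g entire_compose by (auto simp: nonconst_entire_def)
qed


lemma pair_word_nonconst_entire:
  assumes "nonconst_entire a" "nonconst_entire b" "w \<noteq> []"
  shows "nonconst_entire (pair_word a b w)"
  using assms(3)
proof (induction w)
  case (Cons c w)
  define x where "x = (if c then a else b)"
  have x: "nonconst_entire x"
    using assms(1,2) by (simp add: x_def)
  have eq: "pair_word a b (c # w) = x \<circ> pair_word a b w"
    by (simp add: x_def)
  show ?case
  proof (cases "w = []")
    case True
    then show ?thesis using x unfolding eq by simp
  next
    case False
    then show ?thesis unfolding eq by (intro nonconst_entire_compose x Cons.IH)
  qed
qed simp

lemma generated_semigroup_nonconst_entire:
  assumes "\<And>s. s \<in> S \<Longrightarrow> nonconst_entire s" "s \<in> generated_semigroup S"
  shows "nonconst_entire s"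
  using assms(2) by induction (use assms(1) nonconst_entire_compose in blast)+

lemma generated_semigroup_not_inj:
  assumes "\<And>s. s \<in> S \<Longrightarrow> \<not> inj s" "s \<in> generated_semigroup S"
  shows "\<not> inj s"
  using assms(2) by induction (use assms(1) inj_on_imageI2 in blast)+

text \<open>Strip common last letters from two words with the same value. Neither word can become empty first,
  because a nonempty word is not injective and hence not the identity; the process stops at words with
  different last letters.\<close>

lemma common_left_multiple:
  assumes ent: "\<And>s. s \<in> S \<Longrightarrow> nonconst_entire s"
    and ninj: "\<And>s. s \<in> S \<Longrightarrow> \<not> inj s"
    and nofree: "\<not> (\<exists>T \<subseteq> generated_semigroup S. free_noncyclic T)"
    and a: "a \<in> generated_semigroup S" and b: "b \<in> generated_semigroup S"
  obtains u v where "u \<in> insert id (generated_semigroup S)" "v \<in> insert id (generated_semigroup S)"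
    "u \<circ> a = v \<circ> b"
proof -
  define G where "G = generated_semigroup S"
  have ab: "nonconst_entire a" "nonconst_entire b"
    using generated_semigroup_nonconst_entire[OF ent] a b by blast+
  have inG: "pair_word a b w \<in> insert id G" for w
    using pair_word_in_generated_semigroup[OF a b, of w] by (cases "w = []") (auto simp: G_def)
  have hol: "pair_word a b w holomorphic_on UNIV" for w
    using pair_word_nonconst_entire[OF ab, of w]
    by (cases "w = []") (auto simp: nonconst_entire_def id_def)
  have nid: "pair_word a b w \<noteq> id" if "w \<noteq> []" for w
    using generated_semigroup_not_inj[OF ninj] pair_word_in_generated_semigroup[OF a b that] inj_on_id
    by metis
  have *: "\<exists>u\<in>insert id G. \<exists>v\<in>insert id G. u \<circ> a = v \<circ> b"
    if "v \<noteq> w" "pair_word a b v = pair_word a b w" for v w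
    using that
  proof (induction v arbitrary: w rule: rev_induct)
    case Nil
    then show ?case using nid[of w] by (metis pair_word_simps(1))
  next
    case (snoc c v)
    show ?case
    proof (cases w rule: rev_exhaust)
      case Nil
      then show ?thesis using snoc.prems nid[of "v @ [c]"] by (metis pair_word_simps(1))
    next
      case (snoc w' d)
      have eq: "pair_word a b v \<circ> (if c then a else b) = pair_word a b w' \<circ> (if d then a else b)"
        using snoc.prems(2) unfolding snoc pair_word_append pair_word_simps comp_id .
      show ?thesis
      proof (cases "c = d")
        case True
        have "pair_word a b v = pair_word a b w'"
          by (rule entire_right_cancel[OF hol hol, of "if c then a else b"])
            (use ab eq True in auto)
        then show ?thesis
          using snoc.IH[of w'] snoc.prems(1) True snoc by simp
      next
        case False
        then show ?thesis
          using eq inG[of v] inG[of w'] by (cases c) metis+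
      qed
    qed
  qed
  obtain v w where "v \<noteq> w" "pair_word a b v = pair_word a b w"
    using pair_word_collision_if_no_free_subsemigroup[OF nofree a b] by metis
  then show ?thesis
    using *[of v w] that unfolding G_def by blast
qed

text \<open>From \<open>a\<^sup>i \<circ> b\<^sup>j = a\<^sup>k \<circ> b\<^sup>l\<close> cancel the smaller power of each letter. What is left is either a
  nonempty product equal to the identity, which non-injectivity excludes, or a common power.\<close>

lemma commuting_imp_common_power:
  assumes ent: "\<And>s. s \<in> S \<Longrightarrow> nonconst_entire s"
    and ninj: "\<And>s. s \<in> S \<Longrightarrow> \<not> inj s"
    and nofree: "\<not> (\<exists>T \<subseteq> generated_semigroup S. free_abelian_noncyclic T)"
    and a: "a \<in> generated_semigroup S" and b: "b \<in> generated_semigroup S"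
    and comm: "a \<circ> b = b \<circ> a"
  obtains r s where "r \<ge> 1" "s \<ge> 1" "a ^^ r = b ^^ s"
proof -
  have ab: "nonconst_entire a" "nonconst_entire b"
    using generated_semigroup_nonconst_entire[OF ent] a b by blast+
  have hol: "(f ^^ n) holomorphic_on UNIV" if "nonconst_entire f" for f n
    using that by (induction n) (auto simp: nonconst_entire_def id_def[symmetric] intro!: entire_compose)
  have cancel: "u = v" if "u \<circ> (f ^^ n) = v \<circ> (f ^^ n)" "nonconst_entire f"
      "u holomorphic_on UNIV" "v holomorphic_on UNIV" for u v f n
    using that
  proof (induction n arbitrary: u v)
    case (Suc n)
    have f: "f holomorphic_on UNIV"
      using Suc.prems(2) by (simp add: nonconst_entire_def)
    have "(u \<circ> f) \<circ> (f ^^ n) = (v \<circ> f) \<circ> (f ^^ n)"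
      using Suc.prems(1) by (simp only: funpow.simps comp_assoc)
    then have "u \<circ> f = v \<circ> f"
      by (rule Suc.IH) (intro Suc.prems entire_compose f)+
    then show ?case
      using entire_right_cancel Suc.prems by blast
  qed (simp only: funpow.simps comp_id)
  have nid: "f ^^ n \<noteq> id" if "f \<in> generated_semigroup S" "n \<ge> 1" for f n
    using generated_semigroup_not_inj[OF ninj] funpow_in_generated_semigroup[OF that] inj_on_id
    by metis
  have pow: "nonconst_entire ((a ^^ i) \<circ> (b ^^ j))" "\<not> inj ((a ^^ i) \<circ> (b ^^ j))" if "i \<ge> 1 \<or> j \<ge> 1" for i j
  proof -
    have "(a ^^ i) \<circ> (b ^^ j) \<in> generated_semigroup S"
    proof (cases "i = 0 \<or> j = 0")
      case True
      then show ?thesis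
        using that funpow_in_generated_semigroup[OF a, of i] funpow_in_generated_semigroup[OF b, of j] by auto
    next
      case False
      then show ?thesis
        by (intro generated_semigroup.compose funpow_in_generated_semigroup a b) auto
    qed
    then show "nonconst_entire ((a ^^ i) \<circ> (b ^^ j))" "\<not> inj ((a ^^ i) \<circ> (b ^^ j))"
      using generated_semigroup_nonconst_entire[OF ent] generated_semigroup_not_inj[OF ninj] by blast+
  qed
  have split: "f ^^ m = (f ^^ (m - n)) \<circ> (f ^^ n)" if "n \<le> m" for f :: "complex \<Rightarrow> complex" and m n
    using that by (simp only: flip: funpow_add) simp
  have *: "\<exists>r\<ge>1. \<exists>s\<ge>1. a ^^ r = b ^^ s"
    if ne: "(i, j) \<noteq> (k, l)" and eq: "(a ^^ i) \<circ> (b ^^ j) = (a ^^ k) \<circ> (b ^^ l)" and "i \<ge> k" for i j k l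
  proof -
    have "((a ^^ (i - k)) \<circ> (b ^^ j)) \<circ> (a ^^ k) = (a ^^ (i - k)) \<circ> ((a ^^ k) \<circ> (b ^^ j))"
      by (simp only: comp_assoc comm_comp_funpow[OF comm, of k j])
    also have "\<dots> = (a ^^ i) \<circ> (b ^^ j)"
      by (simp only: split[OF \<open>i \<ge> k\<close>] comp_assoc)
    also have "\<dots> = (b ^^ l) \<circ> (a ^^ k)"
      by (simp only: eq comm_comp_funpow[OF comm, of k l])
    finally have 1: "(a ^^ (i - k)) \<circ> (b ^^ j) = b ^^ l"
      by (rule cancel) (intro ab hol entire_compose)+
    show ?thesis
    proof (cases "j \<ge> l")
      case True
      have "((a ^^ (i - k)) \<circ> (b ^^ (j - l))) \<circ> (b ^^ l) = id \<circ> (b ^^ l)"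
        using 1 by (simp only: split[OF True] comp_assoc id_comp)
      then have "(a ^^ (i - k)) \<circ> (b ^^ (j - l)) = id"
        by (rule cancel) (intro ab hol entire_compose | simp add: id_def)+
      then show ?thesis
        using pow(2)[of "i - k" "j - l"] ne \<open>i \<ge> k\<close> True by fastforce
    next
      case False
      then have "j \<le> l"
        by simp
      have "(a ^^ (i - k)) \<circ> (b ^^ j) = (b ^^ (l - j)) \<circ> (b ^^ j)"
        using 1 by (simp only: split[OF \<open>j \<le> l\<close>])
      then have 2: "a ^^ (i - k) = b ^^ (l - j)"
        by (rule cancel) (intro ab hol)+
      moreover have "i - k \<noteq> 0"
      proof
        assume "i - k = 0"
        then have "b ^^ (l - j) = id"
          using 2 by (simp only: funpow.simps)
        then show False
          using nid[OF b, of "l - j"] False by linarith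
      qed
      ultimately show ?thesis
        using False by (intro exI[of _ "i - k"] conjI exI[of _ "l - j"]) auto
    qed
  qed
  obtain i j k l where ne: "(i, j) \<noteq> (k, l)" and eq: "(a ^^ i) \<circ> (b ^^ j) = (a ^^ k) \<circ> (b ^^ l)"
    using commuting_power_collision_if_no_free_abelian_subsemigroup[OF nofree a b comm] by metis
  then have "\<exists>r\<ge>1. \<exists>s\<ge>1. a ^^ r = b ^^ s"
    using *[of i j k l] *[of k l i j] by (cases "i \<ge> k") auto
  then show ?thesis
    using that by blast
qed

section \<open>Preperiodic points\<close>

lemma preperiodic_points_funpow:
  assumes "N \<ge> 1"
  shows "preperiodic_points (f ^^ N) = preperiodic_points f"
proof (intro set_eqI iffI)
  fix z assume "z \<in> preperiodic_points f"
  moreover have "range (\<lambda>n. ((f ^^ N) ^^ n) z) \<subseteq> range (\<lambda>n. (f ^^ n) z)"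
    by (auto simp: funpow_mult)
  ultimately show "z \<in> preperiodic_points (f ^^ N)"
    unfolding preperiodic_points_def using finite_subset by blast
next
  fix z assume z: "z \<in> preperiodic_points (f ^^ N)"
  have "range (\<lambda>n. (f ^^ n) z) \<subseteq> (\<Union>j<N. (f ^^ j) ` range (\<lambda>n. ((f ^^ N) ^^ n) z))"
  proof
    fix x assume "x \<in> range (\<lambda>n. (f ^^ n) z)"
    then obtain n where x: "x = (f ^^ n) z" by blast
    have "(f ^^ n) z = (f ^^ (n mod N)) (((f ^^ N) ^^ (n div N)) z)"
      by (simp add: funpow_mult flip: funpow_add o_apply[of "f ^^ _" "f ^^ _"])
    then show "x \<in> (\<Union>j<N. (f ^^ j) ` range (\<lambda>n. ((f ^^ N) ^^ n) z))"
      using assms unfolding x by (intro UN_I[of "n mod N"]) auto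
  qed
  moreover have "finite (\<Union>j<N. (f ^^ j) ` range (\<lambda>n. ((f ^^ N) ^^ n) z))"
    using z by (auto simp: preperiodic_points_def)
  ultimately show "z \<in> preperiodic_points f"
    unfolding preperiodic_points_def using finite_subset by blast
qed

text \<open>If \<open>Q \<circ> P = Q \<circ> Q\<close> then \<open>Q\<close> sends the orbit of \<open>z\<close> under \<open>P\<close> onto the tail of its orbit
  under \<open>Q\<close>.\<close>

lemma preperiodic_points_subset_if_absorbing:
  assumes "Q \<circ> P = Q \<circ> Q"
  shows "preperiodic_points P \<subseteq> preperiodic_points Q"
proof
  fix z assume z: "z \<in> preperiodic_points P"
  have eq: "(Q ^^ Suc n) w = Q ((P ^^ n) w)" for n w
  proof (induction n arbitrary: w)
    case (Suc n)
    have "(Q ^^ Suc (Suc n)) w = Q (Q ((Q ^^ n) w))"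
      by simp
    also have "\<dots> = Q ((Q ^^ n) (Q w))"
      by (simp add: funpow_swap1)
    also have "\<dots> = Q ((P ^^ n) (Q w))"
      using Suc by simp
    finally have 1: "(Q ^^ Suc (Suc n)) w = Q ((P ^^ n) (Q w))" .
    have "(Q ^^ Suc (Suc n)) w = Q (Q ((P ^^ n) w))"
      using Suc[of w] by simp
    also have "\<dots> = Q (P ((P ^^ n) w))"
      using assms by (metis comp_apply)
    finally show ?case by simp
  qed simp
  have "range (\<lambda>n. (Q ^^ n) z) \<subseteq> insert z (Q ` range (\<lambda>n. (P ^^ n) z))"
  proof
    fix x assume "x \<in> range (\<lambda>n. (Q ^^ n) z)"
    then obtain n where "x = (Q ^^ n) z" by blast
    then show "x \<in> insert z (Q ` range (\<lambda>n. (P ^^ n) z))"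
      using eq by (cases n) auto
  qed
  then show "z \<in> preperiodic_points Q"
    using z finite_subset unfolding preperiodic_points_def by auto
qed

section \<open>Lifts of circle maps and their linearisation\<close>

text \<open>Lifts of weakly monotone circle maps of degree \<open>d\<close> to the universal cover of \<open>\<real>/\<int>\<close>.\<close>

definition circle_lift :: "nat \<Rightarrow> (real \<Rightarrow> real) \<Rightarrow> bool" where
  "circle_lift d \<beta> \<longleftrightarrow> mono \<beta> \<and> continuous_on UNIV \<beta> \<and> (\<forall>x. \<beta> (x + 1) = \<beta> x + real d)"

lemma circle_lift_add_int:
  assumes "circle_lift d \<beta>"
  shows "\<beta> (x + of_int k) = \<beta> x + real d * of_int k"
proof -
  have nat: "\<beta> (x + real n) = \<beta> x + real d * real n" for x n
  proof (induction n)
    case (Suc n)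
    have "\<beta> (x + real (Suc n)) = \<beta> ((x + real n) + 1)"
      by (simp add: algebra_simps)
    also have "\<dots> = \<beta> (x + real n) + real d"
      using assms by (simp add: circle_lift_def)
    finally show ?case
      using Suc by (simp add: algebra_simps)
  qed simp
  show ?thesis
  proof (cases "k \<ge> 0")
    case True
    then show ?thesis using nat[of x "nat k"] by simp
  next
    case False
    then show ?thesis using nat[of "x + of_int k" "nat (- k)"] by (simp add: algebra_simps)
  qed
qed

lemma circle_lift_compose:
  assumes "circle_lift d \<beta>" "circle_lift e \<gamma>"
  shows "circle_lift (d * e) (\<beta> \<circ> \<gamma>)"
proof -
  have "mono (\<beta> \<circ> \<gamma>)"
    using assms by (auto simp: circle_lift_def mono_def)
  moreover have "continuous_on UNIV (\<beta> \<circ> \<gamma>)"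
    using assms by (meson circle_lift_def continuous_on_compose continuous_on_subset top_greatest)
  moreover have "(\<beta> \<circ> \<gamma>) (x + 1) = (\<beta> \<circ> \<gamma>) x + real (d * e)" for x
    using assms circle_lift_add_int[OF assms(1), of "\<gamma> x" "int e"] by (simp add: circle_lift_def)
  ultimately show ?thesis
    by (simp add: circle_lift_def)
qed

lemma circle_lift_id: "circle_lift 1 id"
  by (simp add: circle_lift_def mono_def)

lemma circle_lift_funpow:
  assumes "circle_lift d \<beta>"
  shows "circle_lift (d ^ n) (\<beta> ^^ n)"
proof (induction n)
  case 0
  then show ?case using circle_lift_id by (simp only: funpow.simps power_0)
next
  case (Suc n)
  then show ?case using circle_lift_compose[OF assms Suc] by (simp only: funpow.simps power_Suc)
qed

text \<open>Between consecutive integer translates of \<open>y\<close> both \<open>\<beta>\<close> and the linear map increase by exactly \<open>d\<close>,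
  and both are monotone.\<close>

lemma circle_lift_near_linear:
  assumes "circle_lift d \<beta>"
  shows "\<bar>\<beta> x - \<beta> y - real d * (x - y)\<bar> \<le> real d"
proof -
  define m where "m = \<lfloor>x - y\<rfloor>"
  have m: "of_int m \<le> x - y" "x - y \<le> of_int m + 1"
    unfolding m_def by linarith+
  have "\<beta> (y + of_int m) \<le> \<beta> x" "\<beta> x \<le> \<beta> (y + of_int (m + 1))"
    using assms m by (auto simp: circle_lift_def intro!: monoD[of \<beta>])
  then have 1: "real d * of_int m \<le> \<beta> x - \<beta> y" "\<beta> x - \<beta> y \<le> real d * (of_int m + 1)"
    unfolding circle_lift_add_int[OF assms] by (simp_all add: algebra_simps)
  have 2: "real d * of_int m \<le> real d * (x - y)" "real d * (x - y) \<le> real d * (of_int m + 1)"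
    using m by (auto intro: mult_left_mono)
  show ?thesis
    using 1 2 by (simp add: algebra_simps abs_le_iff)
qed

text \<open>Since \<open>\<beta> x - d x\<close> is bounded, the increments of \<open>\<beta>\<^sup>n / d\<^sup>n\<close> are bounded by a geometric series.\<close>

lemma circle_lift_linearisation:
  assumes lift: "circle_lift d \<beta>" and d: "d \<ge> 2"
  obtains H where "circle_lift 1 H" "\<And>x. H (\<beta> x) = real d * H x"
    "\<And>x. (\<lambda>n. (\<beta> ^^ n) x / real d ^ n) \<longlonglongrightarrow> H x"
proof -
  define C where "C = real d + \<bar>\<beta> 0\<bar>"
  have C: "\<bar>\<beta> x - real d * x\<bar> \<le> C" for x
    using circle_lift_near_linear[OF lift, of x 0] by (simp add: C_def)
  \<comment> \<open>the difference of consecutive terms, so that \<open>H\<close> is \<open>x\<close> plus a telescoping series\<close>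
  define t where "t = (\<lambda>n x. (\<beta> ((\<beta> ^^ n) x) - real d * (\<beta> ^^ n) x) / real d ^ Suc n)"
  have t_bound: "\<bar>t n x\<bar> \<le> C * (1/2) ^ n" for n x
  proof -
    have "\<bar>t n x\<bar> \<le> C / real d ^ Suc n"
      using C[of "(\<beta> ^^ n) x"] by (simp add: t_def divide_right_mono)
    also have "\<dots> \<le> C / 2 ^ n"
    proof (rule divide_left_mono)
      have "(2::real) ^ n \<le> real d ^ n"
        using d by (intro power_mono) auto
      also have "\<dots> \<le> real d ^ Suc n"
        using d by simp
      finally show "(2::real) ^ n \<le> real d ^ Suc n" .
    qed (use d in \<open>auto simp: C_def\<close>)
    finally show ?thesis
      by (simp add: power_divide)
  qed
  have partial: "(\<Sum>i<n. t i x) = (\<beta> ^^ n) x / real d ^ n - x" for n x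
    using d by (induction n) (auto simp: t_def diff_divide_distrib)
  define H where "H = (\<lambda>x. x + (\<Sum>i. t i x))"
  have unif: "uniform_limit UNIV (\<lambda>n x. \<Sum>i<n. t i x) (\<lambda>x. \<Sum>i. t i x) sequentially"
    by (rule Weierstrass_m_test[where M = "\<lambda>n. C * (1/2) ^ n"])
      (use t_bound in \<open>auto intro!: summable_mult summable_geometric\<close>)
  have cont_n: "continuous_on UNIV (\<beta> ^^ n)" for n
    using circle_lift_funpow[OF lift] by (simp add: circle_lift_def)
  have lim: "(\<lambda>n. (\<beta> ^^ n) x / real d ^ n) \<longlonglongrightarrow> H x" for x
  proof -
    have "(\<lambda>n. x + (\<Sum>i<n. t i x)) \<longlonglongrightarrow> x + (\<Sum>i. t i x)"
      by (intro tendsto_intros tendsto_uniform_limitI[OF unif]) auto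
    then show ?thesis
      unfolding partial H_def by simp
  qed
  have "continuous_on UNIV (\<lambda>x. \<Sum>i. t i x)"
  proof (rule uniform_limit_theorem[OF _ unif])
    show "\<forall>\<^sub>F n in sequentially. continuous_on UNIV (\<lambda>x. \<Sum>i<n. t i x)"
      unfolding partial using cont_n d by (intro always_eventually allI continuous_intros) auto
  qed auto
  then have "continuous_on UNIV H"
    unfolding H_def by (intro continuous_intros)
  moreover have "mono H"
  proof (rule monoI)
    fix x y :: real assume "x \<le> y"
    then have "(\<beta> ^^ n) x / real d ^ n \<le> (\<beta> ^^ n) y / real d ^ n" for n
      using circle_lift_funpow[OF lift, of n] by (auto simp: circle_lift_def mono_def intro: divide_right_mono)
    then show "H x \<le> H y"
      by (intro LIMSEQ_le[OF lim lim]) auto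
  qed
  moreover have "H (x + 1) = H x + 1" for x
  proof (rule LIMSEQ_unique[OF lim])
    have "(\<beta> ^^ n) (x + 1) / real d ^ n = (\<beta> ^^ n) x / real d ^ n + 1" for n
      using circle_lift_funpow[OF lift, of n] d by (simp add: circle_lift_def add_divide_distrib)
    then show "(\<lambda>n. (\<beta> ^^ n) (x + 1) / real d ^ n) \<longlonglongrightarrow> H x + 1"
      using tendsto_add[OF lim tendsto_const, of x 1] by simp
  qed
  ultimately have "circle_lift 1 H"
    by (simp add: circle_lift_def)
  moreover have "H (\<beta> x) = real d * H x" for x
  proof (rule LIMSEQ_unique[OF lim])
    have "(\<lambda>n. real d * ((\<beta> ^^ Suc n) x / real d ^ Suc n)) \<longlonglongrightarrow> real d * H x"
      by (intro tendsto_intros LIMSEQ_Suc lim)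
    then show "(\<lambda>n. (\<beta> ^^ n) (\<beta> x) / real d ^ n) \<longlonglongrightarrow> real d * H x"
      using d by (simp add: funpow_swap1)
  qed
  ultimately show ?thesis
    using that lim by blast
qed

text \<open>Pulling back by \<open>\<alpha>\<^sup>N\<close> and normalising contracts functions modulo constants by \<open>d\<^sup>N\<close>, so a common
  left multiple of \<open>\<alpha>\<^sup>N\<close> and \<open>\<beta>\<^sup>N\<close> for every \<open>N\<close> forces the two linearisations to agree.\<close>

lemma linearisations_differ_by_constant:
  assumes \<alpha>: "circle_lift d \<alpha>" "d \<ge> 2" and \<beta>: "circle_lift e \<beta>" "e \<ge> 2"
    and A: "\<And>x. (\<lambda>n. (\<alpha> ^^ n) x / real d ^ n) \<longlonglongrightarrow> A x"
    and B: "\<And>x. (\<lambda>n. (\<beta> ^^ n) x / real e ^ n) \<longlonglongrightarrow> B x"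
    and common: "\<And>N. \<exists>p u q v k. circle_lift p u \<and> circle_lift q v \<and> p \<ge> 1 \<and>
        (\<forall>x. u ((\<alpha> ^^ N) x) = v ((\<beta> ^^ N) x) + k)"
  shows "A x - A y = B x - B y"
proof -
  define \<delta> where "\<delta> = (\<lambda>N. ((\<alpha> ^^ N) x / real d ^ N - (\<alpha> ^^ N) y / real d ^ N)
    - ((\<beta> ^^ N) x / real e ^ N - (\<beta> ^^ N) y / real e ^ N))"
  have bound: "\<bar>\<delta> N\<bar> \<le> 2 * (1/2) ^ N" for N
  proof -
    obtain p u q v k where u: "circle_lift p u" and v: "circle_lift q v" and "p \<ge> 1"
      and eq: "\<And>x. u ((\<alpha> ^^ N) x) = v ((\<beta> ^^ N) x) + k"
      using common[of N] by blast
    have "circle_lift (p * d ^ N) (u \<circ> (\<alpha> ^^ N))" "circle_lift (q * e ^ N) (v \<circ> (\<beta> ^^ N))"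
      by (intro circle_lift_compose circle_lift_funpow u v \<alpha> \<beta>)+
    then have "u ((\<alpha> ^^ N) (0 + 1)) = u ((\<alpha> ^^ N) 0) + real (p * d ^ N)"
      "v ((\<beta> ^^ N) (0 + 1)) = v ((\<beta> ^^ N) 0) + real (q * e ^ N)"
      unfolding circle_lift_def comp_def by blast+
    then have deg: "real p * real d ^ N = real q * real e ^ N"
      unfolding eq by simp
    define D where "D = real p * real d ^ N"
    have "D > 0"
      using \<open>p \<ge> 1\<close> \<alpha>(2) by (simp add: D_def)
    have "q > 0"
      using deg \<open>D > 0\<close> by (auto simp: D_def intro: Nat.gr0I)
    have near: "\<bar>(m s - m t) / D - (s / r ^ N - t / r ^ N)\<bar> \<le> (1/2) ^ N"
      if m: "circle_lift n m" and n: "n > 0" "D = real n * r ^ N" and r: "r \<ge> 2" for n m s t and r :: real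
    proof -
      have "s / r ^ N - t / r ^ N = real n * (s - t) / D"
        using n r by (simp add: diff_divide_distrib)
      then have "\<bar>(m s - m t) / D - (s / r ^ N - t / r ^ N)\<bar> = \<bar>m s - m t - real n * (s - t)\<bar> / D"
        using \<open>D > 0\<close> by (simp add: diff_divide_distrib[symmetric])
      also have "\<dots> \<le> real n / D"
        using circle_lift_near_linear[OF m] \<open>D > 0\<close> by (intro divide_right_mono) auto
      also have "\<dots> = (1 / r) ^ N"
        using n r by (simp add: power_divide)
      also have "\<dots> \<le> (1/2) ^ N"
        using r by (intro power_mono divide_left_mono) auto
      finally show ?thesis .
    qed
    have 1: "\<bar>(u ((\<alpha> ^^ N) x) - u ((\<alpha> ^^ N) y)) / D - ((\<alpha> ^^ N) x / real d ^ N - (\<alpha> ^^ N) y / real d ^ N)\<bar> \<le> (1/2) ^ N"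
      by (rule near[OF u]) (use \<open>p \<ge> 1\<close> \<alpha>(2) in \<open>auto simp: D_def\<close>)
    have 2: "\<bar>(v ((\<beta> ^^ N) x) - v ((\<beta> ^^ N) y)) / D - ((\<beta> ^^ N) x / real e ^ N - (\<beta> ^^ N) y / real e ^ N)\<bar> \<le> (1/2) ^ N"
      by (rule near[OF v]) (use \<open>q > 0\<close> \<beta>(2) deg in \<open>auto simp: D_def\<close>)
    show ?thesis
      using 1 2 unfolding \<delta>_def eq by simp
  qed
  have "\<delta> \<longlonglongrightarrow> 0"
  proof (rule Lim_null_comparison)
    show "\<forall>\<^sub>F n in sequentially. norm (\<delta> n) \<le> 2 * (1/2) ^ n"
      using bound by simp
    show "(\<lambda>n. 2 * (1/2::real) ^ n) \<longlonglongrightarrow> 0"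
      by real_asymp
  qed
  moreover have "\<delta> \<longlonglongrightarrow> (A x - A y) - (B x - B y)"
    unfolding \<delta>_def by (intro tendsto_intros A B)
  ultimately show ?thesis
    using LIMSEQ_unique by fastforce
qed

text \<open>A plateau of a monotone function contains a rational, so only countably many values are attained
  more than once; a semiconjugacy is therefore injective enough to recover a map on an infinite set.\<close>

lemma agree_infinitely_if_same_semiconjugate:
  assumes H: "circle_lift 1 H" and \<beta>: "circle_lift d \<beta>" "d \<ge> 1"
    and eq: "\<And>x. H (\<beta> x) = H (\<gamma> x)"
  shows "infinite {x \<in> {0..<1}. \<beta> x = \<gamma> x}"
proof
  assume fin: "finite {x \<in> {0..<1}. \<beta> x = \<gamma> x}"
  define Q where "Q = H ` \<rat>"
  have plateau: "H a \<in> Q" if "a < b" "H a = H b" for a b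
  proof -
    obtain r where "r \<in> \<rat>" "a < r" "r < b"
      using Rats_dense_in_real \<open>a < b\<close> by blast
    moreover have "mono H"
      using H by (simp add: circle_lift_def)
    ultimately have "H a = H r"
      using that by (metis less_eq_real_def monoD order_antisym)
    then show ?thesis
      using \<open>r \<in> \<rat>\<close> by (simp add: Q_def)
  qed
  define c where "c = H (\<beta> 0)"
  have lift: "circle_lift d (H \<circ> \<beta>)"
    using circle_lift_compose[OF H \<beta>(1)] by simp
  \<comment> \<open>\<open>H \<circ> \<beta>\<close> takes every value of an interval; where the value is not a plateau value, \<open>\<beta> x = \<gamma> x\<close>\<close>
  have "{c..<c + real d} \<subseteq> Q \<union> (\<lambda>x. H (\<beta> x)) ` {x \<in> {0..<1}. \<beta> x = \<gamma> x}"
  proof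
    fix y assume y: "y \<in> {c..<c + real d}"
    have one: "H (\<beta> 1) = c + real d"
      using lift unfolding circle_lift_def c_def comp_def by (metis add_0)
    have cont: "continuous_on {0..1} (\<lambda>x. H (\<beta> x))"
      using lift unfolding circle_lift_def comp_def by (meson continuous_on_subset subset_UNIV)
    obtain x where x: "0 \<le> x" "x \<le> 1" "H (\<beta> x) = y"
      using IVT'[of "\<lambda>x. H (\<beta> x)" 0 y 1, OF _ _ _ cont] y one by (auto simp: c_def)
    then have "x \<in> {0..<1}"
      using one y by (cases "x = 1") auto
    show "y \<in> Q \<union> (\<lambda>x. H (\<beta> x)) ` {x \<in> {0..<1}. \<beta> x = \<gamma> x}"
    proof (cases "\<beta> x = \<gamma> x")
      case True
      then show ?thesis using x \<open>x \<in> {0..<1}\<close> by auto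
    next
      case False
      then have "H (\<beta> x) \<in> Q"
        using plateau[of "\<beta> x" "\<gamma> x"] plateau[of "\<gamma> x" "\<beta> x"] eq[of x] by (cases "\<beta> x" "\<gamma> x" rule: linorder_cases) auto
      then show ?thesis using x by simp
    qed
  qed
  moreover have "countable (Q \<union> (\<lambda>x. H (\<beta> x)) ` {x \<in> {0..<1}. \<beta> x = \<gamma> x})"
    using fin countable_rat by (auto simp: Q_def intro: countable_finite)
  ultimately have "countable {c..<c + real d}"
    using countable_subset by blast
  then show False
    using \<beta>(2) uncountable_half_open_interval_1[of c "c + real d"] by simp
qed

section \<open>Finite Blaschke products\<close>

text \<open>The bound \<open>\<bar>B\<bar> \<le> 1\<close> is not strict because unimodular constants are what remains after all zeros have
  been divided out.\<close>

definition boundary_unimodular :: "(complex \<Rightarrow> complex) \<Rightarrow> bool" where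
  "boundary_unimodular B \<longleftrightarrow> B holomorphic_on ball 0 1 \<and> (\<forall>z\<in>ball 0 1. norm (B z) \<le> 1) \<and>
     (\<forall>r<1. \<exists>s<1. \<forall>z. s < norm z \<and> norm z < 1 \<longrightarrow> r < norm (B z))"

abbreviation disc_factor :: "complex \<Rightarrow> complex \<Rightarrow> complex" where
  "disc_factor a \<equiv> Moebius_function 0 a"

lemma disc_factor_denominator:
  assumes "norm a < 1" "norm z \<le> 1"
  shows "1 - cnj a * z \<noteq> 0"
proof
  assume "1 - cnj a * z = 0"
  then have "norm (cnj a * z) = 1"
    by simp
  moreover have "norm (cnj a * z) < 1"
    using assms by (simp add: norm_mult) (smt (verit) mult_left_le norm_ge_zero)
  ultimately show False
    by simp
qed

lemma disc_factor_analytic: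
  assumes "norm a < 1"
  shows "disc_factor a analytic_on cball 0 1"
  unfolding Moebius_function_def
  by (intro analytic_intros) (use disc_factor_denominator[OF assms] in auto)

lemma norm_disc_factor_sphere:
  assumes "norm a < 1" "norm z = 1"
  shows "norm (disc_factor a z) = 1"
proof -
  have zz: "z * cnj z = 1"
    using assms(2) by (simp add: complex_norm_square[symmetric])
  have "z * cnj (z - a) = 1 - cnj a * z"
    by (simp add: algebra_simps zz)
  then have "norm (1 - cnj a * z) = norm z * norm (cnj (z - a))"
    by (metis norm_mult)
  then have "norm (1 - cnj a * z) = norm (z - a)"
    using assms(2) by (metis complex_mod_cnj mult_1)
  then show ?thesis
    using disc_factor_denominator[OF assms(1), of z] assms(2)
    by (metis Moebius_function_simple divide_self norm_divide norm_eq_zero order_refl)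
qed

text \<open>The set where \<open>\<bar>disc_factor a\<bar> \<le> r\<close> is compact and misses the unit circle.\<close>

lemma disc_factor_near_boundary:
  assumes "norm a < 1" "r < 1"
  shows "\<exists>s<1. \<forall>z. s < norm z \<and> norm z < 1 \<longrightarrow> r < norm (disc_factor a z)"
proof -
  define K where "K = {z \<in> cball 0 1. norm (disc_factor a z) \<le> r}"
  have cont: "continuous_on (cball 0 1) (disc_factor a)"
    by (intro holomorphic_on_imp_continuous_on analytic_imp_holomorphic disc_factor_analytic assms)
  then have "closed K"
    unfolding K_def by (intro continuous_on_closed_Collect_le continuous_intros cont) auto
  moreover have "bounded K"
    unfolding K_def by (rule bounded_subset[OF bounded_cball[of 0 1]]) auto
  ultimately have "compact K"
    by (simp add: compact_eq_bounded_closed)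
  have far: "r < norm (disc_factor a z)" if "z \<notin> K" "norm z < 1" for z
    using that by (simp add: K_def)
  show ?thesis
  proof (cases "K = {}")
    case True
    then have "\<forall>z. 0 < norm z \<and> norm z < 1 \<longrightarrow> r < norm (disc_factor a z)"
      using far by blast
    then show ?thesis
      using zero_less_one by blast
  next
    case False
    then obtain m where m: "m \<in> K" "\<And>z. z \<in> K \<Longrightarrow> norm z \<le> norm m"
      using continuous_attains_sup[OF \<open>compact K\<close>, of norm] continuous_on_norm_id by blast
    have "norm m < 1"
      using m(1) norm_disc_factor_sphere[OF assms(1), of m] assms(2) by (force simp: K_def)
    moreover have "\<forall>z. norm m < norm z \<and> norm z < 1 \<longrightarrow> r < norm (disc_factor a z)"
      using far m(2) by (meson not_le)
    ultimately show ?thesis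
      by blast
  qed
qed

lemma norm_le_1_from_boundary:
  assumes g: "g holomorphic_on ball 0 1"
    and bd: "\<And>K. K > 1 \<Longrightarrow> \<exists>s<1. \<forall>z. s < norm z \<and> norm z < 1 \<longrightarrow> norm (g z) \<le> K"
    and z: "norm z < 1"
  shows "norm (g z) \<le> 1"
proof (rule field_le_epsilon)
  fix e :: real assume "e > 0"
  then obtain s where s: "s < 1" "\<And>w. s < norm w \<Longrightarrow> norm w < 1 \<Longrightarrow> norm (g w) \<le> 1 + e"
    using bd[of "1 + e"] by auto
  obtain t where t: "max s (norm z) < t" "t < 1"
    using s(1) z dense[of "max s (norm z)" 1] by auto
  show "norm (g z) \<le> 1 + e"
  proof (rule maximum_modulus_frontier[of g "cball 0 t"])
    show "g holomorphic_on interior (cball 0 t)"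
      using t by (intro holomorphic_on_subset[OF g]) auto
    show "continuous_on (closure (cball 0 t)) g"
      using t by (intro holomorphic_on_imp_continuous_on holomorphic_on_subset[OF g]) auto
    show "norm (g w) \<le> 1 + e" if "w \<in> frontier (cball 0 t)" for w
      using that t s(2)[of w] by (auto simp: frontier_cball)
  qed (use t in auto)
qed

text \<open>The quotient by a disc factor extends over the zero, and since the factor has modulus close to one
  near the circle, the maximum principle bounds the quotient by one.\<close>

lemma boundary_unimodular_divide:
  assumes B: "boundary_unimodular B" and a: "norm a < 1" "B a = 0"
  obtains B' where "boundary_unimodular B'" "\<And>z. norm z < 1 \<Longrightarrow> B z = disc_factor a z * B' z"
proof -
  define B' where "B' = (\<lambda>z. (1 - cnj a * z) * (if z = a then deriv B a else (B z - B a) / (z - a)))"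
  have hol: "B holomorphic_on ball 0 1"
    using B by (simp add: boundary_unimodular_def)
  have hol': "B' holomorphic_on ball 0 1"
    unfolding B'_def using pole_lemma_open[OF hol] by (intro holomorphic_intros) auto
  have eq: "B z = disc_factor a z * B' z" if "norm z < 1" for z
    using disc_factor_denominator[of a z] a that by (auto simp: B'_def Moebius_function_simple)
  have le1: "norm (B' z) \<le> 1" if "norm z < 1" for z
  proof (rule norm_le_1_from_boundary[OF hol' _ that])
    fix K :: real assume "K > 1"
    then obtain s where s: "s < 1" "\<And>z. s < norm z \<Longrightarrow> norm z < 1 \<Longrightarrow> 1 / K < norm (disc_factor a z)"
      using disc_factor_near_boundary[OF a(1), of "1 / K"] by auto
    have "norm (B' z) \<le> K" if "s < norm z" "norm z < 1" for z
    proof -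
      have "norm (disc_factor a z) * norm (B' z) \<le> 1"
        using B that eq by (auto simp: boundary_unimodular_def norm_mult[symmetric])
      moreover have "1 / K * norm (B' z) \<le> norm (disc_factor a z) * norm (B' z)"
        using s(2)[OF that] by (intro mult_right_mono) auto
      ultimately have "1 / K * norm (B' z) \<le> 1"
        by linarith
      then show ?thesis
        using \<open>K > 1\<close> by (simp add: field_simps)
    qed
    then show "\<exists>s<1. \<forall>z. s < norm z \<and> norm z < 1 \<longrightarrow> norm (B' z) \<le> K"
      using s(1) by blast
  qed
  have ge: "norm (B z) \<le> norm (B' z)" if "norm z < 1" for z
    using eq[OF that] Moebius_function_norm_lt_1[OF a(1) that, of 0]
    by (simp add: norm_mult mult_left_le_one_le)
  have "\<exists>s<1. \<forall>z. s < norm z \<and> norm z < 1 \<longrightarrow> r < norm (B' z)" if "r < 1" for r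
  proof -
    have "\<forall>r<1. \<exists>s<1. \<forall>z. s < norm z \<and> norm z < 1 \<longrightarrow> r < norm (B z)"
      using B by (simp add: boundary_unimodular_def)
    then obtain s where "s < 1" "\<forall>z. s < norm z \<and> norm z < 1 \<longrightarrow> r < norm (B z)"
      using \<open>r < 1\<close> by auto
    then show ?thesis
      using ge less_le_trans[of r] by (intro exI[of _ s]) blast
  qed
  then have "boundary_unimodular B'"
    using hol' le1 by (simp add: boundary_unimodular_def)
  then show ?thesis
    using that eq by blast
qed

text \<open>The maximum principle applies to \<open>B\<close> and to its inverse.\<close>

lemma boundary_unimodular_zero_free:
  assumes B: "boundary_unimodular B" and nz: "\<And>z. norm z < 1 \<Longrightarrow> B z \<noteq> 0"
  obtains c where "norm c = 1" "\<And>z. norm z < 1 \<Longrightarrow> B z = c"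
proof -
  have hol: "B holomorphic_on ball 0 1"
    using B by (simp add: boundary_unimodular_def)
  have inv: "norm (inverse (B z)) \<le> 1" if "norm z < 1" for z
  proof (rule norm_le_1_from_boundary[OF _ _ that])
    show "(\<lambda>z. inverse (B z)) holomorphic_on ball 0 1"
      using nz by (intro holomorphic_intros hol) auto
    fix K :: real assume "K > 1"
    then obtain s where s: "s < 1" "\<And>z. s < norm z \<Longrightarrow> norm z < 1 \<Longrightarrow> 1 / K < norm (B z)"
      using B unfolding boundary_unimodular_def by (metis divide_less_eq_1_pos less_trans zero_less_one)
    have "norm (inverse (B z)) \<le> K" if "s < norm z" "norm z < 1" for z
      using s(2)[OF that] nz[OF that(2)] \<open>K > 1\<close> by (simp add: norm_inverse norm_divide field_simps)
    then show "\<exists>s<1. \<forall>z. s < norm z \<and> norm z < 1 \<longrightarrow> norm (inverse (B z)) \<le> K"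
      using s(1) by blast
  qed
  have one: "norm (B z) = 1" if "norm z < 1" for z
  proof -
    have "norm (B z) \<le> 1"
      using B that by (simp add: boundary_unimodular_def)
    moreover have "1 \<le> norm (B z)"
      using inv[OF that] nz[OF that] by (simp add: norm_inverse norm_divide field_simps)
    ultimately show ?thesis by simp
  qed
  have "B constant_on ball 0 1"
    by (rule maximum_modulus_principle[OF hol, of "ball 0 1" 0]) (use one in auto)
  then show ?thesis
    using that one by (auto simp: constant_on_def) (metis norm_zero zero_less_one)
qed

text \<open>At a point \<open>z\<^sub>0\<close> closer to the circle than every zero, each factor has modulus at most some
  \<open>\<rho> < 1\<close>, so \<open>\<bar>B z\<^sub>0\<bar> > 0\<close> bounds the number of factors that can be split off. A factorisation
  with the largest possible number of factors leaves a zero-free quotient.\<close>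

theorem finite_Blaschke_factorisation:
  assumes B: "boundary_unimodular B"
  obtains c as where "norm c = 1" "\<And>a. a \<in> set as \<Longrightarrow> norm a < 1"
    "\<And>z. norm z < 1 \<Longrightarrow> B z = c * (\<Prod>a\<leftarrow>as. disc_factor a z)"
proof -
  define P where "P = (\<lambda>n. \<exists>as B'. length as = n \<and> (\<forall>a\<in>set as. norm a < 1) \<and> boundary_unimodular B' \<and>
    (\<forall>z. norm z < 1 \<longrightarrow> B z = (\<Prod>a\<leftarrow>as. disc_factor a z) * B' z))"
  have "P 0"
    unfolding P_def using B by (intro exI[of _ "[]"] exI[of _ B]) simp
  obtain s where s: "s < 1" "\<And>z. s < norm z \<Longrightarrow> norm z < 1 \<Longrightarrow> 0 < norm (B z)"
    using B unfolding boundary_unimodular_def by (meson zero_less_one)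
  obtain t where t: "max s 0 < t" "t < 1"
    using s(1) dense[of "max s 0" 1] by auto
  define z0 where "z0 = complex_of_real t"
  have z0: "norm z0 < 1" "s < norm z0"
    using t by (auto simp: z0_def)
  have "B z0 \<noteq> 0"
    using s(2) z0 by force
  obtain \<rho> where \<rho>: "0 \<le> \<rho>" "\<rho> < 1" "\<And>a. norm a \<le> max s 0 \<Longrightarrow> norm (disc_factor a z0) \<le> \<rho>"
  proof -
    have den: "1 - cnj a * z0 \<noteq> 0" if "a \<in> cball 0 (max s 0)" for a
      using disc_factor_denominator[of a z0] that s(1) z0(1) by (auto simp: max_def split: if_splits)
    have "continuous_on (cball 0 (max s 0)) (\<lambda>a. norm (disc_factor a z0))"
      unfolding Moebius_function_def by (intro continuous_intros) (use den in auto)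
    then obtain m where m: "m \<in> cball 0 (max s 0)"
        "\<And>a. a \<in> cball 0 (max s 0) \<Longrightarrow> norm (disc_factor a z0) \<le> norm (disc_factor m z0)"
      using continuous_attains_sup[of "cball 0 (max s 0)" "\<lambda>a. norm (disc_factor a z0)"] by force
    have "norm m < 1"
      using m(1) s(1) by auto
    then show ?thesis
      using that[of "norm (disc_factor m z0)"] m(2) Moebius_function_norm_lt_1[OF _ z0(1), of m 0] by auto
  qed
  obtain n0 where n0: "\<rho> ^ n0 < norm (B z0)"
    using real_arch_pow_inv[of "norm (B z0)" \<rho>] \<open>B z0 \<noteq> 0\<close> \<rho>(2) by auto
  have bound: "n \<le> n0" if "P n" for n
  proof (rule ccontr)
    assume "\<not> n \<le> n0"
    obtain as B' where as: "length as = n" "\<forall>a\<in>set as. norm a < 1" "boundary_unimodular B'"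
      and eq: "\<forall>z. norm z < 1 \<longrightarrow> B z = (\<Prod>a\<leftarrow>as. disc_factor a z) * B' z"
      using \<open>P n\<close> unfolding P_def by blast
    have zero: "norm a \<le> max s 0" if "a \<in> set as" for a
    proof (rule ccontr)
      assume "\<not> norm a \<le> max s 0"
      then have "B a \<noteq> 0"
        using s(2)[of a] as(2) that by force
      moreover have "(\<Prod>b\<leftarrow>as. disc_factor b a) = 0"
        using that Moebius_function_eq_zero[of 0 a] by (force simp: prod_list_zero_iff image_iff)
      ultimately show False
        using eq as(2) that by auto
    qed
    have "norm (\<Prod>a\<leftarrow>as. disc_factor a z0) \<le> \<rho> ^ length as"
      using zero
    proof (induction as)
      case (Cons a as)
      then show ?case
        using \<rho> by (auto simp: norm_mult intro!: mult_mono)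
    qed simp
    moreover have "norm (B' z0) \<le> 1"
      using as(3) z0(1) by (simp add: boundary_unimodular_def)
    ultimately have "norm (B z0) \<le> \<rho> ^ n * 1"
      unfolding eq[rule_format, OF z0(1)] norm_mult as(1)[symmetric]
      by (intro mult_mono) (use \<rho> in auto)
    also have "\<dots> \<le> \<rho> ^ n0"
      using \<rho> \<open>\<not> n \<le> n0\<close> by (simp add: power_decreasing)
    finally show False
      using n0 by simp
  qed
  define n where "n = (GREATEST n. P n)"
  have "P n"
    unfolding n_def by (rule GreatestI_nat[of P 0 n0]) (use \<open>P 0\<close> bound in auto)
  then obtain as B' where as: "length as = n" "\<forall>a\<in>set as. norm a < 1" "boundary_unimodular B'"
    and eq: "\<And>z. norm z < 1 \<Longrightarrow> B z = (\<Prod>a\<leftarrow>as. disc_factor a z) * B' z"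
    unfolding P_def by blast
  have "B' z \<noteq> 0" if z: "norm z < 1" for z
  proof
    assume "B' z = 0"
    then obtain B'' where "boundary_unimodular B''" "\<And>w. norm w < 1 \<Longrightarrow> B' w = disc_factor z w * B'' w"
      using boundary_unimodular_divide[OF as(3) z] by blast
    then have "P (Suc n)"
      unfolding P_def using as eq z by (intro exI[of _ "z # as"] exI[of _ B'']) auto
    then have "Suc n \<le> n"
      using Greatest_le_nat[of P "Suc n" n0] bound by (simp add: n_def)
    then show False by simp
  qed
  then obtain c where "norm c = 1" "\<And>z. norm z < 1 \<Longrightarrow> B' z = c"
    using boundary_unimodular_zero_free[OF as(3)] by blast
  then show ?thesis
    using that[of c as] as eq by (simp add: mult.commute)
qed


section \<open>Boundary values of Blaschke products\<close>

definition circle_point :: "real \<Rightarrow> complex" where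
  "circle_point x = cis (2 * pi * x)"

lemma norm_circle_point [simp]: "norm (circle_point x) = 1"
  by (simp add: circle_point_def)

lemma circle_point_add: "circle_point (x + y) = circle_point x * circle_point y"
  by (simp add: circle_point_def cis_mult distrib_left)

lemma circle_point_eq_iff: "circle_point x = circle_point y \<longleftrightarrow> (\<exists>k::int. x = y + of_int k)"
proof -
  have "circle_point x / circle_point y = cis (2 * pi * (x - y))"
    unfolding circle_point_def by (simp only: cis_divide right_diff_distrib)
  moreover have "circle_point y \<noteq> 0"
    by (simp add: circle_point_def)
  ultimately have "circle_point x = circle_point y \<longleftrightarrow> cis (2 * pi * (x - y)) = 1"
    by (auto simp: divide_eq_1_iff)
  also have "\<dots> \<longleftrightarrow> (\<exists>k::int. 2 * pi * (x - y) = 2 * pi * of_int k)"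
    unfolding cis_eq_1_iff by (auto simp: mult.commute)
  also have "\<dots> \<longleftrightarrow> (\<exists>k::int. x = y + of_int k)"
    by (auto simp: diff_eq_eq add.commute)
  finally show ?thesis .
qed

text \<open>The extension \<open>E\<close> is required to be analytic across the circle, not just continuous, so that the
  identity theorem can be applied at boundary points.\<close>

definition boundary_lift :: "(complex \<Rightarrow> complex) \<Rightarrow> nat \<Rightarrow> (real \<Rightarrow> real) \<Rightarrow> bool" where
  "boundary_lift B d \<beta> \<longleftrightarrow> circle_lift d \<beta> \<and> B ` ball 0 1 \<subseteq> ball 0 1 \<and>
     (\<exists>E. E analytic_on cball 0 1 \<and> (\<forall>z\<in>ball 0 1. E z = B z) \<and>
          (\<forall>x. E (circle_point x) = circle_point (\<beta> x)))"

text \<open>On the unit circle \<open>disc_factor a z = z * (w / cnj w)\<close> with \<open>w = 1 - a * cnj z\<close>. As \<open>Re w > 0\<close>,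
  the principal argument of \<open>w\<close> is smooth, and the lift is obtained by adding twice this argument to the
  angle of \<open>z\<close>. The derivative is the Poisson kernel \<open>(1 - \<bar>q\<bar>\<^sup>2) / \<bar>1 - q\<bar>\<^sup>2\<close> at \<open>q = a * cnj z\<close>, whence monotonicity.\<close>

lemma disc_factor_lift:
  assumes "norm a < 1"
  obtains \<beta> where "circle_lift 1 \<beta>" "\<And>x. disc_factor a (circle_point x) = circle_point (\<beta> x)"
proof -
  define w where "w = (\<lambda>x. 1 - a * cnj (circle_point x))"
  define \<beta> where "\<beta> = (\<lambda>x. x + Im (Ln (w x)) / pi)"
  have lt: "norm (a * cnj (circle_point x)) < 1" for x
    using assms by (simp add: norm_mult)
  have Re: "Re (w x) > 0" for x
    using complex_Re_le_cmod[of "a * cnj (circle_point x)"] lt[of x] unfolding w_def by (simp del: complex_cnj_cnj)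
  then have w: "w x \<notin> \<real>\<^sub>\<le>\<^sub>0" "w x \<noteq> 0" for x
    by (metis complex_nonpos_Reals_iff not_le) (metis Re less_irrefl zero_complex.sel(1))
  have w_deriv: "(w has_vector_derivative (2 * pi * \<i>) * (a * cnj (circle_point x))) (at x)" for x
  proof -
    have e: "cnj (circle_point x) = exp (- (2 * pi * \<i>) * of_real x)" for x
      by (simp only: circle_point_def cis_cnj cis_conv_exp[of "- (2 * pi * x)"]) (simp add: algebra_simps)
    then have "w = (\<lambda>x. 1 - a * exp (- (2 * pi * \<i>) * of_real x))"
      by (simp add: w_def)
    moreover have "((\<lambda>x. 1 - a * exp (- (2 * pi * \<i>) * of_real x)) has_vector_derivative
        (2 * pi * \<i>) * (a * exp (- (2 * pi * \<i>) * of_real x))) (at x)"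
    proof -
      have "((\<lambda>z. 1 - a * exp (- (2 * pi * \<i>) * z)) has_field_derivative
        (2 * pi * \<i>) * (a * exp (- (2 * pi * \<i>) * of_real x))) (at (of_real x))"
        by (auto intro!: derivative_eq_intros simp: algebra_simps)
      then show ?thesis
        by (rule has_vector_derivative_real_field)
    qed
    ultimately show ?thesis
      unfolding e by simp
  qed
  have deriv: "(\<beta> has_real_derivative 1 + Im (2 * pi * \<i> * (a * cnj (circle_point x)) / w x) / pi) (at x)" for x
  proof -
    have "((\<lambda>x. Ln (w x)) has_vector_derivative (2 * pi * \<i>) * (a * cnj (circle_point x)) * inverse (w x)) (at x)"
      using field_vector_diff_chain_at[OF w_deriv has_field_derivative_Ln[OF w(1)]] by (simp add: comp_def)
    then have "((\<lambda>x. Im (Ln (w x))) has_vector_derivative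
        Im ((2 * pi * \<i>) * (a * cnj (circle_point x)) * inverse (w x))) (at x)"
      by (rule bounded_linear.has_vector_derivative[OF bounded_linear_Im])
    then have "((\<lambda>x. Im (Ln (w x))) has_real_derivative
        Im ((2 * pi * \<i>) * (a * cnj (circle_point x)) * inverse (w x))) (at x)"
      by (simp add: has_real_derivative_iff_has_vector_derivative)
    then show ?thesis
      unfolding \<beta>_def divide_inverse[of _ "w x"] by (intro DERIV_add DERIV_ident DERIV_cdivide)
  qed
  have pos: "1 + Im (2 * pi * \<i> * (a * cnj (circle_point x)) / w x) / pi \<ge> 0" for x
  proof -
    define q where "q = a * cnj (circle_point x)"
    have q: "norm q < 1" "w x = 1 - q" "1 - q \<noteq> 0"
      using lt[of x] w(2)[of x] by (auto simp: q_def w_def)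
    have "2 * pi * \<i> * q / (1 - q) = of_real (2 * pi) * (\<i> * (q / (1 - q)))"
      by simp
    then have "Im (2 * pi * \<i> * q / (1 - q)) = 2 * pi * Re (q / (1 - q))"
      by (simp only: Im_complex_of_real Re_complex_of_real times_complex.sel) simp
    then have "1 + Im (2 * pi * \<i> * q / (1 - q)) / pi = 1 + 2 * Re (q / (1 - q))"
      by simp
    also have "\<dots> = Re (1 + 2 * (q / (1 - q)))"
      by (simp only: plus_complex.sel one_complex.sel times_complex.sel) simp
    also have "1 + 2 * (q / (1 - q)) = (1 + q) / (1 - q)"
      using q(3) by (simp add: field_simps)
    also have "Re \<dots> = (1 - (norm q)\<^sup>2) / (norm (1 - q))\<^sup>2"
      by (simp add: Re_divide cmod_power2) (simp add: power2_eq_square algebra_simps)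
    also have "\<dots> \<ge> 0"
      using q(1) by (simp add: power_le_one)
    finally show ?thesis
      unfolding q(2) q_def[symmetric] .
  qed
  have "mono \<beta>"
  proof (rule monoI)
    fix x y :: real assume "x \<le> y"
    show "\<beta> x \<le> \<beta> y"
      by (rule DERIV_nonneg_imp_nondecreasing[OF \<open>x \<le> y\<close>]) (rule exI conjI deriv pos)+
  qed
  moreover have "continuous_on UNIV \<beta>"
    by (intro DERIV_continuous_on[where D = "\<lambda>x. 1 + Im (2 * pi * \<i> * (a * cnj (circle_point x)) / w x) / pi"]
        has_field_derivative_at_within[OF deriv])
  moreover have "\<beta> (x + 1) = \<beta> x + 1" for x
  proof -
    have "w (x + 1) = w x"
    proof -
      have "circle_point (x + 1) = circle_point x"
        unfolding circle_point_eq_iff by (rule exI[of _ 1]) simp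
      then show ?thesis
        by (simp add: w_def)
    qed
    then show ?thesis
      by (simp add: \<beta>_def)
  qed
  ultimately have "circle_lift 1 \<beta>"
    by (simp add: circle_lift_def)
  moreover have "disc_factor a (circle_point x) = circle_point (\<beta> x)" for x
  proof -
    define t where "t = Im (Ln (w x))"
    have wt: "w x = of_real (exp (Re (Ln (w x)))) * cis t"
      using exp_Ln[OF w(2)] unfolding t_def by (metis exp_eq_polar)
    have cwt: "cnj (w x) = of_real (exp (Re (Ln (w x)))) * cis (- t)"
      by (subst wt) (simp add: cis_cnj)
    have "w x / cnj (w x) = cis t / cis (- t)"
      unfolding cwt by (subst wt) simp
    then have quot: "w x / cnj (w x) = cis (2 * t)"
      by (simp add: cis_divide)
    have zz: "circle_point x * cnj (circle_point x) = 1"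
      by (simp add: complex_norm_square[symmetric])
    have "circle_point x - a = circle_point x * w x"
      by (simp add: w_def algebra_simps zz)
    moreover have "1 - cnj a * circle_point x = cnj (w x)"
      by (simp add: w_def)
    ultimately have "disc_factor a (circle_point x) = circle_point x * (w x / cnj (w x))"
      by (simp add: Moebius_function_simple)
    also have "\<dots> = circle_point (\<beta> x)"
      unfolding quot \<beta>_def t_def circle_point_def by (simp add: cis_mult distrib_left)
    finally show ?thesis .
  qed
  ultimately show ?thesis
    using that by blast
qed

lemma circle_lift_add:
  assumes "circle_lift d \<beta>" "circle_lift e \<gamma>"
  shows "circle_lift (d + e) (\<lambda>x. \<beta> x + \<gamma> x)"
  using assms unfolding circle_lift_def mono_def
  by (simp add: continuous_on_add add_mono)

lemma Blaschke_product_boundary_lift: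
  assumes B: "B ` ball 0 1 \<subseteq> ball 0 1" and c: "norm c = 1" and as: "\<And>a. a \<in> set as \<Longrightarrow> norm a < 1"
    and eq: "\<And>z. norm z < 1 \<Longrightarrow> B z = c * (\<Prod>a\<leftarrow>as. disc_factor a z)"
  obtains \<beta> where "boundary_lift B (length as) \<beta>"
proof -
  have an: "(\<lambda>z. \<Prod>a\<leftarrow>as. disc_factor a z) analytic_on cball 0 1"
    using as
  proof (induction as)
    case (Cons a as)
    then have "(\<lambda>z. disc_factor a z * (\<Prod>b\<leftarrow>as. disc_factor b z)) analytic_on cball 0 1"
      by (intro analytic_on_mult disc_factor_analytic) auto
    then show ?case by simp
  qed simp
  obtain \<gamma> where \<gamma>: "circle_lift (length as) \<gamma>"
    "\<And>x. (\<Prod>a\<leftarrow>as. disc_factor a (circle_point x)) = circle_point (\<gamma> x)"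
    using as
  proof (induction as arbitrary: thesis)
    case Nil
    show ?case
      by (rule Nil(1)[of "\<lambda>_. 0"]) (auto simp: circle_lift_def mono_def circle_point_def)
  next
    case (Cons a as)
    obtain \<gamma> where \<gamma>: "circle_lift (length as) \<gamma>"
      "\<And>x. (\<Prod>a\<leftarrow>as. disc_factor a (circle_point x)) = circle_point (\<gamma> x)"
      using Cons by auto
    obtain \<alpha> where \<alpha>: "circle_lift 1 \<alpha>" "\<And>x. disc_factor a (circle_point x) = circle_point (\<alpha> x)"
      using disc_factor_lift Cons.prems(2) by (metis list.set_intros(1))
    show ?case
      by (rule Cons.prems(1)[of "\<lambda>x. \<alpha> x + \<gamma> x"])
        (use circle_lift_add[OF \<alpha>(1) \<gamma>(1)] \<alpha>(2) \<gamma>(2) in \<open>simp_all add: circle_point_add\<close>)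
  qed
  obtain t where t: "c = cis t"
    using c by (metis complex_norm_eq_1_exp cis_conv_exp)
  define \<beta> where "\<beta> = (\<lambda>x. t / (2 * pi) + \<gamma> x)"
  have "circle_lift (length as) \<beta>"
    using \<gamma>(1) by (simp add: circle_lift_def \<beta>_def mono_def continuous_on_add)
  moreover have "(\<lambda>z. c * (\<Prod>a\<leftarrow>as. disc_factor a z)) analytic_on cball 0 1"
    by (intro analytic_intros an)
  moreover have "c * (\<Prod>a\<leftarrow>as. disc_factor a (circle_point x)) = circle_point (\<beta> x)" for x
    unfolding \<gamma>(2) \<beta>_def circle_point_add t by (simp add: circle_point_def)
  ultimately have "boundary_lift B (length as) \<beta>"
    unfolding boundary_lift_def using B eq by auto
  then show ?thesis
    using that by blast
qed

lemma boundary_lift_circle_lift: "boundary_lift B d \<beta> \<Longrightarrow> circle_lift d \<beta>"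
  by (simp add: boundary_lift_def)

lemma boundary_lift_shift:
  assumes "boundary_lift B d \<beta>"
  shows "boundary_lift B d (\<lambda>x. \<beta> x + of_int k)"
proof -
  have "circle_point (y + of_int k) = circle_point y" for y
    using circle_point_eq_iff by blast
  moreover have "circle_lift d (\<lambda>x. \<beta> x + of_int k)"
    using assms by (simp add: boundary_lift_def circle_lift_def mono_def continuous_on_add)
  ultimately show ?thesis
    using assms by (simp add: boundary_lift_def)
qed

lemma boundary_lift_compose:
  assumes "boundary_lift B d \<beta>" "boundary_lift C e \<gamma>"
  shows "boundary_lift (B \<circ> C) (d * e) (\<beta> \<circ> \<gamma>)"
proof -
  obtain E where E: "E analytic_on cball 0 1" "\<forall>z\<in>ball 0 1. E z = B z"
      "\<forall>x. E (circle_point x) = circle_point (\<beta> x)"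
    using assms(1) by (auto simp: boundary_lift_def)
  obtain F where F: "F analytic_on cball 0 1" "\<forall>z\<in>ball 0 1. F z = C z"
      "\<forall>x. F (circle_point x) = circle_point (\<gamma> x)"
    using assms(2) by (auto simp: boundary_lift_def)
  have C: "C z \<in> ball 0 1" if "z \<in> ball 0 1" for z
    using assms(2) that unfolding boundary_lift_def by blast
  have "F z \<in> cball 0 1" if z: "z \<in> cball 0 1" for z
  proof (cases "norm z = 1")
    case True
    then obtain t where "z = cis t"
      by (metis complex_norm_eq_1_exp cis_conv_exp)
    then have "z = circle_point (t / (2 * pi))"
      by (simp add: circle_point_def)
    then show ?thesis
      using F(3) by simp
  next
    case False
    then have "z \<in> ball 0 1"
      using z by simp
    then show ?thesis
      using F(2) C[of z] by (simp add: less_imp_le)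
  qed
  then have "(E \<circ> F) analytic_on cball 0 1"
    by (intro analytic_on_compose_gen[OF F(1) E(1)]) auto
  moreover have "(B \<circ> C) ` ball 0 1 \<subseteq> ball 0 1"
    using assms by (auto simp: boundary_lift_def image_subset_iff)
  moreover have "\<forall>z\<in>ball 0 1. (E \<circ> F) z = (B \<circ> C) z"
    using E(2) F(2) C by simp
  moreover have "\<forall>x. (E \<circ> F) (circle_point x) = circle_point ((\<beta> \<circ> \<gamma>) x)"
    using E(3) F(3) by simp
  moreover have "circle_lift (d * e) (\<beta> \<circ> \<gamma>)"
    by (intro circle_lift_compose boundary_lift_circle_lift[OF assms(1)] boundary_lift_circle_lift[OF assms(2)])
  ultimately show ?thesis
    unfolding boundary_lift_def by (intro conjI exI[of _ "E \<circ> F"])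
qed

text \<open>Two lifts of the same boundary map differ by a continuous integer-valued function.\<close>

lemma boundary_lift_unique:
  assumes "boundary_lift B d \<beta>" "boundary_lift B e \<gamma>"
  obtains k :: int where "d = e" "\<And>x. \<gamma> x = \<beta> x + of_int k"
proof -
  obtain E where E: "E analytic_on cball 0 1" "\<forall>z\<in>ball 0 1. E z = B z"
      "\<forall>x. E (circle_point x) = circle_point (\<beta> x)"
    using assms(1) by (auto simp: boundary_lift_def)
  obtain F where F: "F analytic_on cball 0 1" "\<forall>z\<in>ball 0 1. F z = B z"
      "\<forall>x. F (circle_point x) = circle_point (\<gamma> x)"
    using assms(2) by (auto simp: boundary_lift_def)
  have "F z - E z = 0" if "z \<in> cball 0 1" for z
  proof (rule continuous_constant_on_closure[of "ball 0 1" "\<lambda>z. F z - E z"])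
    show "continuous_on (closure (ball 0 1)) (\<lambda>z. F z - E z)"
      using analytic_on_diff[OF F(1) E(1)] by (simp add: holomorphic_on_imp_continuous_on analytic_imp_holomorphic)
  qed (use E F that in auto)
  then have "circle_point (\<gamma> x) = circle_point (\<beta> x)" for x
    using E(3) F(3) by (metis diff_eq_diff_eq diff_self mem_cball_0 norm_circle_point order_refl)
  then have int: "\<exists>k::int. \<gamma> x - \<beta> x = of_int k" for x
    using circle_point_eq_iff by (metis add_diff_cancel_left')
  have "(\<lambda>x. \<gamma> x - \<beta> x) constant_on UNIV"
  proof (rule continuous_discrete_range_constant)
    show "continuous_on UNIV (\<lambda>x. \<gamma> x - \<beta> x)"
      using assms by (auto simp: boundary_lift_def circle_lift_def intro!: continuous_intros)
    fix x
    have "1 \<le> norm ((\<gamma> y - \<beta> y) - (\<gamma> x - \<beta> x))" if "\<gamma> y - \<beta> y \<noteq> \<gamma> x - \<beta> x" for y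
    proof -
      obtain k l :: int where "\<gamma> y - \<beta> y = of_int k" "\<gamma> x - \<beta> x = of_int l"
        using int by meson
      then show ?thesis
        using that by (simp flip: of_int_diff)
    qed
    then show "\<exists>e>0. \<forall>y. y \<in> UNIV \<and> \<gamma> y - \<beta> y \<noteq> \<gamma> x - \<beta> x \<longrightarrow> e \<le> norm (\<gamma> y - \<beta> y - (\<gamma> x - \<beta> x))"
      using zero_less_one by blast
  qed auto
  then obtain c where c: "\<And>x. \<gamma> x - \<beta> x = c"
    by (auto simp: constant_on_def)
  obtain k :: int where "c = of_int k"
    using int[of 0] c[of 0] by auto
  then have k: "\<And>x. \<gamma> x - \<beta> x = of_int k"
    using c by simp
  have "\<beta> (0 + 1) = \<beta> 0 + real d" "\<gamma> (0 + 1) = \<gamma> 0 + real e"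
    using assms unfolding boundary_lift_def circle_lift_def by blast+
  then have "d = e"
    using k[of 0] k[of 1] by simp
  then show ?thesis
    using that[of k] k by (simp add: algebra_simps)
qed

text \<open>The points of agreement accumulate somewhere on the circle, where both maps are analytic.\<close>

lemma eq_if_boundary_lifts_agree_infinitely:
  assumes "boundary_lift B d \<beta>" "boundary_lift C e \<gamma>"
    and inf: "infinite {x \<in> {0..<1}. \<beta> x = \<gamma> x}" and z: "norm z < 1"
  shows "B z = C z"
proof -
  obtain E where E: "E analytic_on cball 0 1" "\<forall>z\<in>ball 0 1. E z = B z"
      "\<forall>x. E (circle_point x) = circle_point (\<beta> x)"
    using assms(1) by (auto simp: boundary_lift_def)
  obtain F where F: "F analytic_on cball 0 1" "\<forall>z\<in>ball 0 1. F z = C z"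
      "\<forall>x. F (circle_point x) = circle_point (\<gamma> x)"
    using assms(2) by (auto simp: boundary_lift_def)
  define Z where "Z = circle_point ` {x \<in> {0..<1}. \<beta> x = \<gamma> x}"
  have "inj_on circle_point {0..<1}"
    by (rule inj_onI) (auto simp: circle_point_eq_iff)
  then have "infinite Z"
    unfolding Z_def using inf by (metis (no_types, lifting) finite_imageD inj_on_subset mem_Collect_eq subsetI)
  moreover have "Z \<subseteq> sphere 0 1"
    by (auto simp: Z_def)
  ultimately obtain \<xi> where \<xi>: "\<xi> \<in> sphere 0 1" "\<xi> islimpt Z"
    using Heine_Borel_imp_Bolzano_Weierstrass[OF compact_sphere] by blast
  have an: "(\<lambda>z. E z - F z) analytic_on cball 0 1"
    using E(1) F(1) by (intro analytic_intros)
  then obtain r where r: "r > 0" "(\<lambda>z. E z - F z) holomorphic_on ball \<xi> r"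
    using \<xi>(1) unfolding analytic_on_def by (metis mem_cball_0 mem_sphere_0 order_refl)
  have "\<xi> \<in> closure (ball 0 1)"
    using \<xi>(1) by simp
  then have meet: "ball 0 1 \<inter> ball \<xi> r \<noteq> {}"
    using r(1) by (metis closure_approachable disjoint_iff mem_ball dist_commute)
  define S where "S = ball 0 1 \<union> ball \<xi> r"
  have "E z - F z = 0"
  proof (rule analytic_continuation[of "\<lambda>z. E z - F z" S "Z \<inter> ball \<xi> r" \<xi> z])
    have "(\<lambda>z. E z - F z) holomorphic_on ball 0 1"
      using an by (intro analytic_imp_holomorphic) (auto intro: analytic_on_subset)
    then show "(\<lambda>z. E z - F z) holomorphic_on S"
      unfolding S_def using r(2) by (intro holomorphic_on_Un) auto
    show "connected S"
      unfolding S_def using meet by (intro connected_Un) auto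
    show "\<xi> islimpt Z \<inter> ball \<xi> r"
      using \<xi>(2) r(1) by (intro islimpt_Int_eventually eventually_at_in_open') auto
    show "E y - F y = 0" if "y \<in> Z \<inter> ball \<xi> r" for y
      using that E(3) F(3) by (auto simp: Z_def)
  qed (use r z in \<open>auto simp: S_def\<close>)
  then show ?thesis
    using E(2) F(2) z by simp
qed

section \<open>Semigroups represented by affine circle maps\<close>

text \<open>Two powers \<open>e\<^sup>i\<close>, \<open>e\<^sup>j\<close> with \<open>i < j\<close> agree modulo \<open>q\<close>; take for \<open>n\<close> a multiple of \<open>j - i\<close> that is at least \<open>i\<close>.\<close>

lemma exists_power_divisible:
  fixes q e :: nat
  assumes "q \<ge> 1"
  obtains n where "n \<ge> 1" "q dvd e ^ n * (e ^ n - 1)"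
proof (cases "e = 0")
  case True
  then show ?thesis
    using that[of 1] by simp
next
  case False
  have "\<not> inj_on (\<lambda>i. e ^ i mod q) {..q}"
  proof
    assume "inj_on (\<lambda>i. e ^ i mod q) {..q}"
    moreover have "(\<lambda>i. e ^ i mod q) ` {..q} \<subseteq> {..<q}"
      using assms by auto
    ultimately have "card {..q} \<le> card {..<q}"
      by (rule card_inj_on_le) simp
    then show False by simp
  qed
  then obtain i j where ij: "i < j" "e ^ i mod q = e ^ j mod q"
    by (auto simp: inj_on_def) (metis linorder_neqE_nat)
  \<comment> \<open>a multiple of \<open>j - i\<close> with \<open>n \<ge> i\<close>\<close>
  define n where "n = (j - i) * (i + 1)"
  have "q dvd e ^ j - e ^ i"
    using ij(2) by (metis mod_eq_dvd_iff_nat dvd_0_right diff_is_0_eq' linorder_linear)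
  also have "e ^ j - e ^ i = e ^ i * (e ^ (j - i) - 1)"
    using ij(1) by (simp add: diff_mult_distrib2 flip: power_add)
  also have "\<dots> dvd e ^ n * (e ^ n - 1)"
  proof (rule mult_dvd_mono)
    have "i * 1 \<le> (j - i) * (i + 1)"
      using ij(1) by (subst mult.commute) (intro mult_le_mono; simp)
    then show "e ^ i dvd e ^ n"
      unfolding n_def by (intro le_imp_power_dvd) simp
    have "(e ^ (j - i) - 1) dvd (e ^ (j - i)) ^ (i + 1) - 1"
    proof -
      have "int (e ^ (j - i)) - 1 dvd int (e ^ (j - i)) ^ (i + 1) - 1"
        by (simp only: power_diff_1_eq dvd_triv_left)
      then have "int (e ^ (j - i) - 1) dvd int ((e ^ (j - i)) ^ (i + 1) - 1)"
        using False by (simp add: of_nat_diff)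
      then show ?thesis
        by (simp only: of_nat_dvd_iff)
    qed
    then show "(e ^ (j - i) - 1) dvd e ^ n - 1"
      by (simp only: n_def power_mult)
  qed
  finally show ?thesis
    using that[of n] ij(1) by (simp add: n_def)
qed

text \<open>The translation parts of words in \<open>x \<mapsto> D x + c\<close> and \<open>x \<mapsto> D x + e c\<close> are \<open>c\<close> times a
  natural number written in base \<open>D\<close> with the digits \<open>1\<close> and \<open>e\<close>.\<close>

fun digit_value :: "nat \<Rightarrow> nat \<Rightarrow> bool list \<Rightarrow> nat" where
  "digit_value D e [] = 0"
| "digit_value D e (b # w) = D * digit_value D e w + (if b then 1 else e)"

lemma digit_value_inj:
  assumes "e mod D \<noteq> 1 mod D" "length v = length w" "digit_value D e v = digit_value D e w"
  and "D > 0"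
  shows "v = w"
  using assms(2,3)
proof (induction v w rule: list_induct2)
  case (Cons b v c w)
  have "(if b then 1 else e) mod D = digit_value D e (b # v) mod D"
    by simp
  also have "\<dots> = (if c then 1 else e) mod D"
    using Cons.prems by simp
  finally have "b = c"
    using assms(1) by (auto split: if_splits)
  then show ?case
    using Cons \<open>D > 0\<close> by auto
qed simp

text \<open>The standing hypotheses on the two generators after passing to powers.\<close>

locale entire_pair =
  fixes F G :: "complex \<Rightarrow> complex"
  assumes entire: "nonconst_entire F" "nonconst_entire G"
    and not_inj: "\<not> inj F" "\<not> inj G"
    and no_free: "\<not> (\<exists>T \<subseteq> generated_semigroup {F, G}. free_noncyclic T)"
    and no_free_abelian: "\<not> (\<exists>T \<subseteq> generated_semigroup {F, G}. free_abelian_noncyclic T)"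
begin

definition words :: "(complex \<Rightarrow> complex) set" where
  "words = generated_semigroup {F, G}"

lemma words_F: "F \<in> words" and words_G: "G \<in> words"
  by (auto simp: words_def intro: generated_semigroup.generator)

lemma words_compose: "s \<in> words \<Longrightarrow> t \<in> words \<Longrightarrow> s \<circ> t \<in> words"
  unfolding words_def by (rule generated_semigroup.compose)

lemma words_funpow: "s \<in> words \<Longrightarrow> n \<ge> 1 \<Longrightarrow> (s ^^ n) \<in> words"
  unfolding words_def by (rule funpow_in_generated_semigroup)

lemma words_pair_word: "a \<in> words \<Longrightarrow> b \<in> words \<Longrightarrow> w \<noteq> [] \<Longrightarrow> pair_word a b w \<in> words"
  unfolding words_def by (rule pair_word_in_generated_semigroup)

lemma words_induct [consumes 1, case_names F G compose]:
  assumes "s \<in> words" "P F" "P G" "\<And>s t. s \<in> words \<Longrightarrow> t \<in> words \<Longrightarrow> P s \<Longrightarrow> P t \<Longrightarrow> P (s \<circ> t)"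
  shows "P s"
  using assms(1) unfolding words_def
proof induction
  case (generator s)
  then show ?case using assms(2,3) by auto
next
  case (compose s t)
  then show ?case using assms(4) by (simp only: words_def)
qed

lemma words_nonconst_entire: "s \<in> words \<Longrightarrow> nonconst_entire s"
  unfolding words_def by (rule generated_semigroup_nonconst_entire[of "{F, G}"]) (use entire in auto)

lemma words_not_inj: "s \<in> words \<Longrightarrow> \<not> inj s"
  unfolding words_def by (rule generated_semigroup_not_inj[of "{F, G}"]) (use not_inj in auto)

lemma words_not_id: "s \<in> words \<Longrightarrow> s \<noteq> id"
  using words_not_inj inj_on_id by blast

lemma words_holomorphic: "s \<in> insert id words \<Longrightarrow> s holomorphic_on UNIV"
  using words_nonconst_entire by (auto simp: nonconst_entire_def id_def)

lemma words_common_left_multiple: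
  assumes "a \<in> words" "b \<in> words"
  obtains u v where "u \<in> insert id words" "v \<in> insert id words" "u \<circ> a = v \<circ> b"
proof -
  have "\<And>s. s \<in> {F, G} \<Longrightarrow> nonconst_entire s" "\<And>s. s \<in> {F, G} \<Longrightarrow> \<not> inj s"
    using entire not_inj by blast+
  from common_left_multiple[OF this no_free assms[unfolded words_def]] show ?thesis
    using that unfolding words_def by blast
qed

lemma words_pair_word_collision:
  assumes "a \<in> words" "b \<in> words"
  obtains v w where "v \<noteq> []" "w \<noteq> []" "v \<noteq> w" "pair_word a b v = pair_word a b w"
  using pair_word_collision_if_no_free_subsemigroup[OF no_free] assms unfolding words_def by metis

lemma words_common_power:
  assumes "a \<in> words" "b \<in> words" "a \<circ> b = b \<circ> a"
  obtains r s where "r \<ge> 1" "s \<ge> 1" "a ^^ r = b ^^ s"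
proof -
  have "\<And>s. s \<in> {F, G} \<Longrightarrow> nonconst_entire s" "\<And>s. s \<in> {F, G} \<Longrightarrow> \<not> inj s"
    using entire not_inj by blast+
  from commuting_imp_common_power[OF this no_free_abelian assms[unfolded words_def]] show ?thesis
    using that by blast
qed

lemma preperiodic_points_eq_if_commuting:
  assumes "F \<circ> G = G \<circ> F"
  shows "preperiodic_points F = preperiodic_points G"
proof -
  obtain r s where "r \<ge> 1" "s \<ge> 1" "F ^^ r = G ^^ s"
    using words_common_power[OF words_F words_G assms] .
  then show ?thesis
    using preperiodic_points_funpow[of r F] preperiodic_points_funpow[of s G] by simp
qed

end

text \<open>A representation of the semigroup by affine circle maps \<open>x \<mapsto> d x + c\<close>, where \<open>c\<close> is only
  determined modulo \<open>\<int>\<close>. The origin is chosen as a fixed point of the map that belongs to \<open>G\<close>.\<close>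

locale affine_pair = entire_pair +
  fixes aff :: "(complex \<Rightarrow> complex) \<Rightarrow> nat \<Rightarrow> real \<Rightarrow> bool" and d e :: nat and c :: real
  assumes aff_id: "aff id 1 0"
    and aff_compose: "\<And>s m a t n b. aff s m a \<Longrightarrow> aff t n b \<Longrightarrow> aff (s \<circ> t) (m * n) (real m * b + a)"
    and aff_unique: "\<And>s m a n b. aff s m a \<Longrightarrow> aff s n b \<Longrightarrow> m = n \<and> a - b \<in> \<int>"
    and aff_eq: "\<And>s t m a b. \<lbrakk>s \<in> insert id words; t \<in> insert id words; aff s m a; aff t m b; a - b \<in> \<int>\<rbrakk> \<Longrightarrow> s = t"
    and aff_F: "aff F d c" and aff_G: "aff G e 0" and d: "d \<ge> 1" and e: "e \<ge> 2"
begin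

lemma aff_funpow:
  assumes "aff s m a"
  shows "aff (s ^^ n) (m ^ n) (a * (\<Sum>i<n. real m ^ i))"
proof (induction n)
  case 0
  then show ?case
    using aff_id by (simp only: funpow.simps power_0 lessThan_0 sum.empty mult_zero_right)
next
  case (Suc n)
  have "a * (\<Sum>i<Suc n. real m ^ i) = real m * (a * (\<Sum>i<n. real m ^ i)) + a"
    by (subst sum.lessThan_Suc_shift) (simp add: sum_distrib_left algebra_simps)
  then show ?case
    using aff_compose[OF assms Suc] by (simp only: funpow.simps power_Suc)
qed

lemma aff_funpow_zero:
  assumes "aff s m 0"
  shows "aff (s ^^ n) (m ^ n) 0"
  using aff_funpow[OF assms, of n] by simp

text \<open>If \<open>c\<close> is irrational, then integer multiples of \<open>c\<close> are distinct modulo \<open>\<int>\<close>, so a word in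
  \<open>F \<circ> G\<close> and \<open>G \<circ> F\<close> is determined by its digit value. The digits \<open>1\<close> and \<open>e\<close> are incongruent modulo
  \<open>D = d e\<close> because \<open>1 < e \<le> D\<close>, so these two maps generate a free semigroup.\<close>

lemma translation_rational: "c \<in> \<rat>"
proof (rule ccontr)
  assume irrat: "c \<notin> \<rat>"
  define D where "D = d * e"
  have A: "aff (F \<circ> G) D c"
    using aff_compose[OF aff_F aff_G] by (simp add: D_def)
  have B: "aff (G \<circ> F) D (real e * c)"
    using aff_compose[OF aff_G aff_F] by (simp add: D_def mult.commute)
  have word: "aff (pair_word (F \<circ> G) (G \<circ> F) w) (D ^ length w) (c * real (digit_value D e w))" for w
  proof (induction w)
    case Nil
    then show ?case
      using aff_id by (simp only: pair_word_simps list.size power_0 digit_value.simps of_nat_0 mult_zero_right)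
  next
    case (Cons b w)
    have "aff (if b then F \<circ> G else G \<circ> F) D (c * real (if b then 1 else e))"
      using A B by (cases b) (simp_all only: if_True if_False mult.commute of_nat_1 mult_1)
    note aff_compose[OF this Cons]
    moreover have "real D * (c * real (digit_value D e w)) + c * real (if b then 1 else e)
        = c * real (digit_value D e (b # w))"
      by (simp add: algebra_simps)
    ultimately show ?case
      by (simp only: pair_word_simps length_Cons power_Suc)
  qed
  obtain v w where vw: "v \<noteq> w" "pair_word (F \<circ> G) (G \<circ> F) v = pair_word (F \<circ> G) (G \<circ> F) w"
    using words_pair_word_collision words_compose words_F words_G by metis
  have "D ^ length v = D ^ length w"
    and int: "c * real (digit_value D e v) - c * real (digit_value D e w) \<in> \<int>"
    using aff_unique[OF word[of v]] word[of w] vw(2) by metis+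
  have "e \<le> D"
    using d by (simp add: D_def)
  then have "length v = length w"
    using \<open>D ^ length v = D ^ length w\<close> e by (metis Suc_1 Suc_le_lessD le_trans power_inject_exp)
  have "e mod D \<noteq> 1 mod D"
  proof
    assume "e mod D = 1 mod D"
    moreover have "1 \<le> e"
      using e by simp
    ultimately have "D dvd e - 1"
      using mod_eq_dvd_iff_nat by blast
    then show False
      using dvd_imp_le[of D "e - 1"] \<open>e \<le> D\<close> e by simp
  qed
  define k where "k = real (digit_value D e v) - real (digit_value D e w)"
  have "c * k \<in> \<int>"
    using int by (simp add: k_def right_diff_distrib)
  moreover have "k \<in> \<int>"
    by (simp add: k_def)
  moreover have "k \<noteq> 0"
    using digit_value_inj[OF \<open>e mod D \<noteq> 1 mod D\<close> \<open>length v = length w\<close>] vw(1) \<open>e \<le> D\<close> e by (auto simp: k_def)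
  ultimately have "c * k / k \<in> \<rat>"
    by (meson Ints_subset_Rats Rats_divide subsetD)
  then show False
    using \<open>k \<noteq> 0\<close> irrat by simp
qed

text \<open>Now \<open>q c \<in> \<int>\<close> for some \<open>q\<close>. Degree \<open>d = 1\<close> would make \<open>F\<^sup>q\<close> the identity. Otherwise \<open>n\<close> is chosen so that
  \<open>e\<^sup>n (e\<^sup>n - 1) c\<close> is an integer, which makes \<open>G\<^sup>n\<close> and \<open>G\<^sup>n \<circ> F\<close> commute; their common power gives a
  common degree \<open>E = d\<^sup>s = e\<^sup>m\<close>. Finally \<open>k\<close> is chosen so that \<open>E\<^sup>k\<close> kills the translation part of the \<open>k\<close>-th
  power of \<open>F\<^sup>s\<close>.\<close>

theorem preperiodic_points_eq: "preperiodic_points F = preperiodic_points G"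
proof -
  obtain p :: int and q :: nat where q: "q \<ge> 1" "c = of_int p / of_nat q"
    using translation_rational by (elim Rats_cases') (metis of_int_of_nat_eq zero_less_imp_eq_int Suc_leI One_nat_def)
  then have cq: "c * real q = of_int p"
    by simp
  have "d \<noteq> 1"
  proof
    assume "d = 1"
    then have "aff (F ^^ q) 1 (c * real q)"
      using aff_funpow[OF aff_F, of q] by simp
    moreover have "c * real q - 0 \<in> \<int>"
      by (simp add: cq)
    ultimately have "F ^^ q = id"
      using aff_eq[of "F ^^ q" id 1 "c * real q" 0] aff_id words_funpow[OF words_F q(1)] by blast
    then show False
      using words_not_id words_funpow[OF words_F q(1)] by blast
  qed
  then have "d \<ge> 2"
    using d by simp
  obtain n where n: "n \<ge> 1" "q dvd e ^ n * (e ^ n - 1)"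
    using exists_power_divisible[OF q(1)] by blast
  define A where "A = G ^^ n"
  define B where "B = A \<circ> F"
  have A: "aff A (e ^ n) 0"
    unfolding A_def by (rule aff_funpow_zero[OF aff_G])
  have B: "aff B (e ^ n * d) (real (e ^ n) * c)"
    using aff_compose[OF A aff_F] by (simp add: B_def)
  have AB: "A \<in> words" "B \<in> words"
    unfolding A_def B_def by (intro words_compose words_funpow words_F words_G n)+
  have "A \<circ> B = B \<circ> A"
  proof (rule aff_eq)
    show "aff (A \<circ> B) (e ^ n * (e ^ n * d)) (real (e ^ n) * (real (e ^ n) * c) + 0)"
      by (rule aff_compose[OF A B])
    show "aff (B \<circ> A) (e ^ n * (e ^ n * d)) (real (e ^ n) * c)"
      using aff_compose[OF B A] by (simp add: mult.commute mult.left_commute)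
    obtain k where k: "e ^ n * (e ^ n - 1) = q * k"
      using n(2) by (auto simp: dvd_def)
    have "real (e ^ n) * (real (e ^ n) * c) + 0 - real (e ^ n) * c = real (e ^ n * (e ^ n - 1)) * c"
      using e by (simp add: of_nat_diff algebra_simps)
    also have "\<dots> = of_int (p * int k)"
      unfolding k of_nat_mult using cq by (simp add: mult.commute mult.left_commute)
    finally show "real (e ^ n) * (real (e ^ n) * c) + 0 - real (e ^ n) * c \<in> \<int>"
      by (simp only: Ints_of_int)
  qed (use AB words_compose in blast)+
  then obtain r s where rs: "r \<ge> 1" "s \<ge> 1" "A ^^ r = B ^^ s"
    using words_common_power[OF AB] by blast
  have "(e ^ n) ^ r = (e ^ n * d) ^ s"
    using aff_unique[OF aff_funpow[OF A, of r]] aff_funpow[OF B, of s] rs(3) by metis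
  then have eq: "e ^ (n * r) = e ^ (n * s) * d ^ s"
    by (simp add: power_mult_distrib power_mult)
  have "e ^ (n * s) * 1 < e ^ (n * s) * d ^ s"
    using \<open>d \<ge> 2\<close> rs(2) e by (intro mult_strict_left_mono one_less_power) auto
  then have "e ^ (n * s) < e ^ (n * r)"
    by (simp add: eq)
  then have "n * s < n * r"
    using e by (metis Suc_1 Suc_le_lessD power_less_imp_less_exp)
  define m where "m = n * r - n * s"
  have m: "m \<ge> 1" "n * r = n * s + m"
    using \<open>n * s < n * r\<close> unfolding m_def by linarith+
  define E where "E = d ^ s"
  have "E = e ^ m"
    using eq e unfolding m(2) power_add E_def by simp
  have "E \<ge> 2"
    unfolding E_def using power_increasing[of 1 s d] \<open>d \<ge> 2\<close> rs(2) by simp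
  define P where "P = F ^^ s"
  define Q where "Q = G ^^ m"
  obtain c' where P: "aff P E c'" and c'q: "c' * real q \<in> \<int>"
  proof
    show "aff P E (c * (\<Sum>i<s. real d ^ i))"
      unfolding P_def E_def by (rule aff_funpow[OF aff_F])
    have "c * (\<Sum>i<s. real d ^ i) * real q = of_int p * (\<Sum>i<s. real d ^ i)"
      unfolding cq[symmetric] by (simp only: mult_ac)
    also have "\<dots> \<in> \<int>"
      by (intro Ints_mult Ints_sum Ints_power) auto
    finally show "c * (\<Sum>i<s. real d ^ i) * real q \<in> \<int>" .
  qed
  have Q: "aff Q E 0"
    unfolding Q_def \<open>E = e ^ m\<close> by (rule aff_funpow_zero[OF aff_G])
  have PQ: "P \<in> words" "Q \<in> words"
    unfolding P_def Q_def by (intro words_funpow words_F words_G rs m)+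
  \<comment> \<open>the factor \<open>E - 1\<close> compensates for the denominator of the geometric sum \<open>1 + E + \<dots> + E\<^sup>k\<^sup>-\<^sup>1\<close>\<close>
  obtain k where k: "k \<ge> 1" "q * (E - 1) dvd E ^ k * (E ^ k - 1)"
  proof -
    have "q * (E - 1) \<ge> 1"
      using q(1) \<open>E \<ge> 2\<close> by simp
    then show ?thesis
      using exists_power_divisible[of "q * (E - 1)" E] that by blast
  qed
  define \<kappa> where "\<kappa> = c' * (\<Sum>i<k. real E ^ i)"
  have Pk: "aff (P ^^ k) (E ^ k) \<kappa>"
    unfolding \<kappa>_def by (rule aff_funpow[OF P])
  have Qk: "aff (Q ^^ k) (E ^ k) 0"
    by (rule aff_funpow_zero[OF Q])
  have int: "real (E ^ k) * \<kappa> \<in> \<int>"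
  proof -
    obtain j where j: "E ^ k * (E ^ k - 1) = q * (E - 1) * j"
      using k(2) by (auto simp: dvd_def)
    have "(real E - 1) * (\<Sum>i<k. real E ^ i) = real E ^ k - 1"
      by (rule power_diff_1_eq[symmetric])
    then have "(real E - 1) * (real (E ^ k) * \<kappa>) = c' * real (E ^ k * (E ^ k - 1))"
      using \<open>E \<ge> 2\<close> by (simp add: \<kappa>_def of_nat_diff mult.commute mult.left_commute)
    also have "\<dots> = (real E - 1) * (c' * real q * real j)"
      unfolding j using \<open>E \<ge> 2\<close> by (simp add: of_nat_diff mult.commute mult.left_commute)
    finally have "real (E ^ k) * \<kappa> = c' * real q * real j"
      using \<open>E \<ge> 2\<close> by simp
    then show ?thesis
      using c'q by (simp only: Ints_mult Ints_of_nat)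
  qed
  have PQk: "P ^^ k \<in> words" "Q ^^ k \<in> words"
    by (intro words_funpow PQ k)+
  have "(Q ^^ k) \<circ> (P ^^ k) = (Q ^^ k) \<circ> (Q ^^ k)"
  proof (rule aff_eq)
    show "aff ((Q ^^ k) \<circ> (P ^^ k)) (E ^ k * E ^ k) (real (E ^ k) * \<kappa> + 0)"
      by (rule aff_compose[OF Qk Pk])
    show "aff ((Q ^^ k) \<circ> (Q ^^ k)) (E ^ k * E ^ k) (real (E ^ k) * 0 + 0)"
      by (rule aff_compose[OF Qk Qk])
  qed (use PQk words_compose int in simp_all)
  then have 1: "preperiodic_points (P ^^ k) \<subseteq> preperiodic_points (Q ^^ k)"
    by (rule preperiodic_points_subset_if_absorbing)
  have "(P ^^ k) \<circ> (Q ^^ k) = (P ^^ k) \<circ> (P ^^ k)"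
  proof (rule aff_eq)
    show "aff ((P ^^ k) \<circ> (Q ^^ k)) (E ^ k * E ^ k) (real (E ^ k) * 0 + \<kappa>)"
      by (rule aff_compose[OF Pk Qk])
    show "aff ((P ^^ k) \<circ> (P ^^ k)) (E ^ k * E ^ k) (real (E ^ k) * \<kappa> + \<kappa>)"
      by (rule aff_compose[OF Pk Pk])
    show "(real (E ^ k) * 0 + \<kappa>) - (real (E ^ k) * \<kappa> + \<kappa>) \<in> \<int>"
      using Ints_minus[OF int] by simp
  qed (use PQk words_compose in simp_all)
  then have 2: "preperiodic_points (Q ^^ k) \<subseteq> preperiodic_points (P ^^ k)"
    by (rule preperiodic_points_subset_if_absorbing)
  have "preperiodic_points F = preperiodic_points (P ^^ k)"
    unfolding P_def using k(1) rs(2) by (simp add: preperiodic_points_funpow)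
  also have "\<dots> = preperiodic_points (Q ^^ k)"
    using 1 2 by blast
  also have "\<dots> = preperiodic_points G"
    unfolding Q_def using k(1) m(1) by (simp add: preperiodic_points_funpow)
  finally show ?thesis .
qed

end

section \<open>Transfer to the unit disc\<close>

lemma boundary_lift_cong:
  assumes "boundary_lift B d \<beta>" "\<And>z. norm z < 1 \<Longrightarrow> B z = C z"
  shows "boundary_lift C d \<beta>"
proof -
  have "C ` ball 0 1 = B ` ball 0 1"
    using assms(2) by (intro image_cong) auto
  then show ?thesis
    using assms unfolding boundary_lift_def by auto
qed

lemma circle_lift_surj:
  assumes "circle_lift d \<beta>" "d \<ge> 1"
  shows "\<exists>x. \<beta> x = y"
proof -
  define n where "n = \<lceil>\<bar>y - \<beta> 0\<bar>\<rceil>"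
  have n: "\<bar>y - \<beta> 0\<bar> \<le> real_of_int n" "n \<ge> 0"
    by (auto simp: n_def)
  have "real_of_int n \<le> real d * real_of_int n"
    using n(2) assms(2) by (simp add: mult_le_cancel_right1)
  then have "\<bar>y - \<beta> 0\<bar> \<le> real d * real_of_int n"
    using n(1) by linarith
  moreover have "\<beta> (of_int n) = \<beta> 0 + real d * of_int n" "\<beta> (- of_int n) = \<beta> 0 - real d * of_int n"
    using circle_lift_add_int[OF assms(1), of 0 n] circle_lift_add_int[OF assms(1), of 0 "- n"] by simp_all
  ultimately have "\<beta> (- of_int n) \<le> y" "y \<le> \<beta> (of_int n)"
    by linarith+
  moreover have "continuous_on {- of_int n..of_int n} \<beta>"
    using assms(1) by (meson circle_lift_def continuous_on_subset subset_UNIV)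
  ultimately show ?thesis
    using IVT'[of \<beta> "- of_int n" y "of_int n"] n(2) by auto
qed

text \<open>The generators restrict to proper self-maps of \<open>D\<close>, which \<open>\<psi>\<close> maps conformally onto the unit disc
  with inverse \<open>\<eta>\<close>.\<close>

locale disc_pair = entire_pair +
  fixes D :: "complex set" and \<psi> \<eta> :: "complex \<Rightarrow> complex"
  assumes open_D: "open D" and nonempty_D: "D \<noteq> {}"
    and \<psi>_holomorphic: "\<psi> holomorphic_on D" and \<eta>_holomorphic: "\<eta> holomorphic_on ball 0 1"
    and \<psi>: "\<And>z. z \<in> D \<Longrightarrow> \<psi> z \<in> ball 0 1" "\<And>z. z \<in> D \<Longrightarrow> \<eta> (\<psi> z) = z"
    and \<eta>: "\<And>z. z \<in> ball 0 1 \<Longrightarrow> \<eta> z \<in> D" "\<And>z. z \<in> ball 0 1 \<Longrightarrow> \<psi> (\<eta> z) = z"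
    and maps_D: "F ` D \<subseteq> D" "G ` D \<subseteq> D"
    and proper_on_D: "\<And>K. compact K \<Longrightarrow> K \<subseteq> D \<Longrightarrow> compact {z \<in> D. F z \<in> K}"
      "\<And>K. compact K \<Longrightarrow> K \<subseteq> D \<Longrightarrow> compact {z \<in> D. G z \<in> K}"
begin

text \<open>Conjugation by the Riemann map. Off the unit disc the value is arbitrary, so identities between such
  maps are stated on the disc.\<close>

definition on_disc :: "(complex \<Rightarrow> complex) \<Rightarrow> complex \<Rightarrow> complex" where
  "on_disc s z = \<psi> (s (\<eta> z))"

lemma on_disc_in_ball:
  assumes "s ` D \<subseteq> D" "z \<in> ball 0 1"
  shows "on_disc s z \<in> ball 0 1"
  unfolding on_disc_def using assms \<eta>(1) \<psi>(1) by blast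

lemma on_disc_compose:
  assumes "t ` D \<subseteq> D" "z \<in> ball 0 1"
  shows "on_disc (s \<circ> t) z = on_disc s (on_disc t z)"
proof -
  have "t (\<eta> z) \<in> D"
    using assms \<eta>(1) by blast
  then show ?thesis
    by (simp add: on_disc_def \<psi>(2))
qed

lemma entire_eq_if_on_disc_eq:
  assumes "s holomorphic_on UNIV" "t holomorphic_on UNIV" "s ` D \<subseteq> D" "t ` D \<subseteq> D"
    and eq: "\<And>z. norm z < 1 \<Longrightarrow> on_disc s z = on_disc t z"
  shows "s = t"
proof
  fix w
  have "s z = t z" if z: "z \<in> D" for z
  proof -
    have "norm (\<psi> z) < 1"
      using \<psi>(1)[OF z] by simp
    from eq[OF this] have "\<psi> (s z) = \<psi> (t z)"
      by (simp add: on_disc_def \<psi>(2)[OF z])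
    moreover have "s z \<in> D" "t z \<in> D"
      using assms(3,4) z by blast+
    ultimately show ?thesis
      using \<psi>(2) by metis
  qed
  then show "s w = t w"
    using analytic_continuation_open[OF open_D open_UNIV nonempty_D _ _ assms(1,2)] by auto
qed

text \<open>Properness says that a compact disc \<open>\<bar>w\<bar> \<le> r\<close> has a preimage which stays away from the unit circle.\<close>

lemma on_disc_boundary_unimodular:
  assumes hol: "s holomorphic_on UNIV" and D: "s ` D \<subseteq> D"
    and proper: "\<And>K. compact K \<Longrightarrow> K \<subseteq> D \<Longrightarrow> compact {z \<in> D. s z \<in> K}"
  shows "boundary_unimodular (on_disc s)"
  unfolding boundary_unimodular_def
proof (intro conjI allI impI ballI)
  have "\<eta> ` ball 0 1 \<subseteq> D" "(s \<circ> \<eta>) ` ball 0 1 \<subseteq> D"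
    using \<eta>(1) D by auto
  then have "\<psi> \<circ> (s \<circ> \<eta>) holomorphic_on ball 0 1"
    by (intro holomorphic_on_compose_gen[OF _ \<psi>_holomorphic] holomorphic_on_compose_gen[OF \<eta>_holomorphic hol]) auto
  then show "on_disc s holomorphic_on ball 0 1"
    by (simp add: on_disc_def[abs_def] comp_def)
  show "norm (on_disc s z) \<le> 1" if "z \<in> ball 0 1" for z
    using on_disc_in_ball[OF D that] by simp
  fix r :: real assume "r < 1"
  define K where "K = \<eta> ` cball 0 r"
  have sub: "cball 0 r \<subseteq> ball (0::complex) 1"
    using \<open>r < 1\<close> by auto
  have "compact K"
    unfolding K_def using sub \<eta>_holomorphic
    by (intro compact_continuous_image holomorphic_on_imp_continuous_on) (auto intro: holomorphic_on_subset)
  moreover have "K \<subseteq> D"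
    unfolding K_def using sub \<eta>(1) by blast
  ultimately have "compact {z \<in> D. s z \<in> K}"
    by (rule proper)
  then have "compact (\<psi> ` {z \<in> D. s z \<in> K})"
    using \<psi>_holomorphic
    by (intro compact_continuous_image holomorphic_on_imp_continuous_on) (auto intro: holomorphic_on_subset)
  then obtain m where m: "m < 1" "\<And>z. z \<in> \<psi> ` {z \<in> D. s z \<in> K} \<Longrightarrow> norm z \<le> m"
  proof (cases "\<psi> ` {z \<in> D. s z \<in> K} = {}")
    case True
    show ?thesis
      by (rule that[of 0], simp, unfold True) blast
  next
    case False
    obtain x where x: "x \<in> \<psi> ` {z \<in> D. s z \<in> K}" "\<And>z. z \<in> \<psi> ` {z \<in> D. s z \<in> K} \<Longrightarrow> norm z \<le> norm x"
      using continuous_attains_sup[OF \<open>compact (\<psi> ` _)\<close> False, of norm] continuous_on_norm_id by blast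
    have "norm x < 1"
      using x(1) \<psi>(1) by force
    then show ?thesis
      using that[of "norm x"] x(2) by blast
  qed
  have "r < norm (on_disc s z)" if z: "m < norm z" "norm z < 1" for z
  proof (rule ccontr)
    assume "\<not> r < norm (on_disc s z)"
    have "s (\<eta> z) \<in> D"
      using D \<eta>(1)[of z] z by auto
    then have "s (\<eta> z) = \<eta> (on_disc s z)"
      by (simp add: on_disc_def \<psi>(2))
    then have "s (\<eta> z) \<in> K"
      using \<open>\<not> r < norm (on_disc s z)\<close> by (auto simp: K_def)
    then have "\<psi> (\<eta> z) \<in> \<psi> ` {z \<in> D. s z \<in> K}"
      using \<eta>(1)[of z] z by auto
    then show False
      using m(2)[of z] \<eta>(2)[of z] z by simp
  qed
  then show "\<exists>t<1. \<forall>z. t < norm z \<and> norm z < 1 \<longrightarrow> r < norm (on_disc s z)"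
    using m(1) by blast
qed

definition lift_of :: "(complex \<Rightarrow> complex) \<Rightarrow> nat \<Rightarrow> (real \<Rightarrow> real) \<Rightarrow> bool" where
  "lift_of s d \<beta> \<longleftrightarrow> s ` D \<subseteq> D \<and> boundary_lift (on_disc s) d \<beta>"

lemma lift_of_circle_lift: "lift_of s d \<beta> \<Longrightarrow> circle_lift d \<beta>"
  by (simp add: lift_of_def boundary_lift_def)

lemma lift_of_id: "lift_of id 1 id"
proof -
  have "boundary_lift id 1 id"
    unfolding boundary_lift_def using circle_lift_id
    by (intro conjI exI[of _ id]) (auto simp: id_def[abs_def] intro: analytic_intros)
  moreover have "on_disc id z = id z" if "norm z < 1" for z
    using that \<eta>(2)[of z] by (simp add: on_disc_def)
  ultimately show ?thesis
    unfolding lift_of_def using boundary_lift_cong[of id 1 id "on_disc id"] by simp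
qed

lemma lift_of_compose:
  assumes "lift_of s d \<beta>" "lift_of t e \<gamma>"
  shows "lift_of (s \<circ> t) (d * e) (\<beta> \<circ> \<gamma>)"
proof -
  have "boundary_lift (on_disc s \<circ> on_disc t) (d * e) (\<beta> \<circ> \<gamma>)"
    using assms boundary_lift_compose by (simp add: lift_of_def)
  moreover have "(on_disc s \<circ> on_disc t) z = on_disc (s \<circ> t) z" if "norm z < 1" for z
    using on_disc_compose[of t z s] assms(2) that by (simp add: lift_of_def)
  ultimately have "boundary_lift (on_disc (s \<circ> t)) (d * e) (\<beta> \<circ> \<gamma>)"
    by (rule boundary_lift_cong)
  moreover have "(s \<circ> t) ` D \<subseteq> D"
    using assms unfolding lift_of_def image_comp[symmetric] by blast
  ultimately show ?thesis
    by (simp only: lift_of_def)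
qed

lemma lift_of_funpow:
  assumes "lift_of s d \<beta>"
  shows "lift_of (s ^^ n) (d ^ n) (\<beta> ^^ n)"
proof (induction n)
  case 0
  show ?case using lift_of_id by (simp only: funpow.simps power_0)
next
  case (Suc n)
  show ?case using lift_of_compose[OF assms Suc] by (simp only: funpow.simps power_Suc)
qed

lemma lift_of_unique:
  assumes "lift_of s d \<beta>" "lift_of s e \<gamma>"
  obtains k :: int where "d = e" "\<And>x. \<gamma> x = \<beta> x + of_int k"
  using boundary_lift_unique assms unfolding lift_of_def by metis

lemma lift_of_shift:
  assumes "lift_of s d \<beta>"
  shows "lift_of s d (\<lambda>x. \<beta> x + of_int k)"
  using boundary_lift_shift assms unfolding lift_of_def by blast

lemma eq_if_lifts_agree_infinitely:
  assumes "s \<in> insert id words" "t \<in> insert id words"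
    and "lift_of s d \<beta>" "lift_of t e \<gamma>" "infinite {x \<in> {0..<1}. \<beta> x = \<gamma> x}"
  shows "s = t"
proof (rule entire_eq_if_on_disc_eq)
  show "s holomorphic_on UNIV" "t holomorphic_on UNIV"
    using assms(1,2) words_holomorphic by blast+
  show "s ` D \<subseteq> D" "t ` D \<subseteq> D"
    using assms(3,4) by (simp_all add: lift_of_def)
  show "on_disc s z = on_disc t z" if "norm z < 1" for z
    using eq_if_boundary_lifts_agree_infinitely[OF _ _ assms(5) that] assms(3,4) unfolding lift_of_def by blast
qed

text \<open>The list \<open>as\<close> is nonempty because a unimodular constant does not map into the open disc.\<close>

lemma generator_Blaschke_form:
  assumes "s \<in> {F, G}"
  obtains c as \<beta> where "norm c = 1" "\<And>a. a \<in> set as \<Longrightarrow> norm a < 1" "as \<noteq> []"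
    "\<And>z. norm z < 1 \<Longrightarrow> on_disc s z = c * (\<Prod>a\<leftarrow>as. disc_factor a z)" "lift_of s (length as) \<beta>"
proof -
  have D: "s ` D \<subseteq> D" and hol: "s holomorphic_on UNIV"
    using assms maps_D entire by (auto simp: nonconst_entire_def)
  have "boundary_unimodular (on_disc s)"
    by (rule on_disc_boundary_unimodular[OF hol D]) (use assms proper_on_D in auto)
  then obtain c as where cas: "norm c = 1" "\<And>a. a \<in> set as \<Longrightarrow> norm a < 1"
    "\<And>z. norm z < 1 \<Longrightarrow> on_disc s z = c * (\<Prod>a\<leftarrow>as. disc_factor a z)"
    using finite_Blaschke_factorisation[of "on_disc s"] by blast
  have "on_disc s ` ball 0 1 \<subseteq> ball 0 1"
    using on_disc_in_ball[OF D] by blast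
  from Blaschke_product_boundary_lift[OF this cas]
  obtain \<beta> where "boundary_lift (on_disc s) (length as) \<beta>" by blast
  then have "lift_of s (length as) \<beta>"
    using D by (simp add: lift_of_def)
  moreover have "as \<noteq> []"
    using cas(1) cas(3)[of 0] on_disc_in_ball[OF D, of 0] by auto
  ultimately show ?thesis
    using that[of c as \<beta>] cas by blast
qed

lemma generator_lift:
  assumes "s \<in> {F, G}"
  shows "\<exists>d\<ge>1. \<exists>\<beta>. lift_of s d \<beta>"
proof (rule generator_Blaschke_form[OF assms])
  fix as :: "complex list" and \<beta>
  assume "as \<noteq> []" and lift: "lift_of s (length as) \<beta>"
  then have "length as \<ge> 1"
    by (simp add: Suc_le_eq)
  then show ?thesis
    using lift by blast
qed

lemma words_lift:
  assumes "s \<in> insert id words"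
  obtains d \<beta> where "d \<ge> 1" "lift_of s d \<beta>"
proof -
  have "\<exists>d\<ge>1. \<exists>\<beta>. lift_of s d \<beta>" if "s \<in> words"
    using that
  proof (induction rule: words_induct)
    case F
    show ?case by (rule generator_lift) simp
  next
    case G
    show ?case by (rule generator_lift) simp
  next
    case (compose s t)
    obtain d \<beta> e \<gamma> where de: "d \<ge> 1" "e \<ge> 1" and "lift_of s d \<beta>" "lift_of t e \<gamma>"
      using compose.IH by blast
    then have "lift_of (s \<circ> t) (d * e) (\<beta> \<circ> \<gamma>)"
      by (intro lift_of_compose)
    moreover have "d * e \<ge> 1"
      using mult_le_mono[OF de] by (simp only: mult_1)
    ultimately show ?case
      by blast
  qed
  then show ?thesis
    using assms lift_of_id that by blast
qed

text \<open>The common left multiple of \<open>a\<^sup>N\<close> and \<open>b\<^sup>N\<close> lifts to an equation between lifts, up to the integer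
  by which lifts are ambiguous.\<close>

lemma linearisations_of_words_differ_by_constant:
  assumes "a \<in> words" "b \<in> words" "lift_of a d \<alpha>" "d \<ge> 2" "lift_of b e \<beta>" "e \<ge> 2"
    and A: "\<And>x. (\<lambda>n. (\<alpha> ^^ n) x / real d ^ n) \<longlonglongrightarrow> A x"
    and B: "\<And>x. (\<lambda>n. (\<beta> ^^ n) x / real e ^ n) \<longlonglongrightarrow> B x"
  shows "A x - A y = B x - B y"
proof (rule linearisations_differ_by_constant[OF _ assms(4) _ assms(6) A B])
  show "circle_lift d \<alpha>" "circle_lift e \<beta>"
    using assms lift_of_circle_lift by blast+
  fix N
  obtain u v where uv: "u \<in> insert id words" "v \<in> insert id words" "u \<circ> (a ^^ N) = v \<circ> (b ^^ N)"
  proof (cases "N \<ge> 1")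
    case True
    then show ?thesis
      using words_common_left_multiple[of "a ^^ N" "b ^^ N"] words_funpow assms(1,2) that by blast
  next
    case False
    then have "N = 0" by simp
    then show ?thesis using that[of id id] by (simp only: funpow.simps insertI1)
  qed
  obtain p \<mu> q \<nu> where \<mu>: "p \<ge> 1" "lift_of u p \<mu>" and \<nu>: "lift_of v q \<nu>"
    using words_lift[OF uv(1)] words_lift[OF uv(2)] by metis
  have "lift_of (u \<circ> (a ^^ N)) (p * d ^ N) (\<mu> \<circ> (\<alpha> ^^ N))"
    by (intro lift_of_compose lift_of_funpow \<mu> assms)
  moreover have "lift_of (u \<circ> (a ^^ N)) (q * e ^ N) (\<nu> \<circ> (\<beta> ^^ N))"
    unfolding uv(3) by (intro lift_of_compose lift_of_funpow \<nu> assms)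
  ultimately obtain k :: int where "\<And>x. (\<nu> \<circ> (\<beta> ^^ N)) x = (\<mu> \<circ> (\<alpha> ^^ N)) x + of_int k"
    using lift_of_unique by blast
  then have "\<mu> ((\<alpha> ^^ N) x) = \<nu> ((\<beta> ^^ N) x) + (- of_int k)" for x
    by simp
  then show "\<exists>p u q v k. circle_lift p u \<and> circle_lift q v \<and> p \<ge> 1 \<and>
      (\<forall>x. u ((\<alpha> ^^ N) x) = v ((\<beta> ^^ N) x) + k)"
    using lift_of_circle_lift[OF \<mu>(2)] lift_of_circle_lift[OF \<nu>] \<mu>(1) by blast
qed

text \<open>The linearisation \<open>H\<close> of \<open>G\<close> semiconjugates every word to an affine map. For \<open>F\<close>, which may have degree one and then
  no linearisation of its own, this is read off from \<open>F \<circ> G\<close>, using that the lift of \<open>G\<close> is surjective.\<close>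

theorem preperiodic_points_eq_if_degree_ge_2:
  assumes G: "lift_of G e \<gamma>" "e \<ge> 2"
  shows "preperiodic_points F = preperiodic_points G"
proof -
  obtain H where H: "circle_lift 1 H" "\<And>x. H (\<gamma> x) = real e * H x"
    "\<And>x. (\<lambda>n. (\<gamma> ^^ n) x / real e ^ n) \<longlonglongrightarrow> H x"
    by (rule circle_lift_linearisation[OF lift_of_circle_lift[OF G(1)] G(2)]) (rule that)
  have H_int: "H (x + of_int k) = H x + of_int k" for x k
    using circle_lift_add_int[OF H(1), of x k] by simp
  define aff where "aff = (\<lambda>s m a. \<exists>\<beta>. lift_of s m \<beta> \<and> (\<forall>x. H (\<beta> x) = real m * H x + a))"
  obtain d \<phi> where F: "d \<ge> 1" "lift_of F d \<phi>"
    using words_lift words_F by blast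
  obtain c where c: "\<And>x. H (\<phi> x) = real d * H x + c"
  proof -
    have FG: "lift_of (F \<circ> G) (d * e) (\<phi> \<circ> \<gamma>)"
      by (rule lift_of_compose[OF F(2) G(1)])
    have de: "d * e \<ge> 2"
      using mult_le_mono[OF F(1) G(2)] by (simp only: mult_1)
    obtain A where A: "\<And>x. A ((\<phi> \<circ> \<gamma>) x) = real (d * e) * A x"
      "\<And>x. (\<lambda>n. ((\<phi> \<circ> \<gamma>) ^^ n) x / real (d * e) ^ n) \<longlonglongrightarrow> A x"
      by (rule circle_lift_linearisation[OF lift_of_circle_lift[OF FG] de]) (rule that)
    have AH: "A x - A y = H x - H y" for x y
      by (rule linearisations_of_words_differ_by_constant[OF _ words_G FG de G A(2) H(3)])
        (intro words_compose words_F words_G)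
    have A_eq: "A x = H x + (A 0 - H 0)" for x
      using AH[of x 0] by (simp add: algebra_simps)
    have "H (\<phi> x) = real d * H x + (real (d * e) - 1) * (A 0 - H 0)" for x
    proof -
      obtain y where y: "\<gamma> y = x"
        using circle_lift_surj[OF lift_of_circle_lift[OF G(1)]] G(2) by fastforce
      have "H (\<phi> x) + (A 0 - H 0) = real (d * e) * (H y + (A 0 - H 0))"
        using A(1)[of y] A_eq[of "\<phi> (\<gamma> y)"] A_eq[of y] y by simp
      moreover have "H x = real e * H y"
        using H(2)[of y] y by simp
      ultimately show ?thesis
        by (simp add: algebra_simps)
    qed
    then show ?thesis
      using that by blast
  qed
  interpret affine_pair F G aff d e c
  proof unfold_locales
    show "aff id 1 0"
      unfolding aff_def using lift_of_id by (intro exI[of _ id]) simp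
    show "aff (s \<circ> t) (m * n) (real m * b + a)" if ab: "aff s m a" "aff t n b" for s m a t n b
    proof -
      obtain \<beta> where \<beta>: "lift_of s m \<beta>" "\<forall>x. H (\<beta> x) = real m * H x + a"
        using ab(1) unfolding aff_def by blast
      obtain \<tau> where \<tau>: "lift_of t n \<tau>" "\<forall>x. H (\<tau> x) = real n * H x + b"
        using ab(2) unfolding aff_def by blast
      have "\<forall>x. H ((\<beta> \<circ> \<tau>) x) = real (m * n) * H x + (real m * b + a)"
        using \<beta>(2) \<tau>(2) by (simp add: algebra_simps)
      then show ?thesis
        unfolding aff_def using lift_of_compose[OF \<beta>(1) \<tau>(1)] by blast
    qed
    show "m = n \<and> a - b \<in> \<int>" if ab: "aff s m a" "aff s n b" for s m a n b
    proof -
      obtain \<beta> where \<beta>: "lift_of s m \<beta>" "\<forall>x. H (\<beta> x) = real m * H x + a"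
        using ab(1) unfolding aff_def by blast
      obtain \<tau> where \<tau>: "lift_of s n \<tau>" "\<forall>x. H (\<tau> x) = real n * H x + b"
        using ab(2) unfolding aff_def by blast
      obtain k :: int where k: "m = n" "\<And>x. \<tau> x = \<beta> x + of_int k"
        using lift_of_unique[OF \<beta>(1) \<tau>(1)] by blast
      have "a - b = of_int (- k)"
        using \<beta>(2)[rule_format, of 0] \<tau>(2)[rule_format, of 0] k H_int[of "\<beta> 0" k] by simp
      then show ?thesis
        using k(1) by (simp only: Ints_of_int)
    qed
    show "s = t" if st: "s \<in> insert id words" "t \<in> insert id words"
      and aff: "aff s m a" "aff t m b" and int: "a - b \<in> \<int>" for s t m a b
    proof -
      obtain \<beta> where \<beta>: "lift_of s m \<beta>" "\<forall>x. H (\<beta> x) = real m * H x + a"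
        using aff(1) unfolding aff_def by blast
      obtain \<tau> where \<tau>: "lift_of t m \<tau>" "\<forall>x. H (\<tau> x) = real m * H x + b"
        using aff(2) unfolding aff_def by blast
      obtain k :: int where k: "a - b = of_int k"
        using int by (auto elim: Ints_cases)
      have "m \<ge> 1"
        using words_lift[OF st(1)] lift_of_unique[OF \<beta>(1)] by metis
      have "H (\<beta> x) = H (\<tau> x + of_int k)" for x
        using \<beta>(2)[rule_format, of x] \<tau>(2)[rule_format, of x] H_int[of "\<tau> x" k] k by simp
      then have "infinite {x \<in> {0..<1}. \<beta> x = \<tau> x + of_int k}"
        by (rule agree_infinitely_if_same_semiconjugate[OF H(1) lift_of_circle_lift[OF \<beta>(1)] \<open>m \<ge> 1\<close>])
      then show ?thesis
        by (rule eq_if_lifts_agree_infinitely[OF st \<beta>(1) lift_of_shift[OF \<tau>(1)]])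
    qed
    show "aff F d c" "aff G e 0"
      unfolding aff_def using F c G H(2) by (auto intro!: exI)
  qed (use F G in auto)
  show ?thesis
    by (rule preperiodic_points_eq)
qed

end

section \<open>Bounded periodic Fatou components\<close>

lemma iterates_holomorphic:
  assumes "f holomorphic_on UNIV"
  shows "(f ^^ n) holomorphic_on UNIV"
proof (induction n)
  case 0
  then show ?case by (simp add: id_def)
next
  case (Suc n)
  show ?case
    unfolding funpow.simps by (rule entire_compose[OF assms Suc])
qed

abbreviation has_normal_subsequence :: "complex set \<Rightarrow> (nat \<Rightarrow> complex \<Rightarrow> complex) \<Rightarrow> bool" where
  "has_normal_subsequence U F \<equiv> (\<exists>r. strict_mono r \<and> ((\<exists>h. h holomorphic_on U \<and>
      (\<forall>K. compact K \<and> K \<subseteq> U \<longrightarrow> uniform_limit K (F \<circ> r) h sequentially)) \<or>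
      locally_uniformly_to_infinity_on U (F \<circ> r)))"

text \<open>Normality is a statement about arbitrary sequences of iterates, which may repeat one iterate
  infinitely often.\<close>

lemma normal_family_on_if_constant_subsequence:
  fixes F :: "nat \<Rightarrow> complex \<Rightarrow> complex"
  assumes "infinite {n. F n = h}" "h holomorphic_on U"
  shows "has_normal_subsequence U F"
proof -
  define r where "r = enumerate {n. F n = h}"
  have "strict_mono r"
    unfolding r_def using assms(1) by (rule strict_mono_enumerate)
  moreover have "F (r n) = h" for n
    using enumerate_in_set[OF assms(1), of n] by (simp add: r_def)
  then have "F \<circ> r = (\<lambda>_. h)"
    by (auto simp: fun_eq_iff)
  then have "uniform_limit K (F \<circ> r) h sequentially" for K
    by (simp add: uniform_limit_const)
  ultimately show ?thesis
    using assms(2) by blast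
qed

text \<open>A constant map has a finite set of iterates. This rules out constant generators, whose only Fatou
  component is unbounded.\<close>

lemma Fatou_set_constant:
  assumes "f constant_on UNIV"
  shows "Fatou_set f = UNIV"
proof -
  obtain c where c: "f = (\<lambda>_. c)"
    using assms by (auto simp: constant_on_def)
  have "normal_family_on UNIV (range (\<lambda>n. f ^^ n))"
    unfolding normal_family_on_def
  proof (intro allI impI)
    fix F :: "nat \<Rightarrow> complex \<Rightarrow> complex"
    assume F: "range F \<subseteq> range (\<lambda>n. f ^^ n)"
    have "f ^^ n \<in> {id, f}" for n
      by (cases n) (auto simp: c)
    then have "range (\<lambda>n. f ^^ n) \<subseteq> {id, f}"
      by (intro image_subsetI)
    with F have "range F \<subseteq> {id, f}"
      by (rule subset_trans)
    moreover from this have "finite (range F)"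
      by (rule finite_subset) simp
    then obtain m where m: "infinite {n. F n = F m}"
      using pigeonhole_infinite[OF infinite_UNIV_nat, of F] by auto
    ultimately have "F m = id \<or> F m = f"
      by (auto simp only: image_subset_iff)
    then have "F m holomorphic_on UNIV"
      unfolding c id_def by (elim disjE) simp_all
    then show "has_normal_subsequence UNIV F"
      by (rule normal_family_on_if_constant_subsequence[OF m])
  qed
  then have "z \<in> Fatou_set f" for z
    unfolding Fatou_set_def using open_UNIV connected_UNIV by blast
  then show ?thesis
    by blast
qed

lemma Fatou_set_open: "open (Fatou_set f)"
proof (subst open_subopen, intro ballI)
  fix z assume "z \<in> Fatou_set f"
  then obtain U where U: "open U" "connected U" "z \<in> U" "normal_family_on U (range (\<lambda>n. f ^^ n))"
    unfolding Fatou_set_def by blast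
  then have "U \<subseteq> Fatou_set f"
    unfolding Fatou_set_def by blast
  then show "\<exists>T. open T \<and> z \<in> T \<and> T \<subseteq> Fatou_set f"
    using U by blast
qed

text \<open>A sequence of iterates of \<open>f\<close> near \<open>z\<close> is, apart from the terms equal to the identity, a sequence of
  iterates near \<open>f z\<close> precomposed with \<open>f\<close>.\<close>

lemma Fatou_set_backward_invariant:
  assumes hol: "f holomorphic_on UNIV" and fz: "f z \<in> Fatou_set f"
  shows "z \<in> Fatou_set f"
proof -
  obtain U where U: "open U" "connected U" "f z \<in> U" "normal_family_on U (range (\<lambda>n. f ^^ n))"
    using fz unfolding Fatou_set_def by blast
  have cont: "continuous_on UNIV f"
    using hol by (rule holomorphic_on_imp_continuous_on)
  then have "open (f -` U)"
    using U(1) by (simp add: continuous_on_open_vimage)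
  then obtain \<epsilon> where \<epsilon>: "\<epsilon> > 0" "ball z \<epsilon> \<subseteq> f -` U"
    using U(3) openE by (metis vimageI)
  define V where "V = ball z \<epsilon>"
  have V: "open V" "connected V" "z \<in> V" "f ` V \<subseteq> U"
    using \<epsilon> by (auto simp: V_def)
  have "normal_family_on V (range (\<lambda>n. f ^^ n))"
    unfolding normal_family_on_def
  proof (intro allI impI)
    fix F :: "nat \<Rightarrow> complex \<Rightarrow> complex"
    assume "range F \<subseteq> range (\<lambda>n. f ^^ n)"
    then have "\<forall>n. \<exists>k. F n = f ^^ k"
      by blast
    then obtain m where m: "\<And>n. F n = f ^^ m n"
      by metis
    show "has_normal_subsequence V F"
    proof (cases "infinite {n. F n = id}")
      case True
      then show ?thesis
        by (rule normal_family_on_if_constant_subsequence) (simp add: id_def)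
    next
      case False
      then obtain n0 where n0: "\<And>n. n \<ge> n0 \<Longrightarrow> F n \<noteq> id"
        unfolding finite_nat_set_iff_bounded by (metis leD mem_Collect_eq)
      define F' where "F' = (\<lambda>n. f ^^ (m n - 1))"
      have F_eq: "F n = F' n \<circ> f" if "n \<ge> n0" for n
      proof -
        have "m n \<noteq> 0"
          using n0[OF that] m[of n] by (metis funpow.simps(1))
        then obtain k where "m n = Suc k"
          by (cases "m n") auto
        then show ?thesis
          by (simp only: m F'_def funpow_Suc_right diff_Suc_1)
      qed
      have "range F' \<subseteq> range (\<lambda>n. f ^^ n)"
        by (auto simp: F'_def)
      then obtain r where r: "strict_mono r" "(\<exists>h. h holomorphic_on U \<and>
          (\<forall>K. compact K \<and> K \<subseteq> U \<longrightarrow> uniform_limit K (F' \<circ> r) h sequentially)) \<or>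
          locally_uniformly_to_infinity_on U (F' \<circ> r)"
        using U(4) unfolding normal_family_on_def by blast
      have ev: "\<forall>\<^sub>F n in sequentially. (F \<circ> r) n = (F' \<circ> r) n \<circ> f"
        unfolding eventually_sequentially
        using F_eq seq_suble[OF r(1)] by (intro exI[of _ n0] allI impI) (metis comp_apply le_trans)
      have img: "compact (f ` K) \<and> f ` K \<subseteq> U" if "compact K" "K \<subseteq> V" for K
        using that V(4) cont by (auto intro: compact_continuous_image continuous_on_subset)
      from r(2) show ?thesis
      proof (elim disjE exE conjE)
        fix h assume h: "h holomorphic_on U"
          and lim: "\<forall>K. compact K \<and> K \<subseteq> U \<longrightarrow> uniform_limit K (F' \<circ> r) h sequentially"
        have "uniform_limit K (F \<circ> r) (h \<circ> f) sequentially" if K: "compact K" "K \<subseteq> V" for K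
          unfolding uniform_limit_iff
        proof (intro allI impI)
          fix e :: real assume "e > 0"
          have "uniform_limit (f ` K) (F' \<circ> r) h sequentially"
            using lim img[OF K] by blast
          then have "\<forall>\<^sub>F n in sequentially. \<forall>x\<in>f ` K. dist ((F' \<circ> r) n x) (h x) < e"
            using \<open>e > 0\<close> unfolding uniform_limit_iff by blast
          with ev show "\<forall>\<^sub>F n in sequentially. \<forall>x\<in>K. dist ((F \<circ> r) n x) ((h \<circ> f) x) < e"
            by eventually_elim (simp only: comp_apply ball_simps)
        qed
        moreover have "h \<circ> f holomorphic_on V"
          using V(4) hol h by (auto intro: holomorphic_on_compose_gen holomorphic_on_subset)
        ultimately show ?thesis
          using r(1) by blast
      next
        assume inf: "locally_uniformly_to_infinity_on U (F' \<circ> r)"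
        have "locally_uniformly_to_infinity_on V (F \<circ> r)"
          unfolding locally_uniformly_to_infinity_on_def
        proof (intro allI impI)
          fix K and B :: real assume K: "compact K \<and> K \<subseteq> V"
          have "\<forall>\<^sub>F n in sequentially. \<forall>x\<in>f ` K. norm ((F' \<circ> r) n x) > B"
            using inf img[of K] K unfolding locally_uniformly_to_infinity_on_def by blast
          with ev show "\<forall>\<^sub>F n in sequentially. \<forall>x\<in>K. norm ((F \<circ> r) n x) > B"
            by eventually_elim (simp only: comp_apply ball_simps)
        qed
        then show ?thesis
          using r(1) by blast
      qed
    qed
  qed
  then show ?thesis
    unfolding Fatou_set_def using V by blast
qed

lemma Fatou_set_backward_invariant_funpow:
  assumes "f holomorphic_on UNIV" "(f ^^ n) z \<in> Fatou_set f"
  shows "z \<in> Fatou_set f"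
  using assms(2)
proof (induction n)
  case (Suc n)
  have "f ((f ^^ n) z) \<in> Fatou_set f"
    using Suc.prems by simp
  then show ?case
    using Fatou_set_backward_invariant[OF assms(1)] Suc.IH by blast
qed simp

lemma Fatou_set_if_iterates_bounded:
  assumes hol: "f holomorphic_on UNIV" and V: "open V" "connected V"
    and bound: "\<And>n z. z \<in> V \<Longrightarrow> norm ((f ^^ n) z) \<le> R"
  shows "V \<subseteq> Fatou_set f"
proof -
  have "normal_family_on V (range (\<lambda>n. f ^^ n))"
    unfolding normal_family_on_def
  proof (intro allI impI)
    fix F :: "nat \<Rightarrow> complex \<Rightarrow> complex"
    assume F: "range F \<subseteq> range (\<lambda>n. f ^^ n)"
    have hol': "h holomorphic_on V" if "h \<in> range (\<lambda>n. f ^^ n)" for h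
      using that iterates_holomorphic[OF hol] by (auto intro: holomorphic_on_subset)
    have "\<exists>B. \<forall>h\<in>range (\<lambda>n. f ^^ n). \<forall>z\<in>K. norm (h z) \<le> B" if "compact K" "K \<subseteq> V" for K
      using bound that by blast
    from Montel[OF V(1) hol' this F] show "has_normal_subsequence V F"
      by (metis (no_types, lifting))
  qed
  then show ?thesis
    unfolding Fatou_set_def using V by blast
qed

locale bounded_periodic_component =
  fixes f :: "complex \<Rightarrow> complex" and D :: "complex set" and p :: nat
  assumes hol: "f holomorphic_on UNIV" and bounded_D: "bounded D"
    and component: "D \<in> components (Fatou_set f)"
    and p: "p \<ge> 1" "(f ^^ p) ` D \<subseteq> D"
begin

lemma component_open: "open D"
  by (rule open_components[OF Fatou_set_open component])

lemma component_connected: "connected D"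
  by (rule in_components_connected[OF component])

lemma funpow_multiple_maps: "(f ^^ (p * n)) ` D \<subseteq> D"
proof (induction n)
  case (Suc n)
  have "(f ^^ (p * Suc n)) z = (f ^^ p) ((f ^^ (p * n)) z)" for z
    by (simp add: funpow_add)
  then show ?case
    using Suc p(2) by (auto simp: image_subset_iff)
qed simp

lemma nonconst: "\<not> f constant_on UNIV"
proof
  assume "f constant_on UNIV"
  then have "Fatou_set f = UNIV"
    by (rule Fatou_set_constant)
  then have "D = UNIV"
    using component connected_component_UNIV by (simp add: components_def)
  then show False
    using bounded_D not_bounded_UNIV by blast
qed

lemma nonempty: "D \<noteq> {}"
  by (rule in_components_nonempty[OF component])

text \<open>An iterate is \<open>f\<^sup>j \<circ> f\<^sup>p\<^sup>n\<close> with \<open>j < p\<close>, and \<open>f\<^sup>p\<^sup>n\<close> maps \<open>D\<close> into itself.\<close>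

lemma iterates_bounded_on_component: "\<exists>R. \<forall>n. \<forall>z\<in>D. norm ((f ^^ n) z) \<le> R"
proof -
  have "bounded ((f ^^ j) ` D)" for j
  proof -
    have "continuous_on (closure D) (f ^^ j)"
      by (intro holomorphic_on_imp_continuous_on holomorphic_on_subset[OF iterates_holomorphic[OF hol]]) simp
    moreover have "compact (closure D)"
      using bounded_D by simp
    ultimately have "bounded ((f ^^ j) ` closure D)"
      by (intro compact_imp_bounded compact_continuous_image)
    then show ?thesis
      by (rule bounded_subset) (use closure_subset in blast)
  qed
  then have "bounded (\<Union>j<p. (f ^^ j) ` D)"
    by (intro bounded_UN) auto
  then obtain R where R: "\<And>x. x \<in> (\<Union>j<p. (f ^^ j) ` D) \<Longrightarrow> norm x \<le> R"
    unfolding bounded_iff by blast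
  have "norm ((f ^^ n) z) \<le> R" if "z \<in> D" for n z
  proof (rule R)
    have "(f ^^ n) z = (f ^^ (n mod p)) ((f ^^ (p * (n div p))) z)"
      by (metis add.commute comp_apply funpow_add mult_div_mod_eq)
    moreover have "(f ^^ (p * (n div p))) z \<in> D"
      using funpow_multiple_maps that by blast
    ultimately show "(f ^^ n) z \<in> (\<Union>j<p. (f ^^ j) ` D)"
      using p(1) by (intro UN_I[of "n mod p"]) auto
  qed
  then show ?thesis by blast
qed

text \<open>By the maximum principle the iterates stay bounded on every region enclosed by a loop in \<open>D\<close>,
  so such a region lies in the Fatou set.\<close>

lemma simply_connected_component: "simply_connected D"
proof -
  obtain R where R: "\<And>n z. z \<in> D \<Longrightarrow> norm ((f ^^ n) z) \<le> R"
    using iterates_bounded_on_component by blast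
  have "winding_number g z = 0"
    if g: "path g" "path_image g \<subseteq> D" "pathfinish g = pathstart g" and z: "z \<notin> D" for g z
  proof (rule winding_number_zero_in_outside[OF g(1,3)])
    have zg: "z \<in> - path_image g"
      using g(2) z by blast
    show "z \<in> outside (path_image g)"
    proof (rule ccontr)
      assume "z \<notin> outside (path_image g)"
      define V where "V = connected_component_set (- path_image g) z"
      have closed: "closed (path_image g)"
        using closed_path_image g(1) by blast
      have V: "open V" "connected V" "z \<in> V" "bounded V"
        using closed zg \<open>z \<notin> outside (path_image g)\<close>
        by (auto simp: V_def outside_def intro: open_connected_component)
      have fr: "frontier V \<subseteq> path_image g"
        unfolding V_def using frontier_of_connected_component_subset[of "- path_image g" z] closed
        by (metis closed_open frontier_complement frontier_subset_closed subset_trans)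
      have "norm ((f ^^ n) w) \<le> R" if "w \<in> V" for n w
      proof (rule maximum_modulus_frontier[of "f ^^ n" V])
        show "(f ^^ n) holomorphic_on interior V"
          using iterates_holomorphic[OF hol] by (rule holomorphic_on_subset) simp
        show "continuous_on (closure V) (f ^^ n)"
          by (intro holomorphic_on_imp_continuous_on holomorphic_on_subset[OF iterates_holomorphic[OF hol]]) simp
        show "norm ((f ^^ n) x) \<le> R" if "x \<in> frontier V" for x
          using R fr g(2) that by blast
      qed (use V that in auto)
      then have "V \<subseteq> Fatou_set f"
        by (rule Fatou_set_if_iterates_bounded[OF hol V(1,2)])
      moreover have "frontier V \<noteq> {}"
        using V by (metis empty_iff frontier_eq_empty not_bounded_UNIV)
      then obtain x where "x \<in> frontier V"
        by blast
      then have "x \<in> D" "x \<in> closure V"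
        using fr g(2) by (auto simp: frontier_def)
      then have "D \<inter> V \<noteq> {}"
        using component_open open_Int_closure_eq_empty by blast
      ultimately have "V \<subseteq> D"
        using components_maximal[OF component V(2)] by blast
      then show False
        using V(3) z by blast
    qed
  qed
  then show ?thesis
    using simply_connected_eq_winding_number_zero[OF component_open] component_connected by blast
qed

text \<open>The preimage in the closure of \<open>D\<close> is compact. By backward invariance its points lie in the Fatou set, so none of them is
  on the boundary of \<open>D\<close>.\<close>

lemma iterate_proper_on_component:
  assumes "compact K" "K \<subseteq> D"
  shows "compact {z \<in> D. (f ^^ n) z \<in> K}"
proof -
  have cont: "continuous_on (closure D) (f ^^ n)"
    by (intro holomorphic_on_imp_continuous_on holomorphic_on_subset[OF iterates_holomorphic[OF hol]]) simp
  have "z \<in> D" if z: "z \<in> closure D" "(f ^^ n) z \<in> K" for z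
  proof -
    have "(f ^^ n) z \<in> Fatou_set f"
      using z(2) assms(2) component in_components_subset by blast
    then have "z \<in> Fatou_set f"
      by (rule Fatou_set_backward_invariant_funpow[OF hol])
    then obtain \<epsilon> where \<epsilon>: "\<epsilon> > 0" "ball z \<epsilon> \<subseteq> Fatou_set f"
      using Fatou_set_open openE by blast
    then have "D \<inter> ball z \<epsilon> \<noteq> {}"
      using z(1) by (metis closure_approachable disjoint_iff dist_commute mem_ball)
    then have "ball z \<epsilon> \<subseteq> D"
      using components_maximal[OF component connected_ball \<epsilon>(2)] by blast
    then show ?thesis
      using \<epsilon>(1) by auto
  qed
  then have "{z \<in> D. (f ^^ n) z \<in> K} = closure D \<inter> (f ^^ n) -` K"
    using closure_subset by auto
  moreover have "closed (closure D \<inter> (f ^^ n) -` K)"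
    by (intro continuous_closed_preimage cont closed_closure compact_imp_closed assms(1))
  moreover have "bounded (closure D \<inter> (f ^^ n) -` K)"
    using bounded_D by (meson bounded_Int bounded_closure)
  ultimately show ?thesis
    by (simp add: compact_eq_bounded_closed)
qed

end

section \<open>Two-by-two matrices\<close>

text \<open>The symbol \<open>$\<close> is wanted for matrix entries only; its use for coefficients of power series makes every
  such term ambiguous.\<close>

no_notation fps_nth (infixl "$" 75)


lemma mat2_mult_entries:
  fixes A B :: "complex^2^2"
  shows "(A ** B) $ 1 $ 1 = A $ 1 $ 1 * B $ 1 $ 1 + A $ 1 $ 2 * B $ 2 $ 1"
    "(A ** B) $ 1 $ 2 = A $ 1 $ 1 * B $ 1 $ 2 + A $ 1 $ 2 * B $ 2 $ 2"
    "(A ** B) $ 2 $ 1 = A $ 2 $ 1 * B $ 1 $ 1 + A $ 2 $ 2 * B $ 2 $ 1"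
    "(A ** B) $ 2 $ 2 = A $ 2 $ 1 * B $ 1 $ 2 + A $ 2 $ 2 * B $ 2 $ 2"
  by (simp_all add: matrix_matrix_mult_def sum_2)

lemma mat2_one_entries [simp]:
  "(mat 1 :: complex^2^2) $ 1 $ 1 = 1" "(mat 1 :: complex^2^2) $ 1 $ 2 = 0"
  "(mat 1 :: complex^2^2) $ 2 $ 1 = 0" "(mat 1 :: complex^2^2) $ 2 $ 2 = 1"
  by (simp_all add: mat_def)

lemma mat2_eq_iff:
  fixes A B :: "complex^2^2"
  shows "A = B \<longleftrightarrow> A $ 1 $ 1 = B $ 1 $ 1 \<and> A $ 1 $ 2 = B $ 1 $ 2 \<and> A $ 2 $ 1 = B $ 2 $ 1 \<and> A $ 2 $ 2 = B $ 2 $ 2"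
  by (auto simp: vec_eq_iff forall_2)

lemma mat2_mult_minus:
  fixes A B :: "complex^2^2"
  shows "A ** (- B) = - (A ** B)" "(- A) ** B = - (A ** B)"
  by (simp_all add: mat2_eq_iff mat2_mult_entries)

definition mat2 :: "complex \<Rightarrow> complex \<Rightarrow> complex \<Rightarrow> complex \<Rightarrow> complex^2^2" where
  "mat2 a b c d = vector [vector [a, b], vector [c, d]]"

lemma mat2_entries [simp]:
  "mat2 a b c d $ 1 $ 1 = a" "mat2 a b c d $ 1 $ 2 = b" "mat2 a b c d $ 2 $ 1 = c" "mat2 a b c d $ 2 $ 2 = d"
  by (simp_all add: mat2_def)

text \<open>The class-based power of \<open>complex^2^2\<close> is the entrywise one.\<close>

definition mat_power :: "complex^2^2 \<Rightarrow> nat \<Rightarrow> complex^2^2" where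
  "mat_power A n = ((**) A ^^ n) (mat 1)"

lemma mat_power_simps [simp]: "mat_power A 0 = mat 1" "mat_power A (Suc n) = A ** mat_power A n"
  by (simp_all add: mat_power_def)

definition mat_word :: "complex^2^2 \<Rightarrow> complex^2^2 \<Rightarrow> bool list \<Rightarrow> complex^2^2" where
  "mat_word A B w = foldr (\<lambda>c M. (if c then A else B) ** M) w (mat 1)"

lemma mat_word_simps [simp]:
  "mat_word A B [] = mat 1" "mat_word A B (c # w) = (if c then A else B) ** mat_word A B w"
  by (simp_all add: mat_word_def)

lemma mat_word_append: "mat_word A B (v @ w) = mat_word A B v ** mat_word A B w"
  by (induction v) (auto simp: matrix_mul_assoc)

lemma mat_word_transpose:
  "transpose (mat_word A B w) = mat_word (transpose A) (transpose B) (rev w)"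
  by (induction w) (auto simp: matrix_transpose_mul mat_word_append transpose_mat)

lemma conjugate_mult:
  fixes P A B P' :: "complex^2^2"
  assumes "P' ** P = mat 1"
  shows "(P ** A ** P') ** (P ** B ** P') = P ** (A ** B) ** P'"
proof -
  have "(P ** A ** P') ** (P ** B ** P') = P ** A ** (P' ** P) ** B ** P'"
    by (simp only: matrix_mul_assoc)
  then show ?thesis
    by (simp only: assms matrix_mul_rid matrix_mul_assoc)
qed

lemma conjugate_word:
  fixes P P' :: "complex^2^2"
  assumes "P ** P' = mat 1" "P' ** P = mat 1"
  shows "mat_word (P ** A ** P') (P ** B ** P') w = P ** mat_word A B w ** P'"
proof (induction w)
  case Nil
  then show ?case using assms by simp
next
  case (Cons c w)
  then show ?case
    using conjugate_mult[OF assms(2)] by (cases c) simp_all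
qed

lemma conjugate_power:
  fixes P P' :: "complex^2^2"
  assumes "P ** P' = mat 1" "P' ** P = mat 1"
  shows "mat_power (P ** A ** P') n = P ** mat_power A n ** P'"
proof (induction n)
  case 0
  then show ?case using assms by simp
next
  case (Suc n)
  then show ?case
    using conjugate_mult[OF assms(2)] by simp
qed

lemma conjugate_cancel:
  fixes P P' :: "complex^2^2"
  assumes "P' ** P = mat 1" "P ** A ** P' = P ** B ** P'"
  shows "A = B"
proof -
  have "P' ** (P ** A ** P') ** P = P' ** (P ** B ** P') ** P"
    by (simp only: assms(2))
  moreover have "P' ** (P ** C ** P') ** P = C" for C
  proof -
    have "P' ** (P ** C ** P') ** P = (P' ** P) ** C ** (P' ** P)"
      by (simp only: matrix_mul_assoc)
    then show ?thesis
      by (simp only: assms(1) matrix_mul_lid matrix_mul_rid)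
  qed
  ultimately show ?thesis
    by simp
qed

section \<open>Ping-pong\<close>

text \<open>Both generators map a cone of first columns into itself, and the slope \<open>\<epsilon>\<close> separates the two images.
  So the value of a word reveals its first letter, even up to sign, and equal values can be cancelled
  letter by letter.\<close>

lemma ping_pong_words:
  fixes U V :: "complex^2^2" and K \<epsilon> :: real
  assumes K: "K \<ge> 0"
    and U: "\<And>M :: complex^2^2. M $ 1 $ 1 \<noteq> 0 \<Longrightarrow> norm (M $ 2 $ 1) \<le> K * norm (M $ 1 $ 1) \<Longrightarrow>
      (U ** M) $ 1 $ 1 \<noteq> 0 \<and> norm ((U ** M) $ 2 $ 1) \<le> K * norm ((U ** M) $ 1 $ 1) \<and>
      norm ((U ** M) $ 2 $ 1) \<le> \<epsilon> * norm ((U ** M) $ 1 $ 1)"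
    and V: "\<And>M :: complex^2^2. M $ 1 $ 1 \<noteq> 0 \<Longrightarrow> norm (M $ 2 $ 1) \<le> K * norm (M $ 1 $ 1) \<Longrightarrow>
      (V ** M) $ 1 $ 1 \<noteq> 0 \<and> norm ((V ** M) $ 2 $ 1) \<le> K * norm ((V ** M) $ 1 $ 1) \<and>
      norm ((V ** M) $ 2 $ 1) > \<epsilon> * norm ((V ** M) $ 1 $ 1)"
    and det: "det U \<noteq> 0" "det V \<noteq> 0"
    and nontrivial: "\<And>w. w \<noteq> [] \<Longrightarrow> mat_word U V w \<noteq> mat 1 \<and> mat_word U V w \<noteq> - mat 1"
    and "v \<noteq> w"
  shows "mat_word U V v \<noteq> mat_word U V w \<and> mat_word U V v \<noteq> - mat_word U V w"
proof -
  define W where "W = mat_word U V"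
  have cone: "W w $ 1 $ 1 \<noteq> 0 \<and> norm (W w $ 2 $ 1) \<le> K * norm (W w $ 1 $ 1)" for w
  proof (induction w)
    case Nil
    then show ?case using K by (simp add: W_def)
  next
    case (Cons c w)
    then show ?case using U[of "W w"] V[of "W w"] by (cases c) (simp_all add: W_def)
  qed
  have cancel: "A = B" if eq: "X ** A = X ** B" and "det X \<noteq> 0" for X A B :: "complex^2^2"
  proof -
    obtain Y where "Y ** X = mat 1"
      using \<open>det X \<noteq> 0\<close> invertible_det_nz[of X] unfolding invertible_def by blast
    then show ?thesis
      using eq by (metis matrix_mul_assoc matrix_mul_lid)
  qed
  have "W v \<noteq> W w \<and> W v \<noteq> - W w"
    using \<open>v \<noteq> w\<close>
  proof (induction v arbitrary: w)
    case Nil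
    then show ?case
      using nontrivial[of w] by (auto simp: W_def)
  next
    case (Cons c v)
    show ?case
    proof (cases w)
      case Nil
      then show ?thesis
        using nontrivial[of "c # v"] by (simp only: W_def mat_word_simps(1) list.distinct) simp
    next
      case (Cons d w')
      define X where "X = (if c then U else V)"
      have X: "det X \<noteq> 0" "W (c # v) = X ** W v"
        using det by (auto simp: X_def W_def)
      show ?thesis
      proof (cases "c = d")
        case True
        then have w: "W w = X ** W w'"
          by (simp add: Cons X_def W_def)
        have "W v \<noteq> W w' \<and> W v \<noteq> - W w'"
          using Cons.IH[of w'] Cons.prems Cons True by simp
        then show ?thesis
          using cancel[OF _ X(1), of "W v" "W w'"] cancel[OF _ X(1), of "W v" "- W w'"]
          unfolding X(2) w mat2_mult_minus(1) by blast
      next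
        case False
        \<comment> \<open>the slope of the first column reveals the first letter, and it does not see the sign\<close>
        have ratio: "(norm (W (b # u) $ 2 $ 1) \<le> \<epsilon> * norm (W (b # u) $ 1 $ 1)) \<longleftrightarrow> b" for b u
          using U[of "W u"] V[of "W u"] cone[of u] by (cases b) (auto simp: W_def not_le)
        show ?thesis
        proof (intro conjI notI)
          assume "W (c # v) = W w"
          then show False
            using ratio[of c v] ratio[of d w'] False unfolding Cons by simp
        next
          assume "W (c # v) = - W w"
          then show False
            using ratio[of c v] ratio[of d w'] False unfolding Cons by simp
        qed
      qed
    qed
  qed
  then show ?thesis
    by (simp add: W_def)
qed

lemma mat_power_diagonal: "mat_power (mat2 a 0 0 d) n = mat2 (a ^ n) 0 0 (d ^ n)"
  by (induction n) (simp_all add: mat2_eq_iff mat2_mult_entries)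

text \<open>The first basis vector is attracting for the diagonal matrix; \<open>B\<close> moves it to a direction
  that is neither of the two axes.\<close>

lemma diagonal_ping_pong:
  fixes B :: "complex^2^2" and \<kappa>\<^sub>1 \<kappa>\<^sub>2 :: complex
  assumes \<kappa>: "norm \<kappa>\<^sub>2 < norm \<kappa>\<^sub>1" "\<kappa>\<^sub>2 \<noteq> 0" and det: "det B \<noteq> 0" and B: "B $ 1 $ 1 \<noteq> 0" "B $ 2 $ 1 \<noteq> 0"
  obtains N U where "N \<ge> 1" "U = mat_power (mat2 \<kappa>\<^sub>1 0 0 \<kappa>\<^sub>2) N"
    "\<And>v w. \<lbrakk>\<And>x. x \<noteq> [] \<Longrightarrow> mat_word U (B ** U) x \<noteq> mat 1 \<and> mat_word U (B ** U) x \<noteq> - mat 1; v \<noteq> w\<rbrakk>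
      \<Longrightarrow> mat_word U (B ** U) v \<noteq> mat_word U (B ** U) w \<and> mat_word U (B ** U) v \<noteq> - mat_word U (B ** U) w"
proof -
  define a b c d where "a = B $ 1 $ 1" and "b = B $ 1 $ 2" and "c = B $ 2 $ 1" and "d = B $ 2 $ 2"
  have ac: "norm a > 0" "norm c > 0"
    using B by (auto simp: a_def c_def)
  define K where "K = 3 * norm c / norm a"
  \<comment> \<open>on vectors \<open>(x, y)\<close> with \<open>\<bar>y\<bar> \<le> \<delta> \<bar>x\<bar>\<close> the matrix \<open>B\<close> acts up to factors 1/2 and 3/2 like \<open>(a x, c x)\<close>\<close>
  define \<delta> where "\<delta> = Min {norm a / (2 * (norm b + 1)), norm c / (2 * (norm d + 1)), norm c / (4 * norm a), K}"
  have "K > 0"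
    using ac by (simp add: K_def)
  have \<delta>: "\<delta> > 0" "\<delta> \<le> norm a / (2 * (norm b + 1))" "\<delta> \<le> norm c / (2 * (norm d + 1))"
    "\<delta> \<le> norm c / (4 * norm a)" "\<delta> \<le> K"
    unfolding \<delta>_def using ac \<open>K > 0\<close> by (auto simp: add_nonneg_pos)
  define q where "q = norm \<kappa>\<^sub>2 / norm \<kappa>\<^sub>1"
  have q: "0 \<le> q" "q < 1"
    using \<kappa> by (auto simp: q_def divide_less_eq_1)
  obtain N0 where "q ^ N0 < \<delta> / K"
    using real_arch_pow_inv[of "\<delta> / K" q] \<delta>(1) \<open>K > 0\<close> q by auto
  define N where "N = Suc N0"
  have N: "q ^ N * K \<le> \<delta>"
  proof -
    have "q ^ N \<le> q ^ N0"
      unfolding N_def using q by (simp add: mult_left_le_one_le)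
    then show ?thesis
      using \<open>q ^ N0 < \<delta> / K\<close> \<open>K > 0\<close> by (simp add: field_simps) (smt (verit) mult_left_mono)
  qed
  define U where "U = mat_power (mat2 \<kappa>\<^sub>1 0 0 \<kappa>\<^sub>2) N"
  have U: "U = mat2 (\<kappa>\<^sub>1 ^ N) 0 0 (\<kappa>\<^sub>2 ^ N)"
    by (simp add: U_def mat_power_diagonal)
  have "\<kappa>\<^sub>1 \<noteq> 0"
    using \<kappa> by auto
  have narrow: "(U ** M) $ 1 $ 1 \<noteq> 0 \<and> norm ((U ** M) $ 2 $ 1) \<le> \<delta> * norm ((U ** M) $ 1 $ 1)"
    if "M $ 1 $ 1 \<noteq> 0" "norm (M $ 2 $ 1) \<le> K * norm (M $ 1 $ 1)" for M :: "complex^2^2"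
  proof -
    have "norm (\<kappa>\<^sub>2 ^ N) = q ^ N * norm (\<kappa>\<^sub>1 ^ N)"
      using \<open>\<kappa>\<^sub>1 \<noteq> 0\<close> by (simp add: q_def norm_power power_divide)
    then have "norm (\<kappa>\<^sub>2 ^ N * M $ 2 $ 1) \<le> q ^ N * norm (\<kappa>\<^sub>1 ^ N) * (K * norm (M $ 1 $ 1))"
      unfolding norm_mult using that(2) q by (intro mult_mono) auto
    also have "\<dots> = (q ^ N * K) * norm (\<kappa>\<^sub>1 ^ N * M $ 1 $ 1)"
      by (simp add: norm_mult)
    also have "\<dots> \<le> \<delta> * norm (\<kappa>\<^sub>1 ^ N * M $ 1 $ 1)"
      using N by (intro mult_right_mono) auto
    finally show ?thesis
      using that(1) \<open>\<kappa>\<^sub>1 \<noteq> 0\<close> by (simp add: U mat2_mult_entries)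
  qed
  have wide: "(B ** M) $ 1 $ 1 \<noteq> 0 \<and> norm ((B ** M) $ 2 $ 1) \<le> K * norm ((B ** M) $ 1 $ 1) \<and>
      norm ((B ** M) $ 2 $ 1) > \<delta> * norm ((B ** M) $ 1 $ 1)"
    if M: "M $ 1 $ 1 \<noteq> 0" "norm (M $ 2 $ 1) \<le> \<delta> * norm (M $ 1 $ 1)" for M :: "complex^2^2"
  proof -
    define x y where "x = M $ 1 $ 1" and "y = M $ 2 $ 1"
    have x: "norm x > 0" and y: "norm y \<le> \<delta> * norm x"
      using M by (auto simp: x_def y_def)
    have small: "norm (e * y) \<le> r / 2 * norm x" if "\<delta> \<le> r / (2 * (norm e + 1))" "r > 0" for e :: complex and r
    proof -
      have "norm (e * y) \<le> norm e * (\<delta> * norm x)"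
        using y by (simp add: norm_mult mult_left_mono)
      also have "\<dots> \<le> (norm e + 1) * (\<delta> * norm x)"
        using \<delta>(1) by (intro mult_right_mono) auto
      also have "\<dots> \<le> (norm e + 1) * (r / (2 * (norm e + 1)) * norm x)"
        using that(1) by (intro mult_left_mono mult_right_mono) auto
      also have "\<dots> = r / 2 * norm x"
      proof -
        have "norm e + 1 \<noteq> 0"
          using norm_ge_zero[of e] by linarith
        then show ?thesis
          by (simp add: field_simps)
      qed
      finally show ?thesis .
    qed
    have bby: "norm (b * y) \<le> norm a / 2 * norm x" and dy: "norm (d * y) \<le> norm c / 2 * norm x"
      using small[OF \<delta>(2)] small[OF \<delta>(3)] ac by auto
    have X: "norm (a * x + b * y) \<ge> norm a / 2 * norm x" "norm (a * x + b * y) \<le> 3 / 2 * norm a * norm x"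
      using norm_diff_ineq[of "a * x" "b * y"] norm_triangle_ineq[of "a * x" "b * y"] bby
      by (simp_all add: norm_mult)
    have Y: "norm (c * x + d * y) \<ge> norm c / 2 * norm x" "norm (c * x + d * y) \<le> 3 / 2 * norm c * norm x"
      using norm_diff_ineq[of "c * x" "d * y"] norm_triangle_ineq[of "c * x" "d * y"] dy
      by (simp_all add: norm_mult)
    have pos: "norm (a * x + b * y) > 0"
      using X(1) ac x by (smt (verit) half_gt_zero mult_pos_pos)
    have "norm (c * x + d * y) \<le> K * (norm a / 2 * norm x)"
      using Y(2) ac by (simp add: K_def)
    also have "\<dots> \<le> K * norm (a * x + b * y)"
      using X(1) \<open>K > 0\<close> by (intro mult_left_mono) auto
    finally have 1: "norm (c * x + d * y) \<le> K * norm (a * x + b * y)" .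
    have "\<delta> * norm (a * x + b * y) \<le> norm c / (4 * norm a) * (3 / 2 * norm a * norm x)"
      using \<delta>(1,4) X(2) by (intro mult_mono) auto
    also have "\<dots> = 3 / 8 * norm c * norm x"
      using ac by simp
    also have "\<dots> < norm c / 2 * norm x"
      using ac x by simp
    also have "\<dots> \<le> norm (c * x + d * y)"
      by (rule Y(1))
    finally have 2: "\<delta> * norm (a * x + b * y) < norm (c * x + d * y)" .
    show ?thesis
      using pos 1 2 by (simp add: mat2_mult_entries a_def b_def c_def d_def x_def y_def)
  qed
  have detU: "det U \<noteq> 0"
    using \<open>\<kappa>\<^sub>1 \<noteq> 0\<close> \<kappa>(2) by (simp add: U det_2)
  show ?thesis
  proof (rule that[of N U])
    fix v w :: "bool list"
    assume nt: "\<And>x. x \<noteq> [] \<Longrightarrow> mat_word U (B ** U) x \<noteq> mat 1 \<and> mat_word U (B ** U) x \<noteq> - mat 1" and "v \<noteq> w"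
    show "mat_word U (B ** U) v \<noteq> mat_word U (B ** U) w \<and> mat_word U (B ** U) v \<noteq> - mat_word U (B ** U) w"
    proof (rule ping_pong_words[where K = K and \<epsilon> = \<delta>, OF _ _ _ detU _ nt \<open>v \<noteq> w\<close>])
      fix M :: "complex^2^2"
      assume M: "M $ 1 $ 1 \<noteq> 0" "norm (M $ 2 $ 1) \<le> K * norm (M $ 1 $ 1)"
      have "\<delta> * norm ((U ** M) $ 1 $ 1) \<le> K * norm ((U ** M) $ 1 $ 1)"
        using \<delta>(5) by (intro mult_right_mono) auto
      then show "(U ** M) $ 1 $ 1 \<noteq> 0 \<and> norm ((U ** M) $ 2 $ 1) \<le> K * norm ((U ** M) $ 1 $ 1) \<and>
        norm ((U ** M) $ 2 $ 1) \<le> \<delta> * norm ((U ** M) $ 1 $ 1)"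
        using narrow[OF M] by linarith
      show "(B ** U ** M) $ 1 $ 1 \<noteq> 0 \<and> norm ((B ** U ** M) $ 2 $ 1) \<le> K * norm ((B ** U ** M) $ 1 $ 1) \<and>
        norm ((B ** U ** M) $ 2 $ 1) > \<delta> * norm ((B ** U ** M) $ 1 $ 1)"
        using wide[of "U ** M"] narrow[OF M] by (simp add: matrix_mul_assoc)
    qed (use \<open>K > 0\<close> det detU in \<open>auto simp: det_mul\<close>)
  qed (auto simp: N_def U_def)
qed

section \<open>The group SU(1,1)\<close>


text \<open>These matrices are the lifts of the conformal automorphisms of the unit disc, each automorphism having
  two lifts \<open>M\<close> and \<open>- M\<close>.\<close>

definition su11 :: "complex^2^2 \<Rightarrow> bool" where
  "su11 M \<longleftrightarrow> M $ 2 $ 2 = cnj (M $ 1 $ 1) \<and> M $ 2 $ 1 = cnj (M $ 1 $ 2) \<and>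
     M $ 1 $ 1 * cnj (M $ 1 $ 1) - M $ 1 $ 2 * cnj (M $ 1 $ 2) = 1"

lemma su11_one: "su11 (mat 1)"
  by (simp add: su11_def)

lemma su11_mult:
  assumes "su11 A" "su11 B"
  shows "su11 (A ** B)"
proof -
  define a b c d where "a = A $ 1 $ 1" and "b = A $ 1 $ 2" and "c = B $ 1 $ 1" and "d = B $ 1 $ 2"
  have A: "A $ 1 $ 1 = a" "A $ 1 $ 2 = b" "A $ 2 $ 1 = cnj b" "A $ 2 $ 2 = cnj a"
    and B: "B $ 1 $ 1 = c" "B $ 1 $ 2 = d" "B $ 2 $ 1 = cnj d" "B $ 2 $ 2 = cnj c"
    using assms by (simp_all add: a_def b_def c_def d_def su11_def)
  have "(a * c + b * cnj d) * cnj (a * c + b * cnj d) - (a * d + b * cnj c) * cnj (a * d + b * cnj c)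
      = (a * cnj a - b * cnj b) * (c * cnj c - d * cnj d)"
    by (simp add: algebra_simps)
  also have "\<dots> = 1"
    using assms unfolding su11_def A B by (simp only: mult_1)
  finally show ?thesis
    unfolding su11_def mat2_mult_entries A B by simp
qed

lemma su11_det: "su11 M \<Longrightarrow> det M = 1"
  by (simp add: su11_def det_2)

lemma su11_norm:
  assumes "su11 M"
  shows "(norm (M $ 1 $ 1))\<^sup>2 = 1 + (norm (M $ 1 $ 2))\<^sup>2"
proof -
  have "complex_of_real ((norm (M $ 1 $ 1))\<^sup>2) = complex_of_real (1 + (norm (M $ 1 $ 2))\<^sup>2)"
    unfolding of_real_add of_real_1 complex_norm_square
    using assms by (simp only: su11_def) (simp add: diff_eq_eq)
  then show ?thesis
    by (simp only: of_real_eq_iff)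
qed

lemma su11_denominator:
  assumes "su11 M" "norm z < 1"
  shows "M $ 2 $ 1 * z + M $ 2 $ 2 \<noteq> 0"
proof
  assume "M $ 2 $ 1 * z + M $ 2 $ 2 = 0"
  then have "norm (M $ 2 $ 1 * z) = norm (M $ 2 $ 2)"
    by (metis add_eq_0_iff norm_minus_cancel)
  then have eq: "norm (M $ 1 $ 2) * norm z = norm (M $ 1 $ 1)"
    using assms(1) by (simp add: su11_def norm_mult)
  have "norm (M $ 1 $ 2) * norm z \<le> norm (M $ 1 $ 2)"
    using assms(2) by (simp add: mult_left_le)
  then have "(norm (M $ 1 $ 1))\<^sup>2 \<le> (norm (M $ 1 $ 2))\<^sup>2"
    unfolding eq by (intro power_mono) auto
  then show False
    using su11_norm[OF assms(1)] by simp
qed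

lemma Cayley_Hamilton_su11:
  fixes M :: "complex^2^2"
  assumes "su11 A"
  shows "A ** (A ** M) = (\<chi> i j. 2 * of_real (Re (A $ 1 $ 1)) * (A ** M) $ i $ j - M $ i $ j)"
proof -
  define a b where "a = A $ 1 $ 1" and "b = A $ 1 $ 2"
  have A: "A $ 1 $ 1 = a" "A $ 1 $ 2 = b" "A $ 2 $ 1 = cnj b" "A $ 2 $ 2 = cnj a"
    using assms by (simp_all add: a_def b_def su11_def)
  have ab: "a * cnj a = 1 + b * cnj b"
    using assms by (simp add: a_def b_def su11_def algebra_simps)
  have tr: "2 * of_real (Re a) = a + cnj a"
    by (simp add: complex_add_cnj)
  have 1: "a * (a * x + b * y) + b * (cnj b * x + cnj a * y) = (a + cnj a) * (a * x + b * y) - x" for x y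
  proof -
    have "(a + cnj a) * (a * x + b * y) - x = a * a * x + (a * cnj a) * x + a * b * y + cnj a * b * y - x"
      by (simp add: algebra_simps)
    then show ?thesis
      unfolding ab by (simp add: algebra_simps)
  qed
  have 2: "cnj b * (a * x + b * y) + cnj a * (cnj b * x + cnj a * y) = (a + cnj a) * (cnj b * x + cnj a * y) - y" for x y
  proof -
    have "(a + cnj a) * (cnj b * x + cnj a * y) - y
        = a * cnj b * x + cnj a * cnj b * x + (a * cnj a) * y + cnj a * cnj a * y - y"
      by (simp add: algebra_simps)
    then show ?thesis
      unfolding ab by (simp add: algebra_simps)
  qed
  show ?thesis
    unfolding mat2_eq_iff by (simp only: mat2_mult_entries vec_lambda_beta A 1 2 tr simp_thms)
qed

text \<open>By Cayley--Hamilton the entries of \<open>A\<^sup>n B\<close> obey this recurrence if \<open>A\<close> has trace \<open>2 cos \<theta>\<close>.\<close>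

lemma cosine_recurrence:
  fixes u :: "nat \<Rightarrow> complex"
  assumes rec: "\<And>n. u (Suc (Suc n)) = 2 * of_real (cos \<theta>) * u (Suc n) - u n" and "sin \<theta> \<noteq> 0"
  shows "u n = u 0 * of_real (cos (real n * \<theta>)) + (u 1 - u 0 * of_real (cos \<theta>)) / of_real (sin \<theta>) * of_real (sin (real n * \<theta>))"
proof -
  define K where "K = (u 1 - u 0 * of_real (cos \<theta>)) / of_real (sin \<theta>)"
  have c: "cos (real (Suc (Suc n)) * \<theta>) = 2 * cos \<theta> * cos (real (Suc n) * \<theta>) - cos (real n * \<theta>)" for n
  proof -
    have "real (Suc (Suc n)) * \<theta> = real (Suc n) * \<theta> + \<theta>" "real n * \<theta> = real (Suc n) * \<theta> - \<theta>"
      by (simp_all add: algebra_simps)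
    then show ?thesis
      by (simp only: cos_add cos_diff) simp
  qed
  have s: "sin (real (Suc (Suc n)) * \<theta>) = 2 * cos \<theta> * sin (real (Suc n) * \<theta>) - sin (real n * \<theta>)" for n
  proof -
    have "real (Suc (Suc n)) * \<theta> = real (Suc n) * \<theta> + \<theta>" "real n * \<theta> = real (Suc n) * \<theta> - \<theta>"
      by (simp_all add: algebra_simps)
    then show ?thesis
      by (simp only: sin_add sin_diff) simp
  qed
  have "u n = u 0 * of_real (cos (real n * \<theta>)) + K * of_real (sin (real n * \<theta>)) \<and>
    u (Suc n) = u 0 * of_real (cos (real (Suc n) * \<theta>)) + K * of_real (sin (real (Suc n) * \<theta>))"
  proof (induction n)
    case 0
    then show ?case using \<open>sin \<theta> \<noteq> 0\<close> by (simp add: K_def)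
  next
    case (Suc n)
    have "u (Suc (Suc n)) = u 0 * of_real (cos (real (Suc (Suc n)) * \<theta>)) + K * of_real (sin (real (Suc (Suc n)) * \<theta>))"
      unfolding rec c s of_real_diff of_real_mult using Suc
      by (simp only: of_real_numeral) (simp add: algebra_simps)
    then show ?case
      using Suc by blast
  qed
  then show ?thesis
    by (simp add: K_def)
qed

lemma su11_power_recurrence:
  fixes B :: "complex^2^2"
  assumes "su11 A"
  shows "(mat_power A (Suc (Suc n)) ** B) $ i $ j
    = 2 * of_real (Re (A $ 1 $ 1)) * (mat_power A (Suc n) ** B) $ i $ j - (mat_power A n ** B) $ i $ j"
proof -
  have "mat_power A (Suc (Suc n)) ** B = A ** (A ** (mat_power A n ** B))"
    by (simp add: matrix_mul_assoc)
  also have "\<dots> $ i $ j = 2 * of_real (Re (A $ 1 $ 1)) * (A ** (mat_power A n ** B)) $ i $ j - (mat_power A n ** B) $ i $ j"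
    unfolding Cayley_Hamilton_su11[OF assms] by simp
  finally show ?thesis
    by (simp add: matrix_mul_assoc)
qed

text \<open>The expression is \<open>\<rho> cos (n \<theta> - \<phi>)\<close> with \<open>\<rho>\<^sup>2 = g\<^sup>2 + \<tau>\<^sup>2\<close>, and the angles \<open>n \<theta>\<close> are dense
  modulo \<open>2 \<pi>\<close>.\<close>

lemma irrational_rotation_amplitude:
  assumes irrat: "\<theta> / (2 * pi) \<notin> \<rat>" and bound: "\<And>n::nat. \<bar>g * cos (real n * \<theta>) + \<tau> * sin (real n * \<theta>)\<bar> \<le> 1"
  shows "g\<^sup>2 + \<tau>\<^sup>2 \<le> 1"
proof (rule ccontr)
  assume "\<not> g\<^sup>2 + \<tau>\<^sup>2 \<le> 1"
  define \<rho> where "\<rho> = sqrt (g\<^sup>2 + \<tau>\<^sup>2)"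
  have \<rho>: "\<rho> > 1" "\<rho>\<^sup>2 = g\<^sup>2 + \<tau>\<^sup>2"
    using \<open>\<not> g\<^sup>2 + \<tau>\<^sup>2 \<le> 1\<close> by (simp_all add: \<rho>_def)
  have "(g / \<rho>)\<^sup>2 + (\<tau> / \<rho>)\<^sup>2 = 1"
    unfolding power_divide add_divide_distrib[symmetric] \<rho>(2)[symmetric] using \<rho>(1) by simp
  then obtain \<phi> where "g / \<rho> = cos \<phi>" "\<tau> / \<rho> = sin \<phi>"
    using sincos_total_2pi by metis
  then have g\<tau>: "g = \<rho> * cos \<phi>" "\<tau> = \<rho> * sin \<phi>"
    using \<rho>(1) by (auto simp: field_simps)
  have "isCont cos (0::real)" "1 - 1 / \<rho> > 0"
    using \<rho>(1) by simp_all
  then have "\<exists>\<delta>>0. \<forall>x::real. dist x 0 < \<delta> \<longrightarrow> dist (cos x) (cos 0) < 1 - 1 / \<rho>"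
    unfolding continuous_at_eps_delta by blast
  then obtain \<delta> where \<delta>: "\<delta> > 0" "\<And>x::real. \<bar>x\<bar> < \<delta> \<Longrightarrow> \<bar>cos x - 1\<bar> < 1 - 1 / \<rho>"
    by (auto simp: dist_real_def)
  obtain h k where k: "k > 0" "\<bar>of_int k * (\<theta> / (2 * pi)) - of_int h - \<phi> / (2 * pi)\<bar> < \<delta> / (2 * pi)"
    by (rule sequence_of_fractional_parts_is_dense[OF irrat, where \<epsilon> = "\<delta> / (2 * pi)" and \<alpha> = "\<phi> / (2 * pi)"])
      (use \<delta>(1) that in auto)
  define n where "n = nat k"
  define x where "x = real n * \<theta> - \<phi> - 2 * pi * of_int h"
  have "x = 2 * pi * (of_int k * (\<theta> / (2 * pi)) - of_int h - \<phi> / (2 * pi))"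
    using k(1) by (simp add: x_def n_def algebra_simps)
  then have "\<bar>x\<bar> = 2 * pi * \<bar>of_int k * (\<theta> / (2 * pi)) - of_int h - \<phi> / (2 * pi)\<bar>"
    by (simp add: abs_mult)
  also have "\<dots> < 2 * pi * (\<delta> / (2 * pi))"
    using k(2) by (intro mult_strict_left_mono) auto
  finally have "\<bar>x\<bar> < \<delta>"
    by simp
  then have "cos x > 1 / \<rho>"
    using \<delta>(2)[of x] by linarith
  then have "1 < \<rho> * cos x"
    using \<rho>(1) by (simp add: field_simps)
  also have "cos x = cos (real n * \<theta> - \<phi>)"
    unfolding x_def by (metis cos_diff cos_int_2pin mult.right_neutral mult_zero_right sin_int_2pin add.right_neutral)
  also have "\<rho> * \<dots> = g * cos (real n * \<theta>) + \<tau> * sin (real n * \<theta>)"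
    unfolding g\<tau> by (simp add: cos_diff algebra_simps)
  finally show False
    using bound[of n] by linarith
qed

text \<open>The hypotheses say that the traceless parts of \<open>A\<close> and \<open>B\<close> are parallel, entry by entry.\<close>

lemma su11_commute:
  assumes "su11 A" "su11 B"
    and E: "of_real (Im (A $ 1 $ 1)) * B $ 1 $ 2 = of_real (Im (B $ 1 $ 1)) * A $ 1 $ 2"
    and s: "Im (A $ 1 $ 2 * cnj (B $ 1 $ 2)) = 0"
  shows "A ** B = B ** A"
proof -
  define a b c d where "a = A $ 1 $ 1" and "b = A $ 1 $ 2" and "c = B $ 1 $ 1" and "d = B $ 1 $ 2"
  have A: "A $ 1 $ 1 = a" "A $ 1 $ 2 = b" "A $ 2 $ 1 = cnj b" "A $ 2 $ 2 = cnj a"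
    and B: "B $ 1 $ 1 = c" "B $ 1 $ 2 = d" "B $ 2 $ 1 = cnj d" "B $ 2 $ 2 = cnj c"
    using assms(1,2) by (simp_all add: a_def b_def c_def d_def su11_def)
  have e: "Im a * Re d = Im c * Re b" "Im a * Im d = Im c * Im b"
    using E unfolding A B by (simp_all add: complex_eq_iff)
  have "Im b * Re d = Re b * Im d"
    using s unfolding A B by simp
  then show ?thesis
    unfolding mat2_eq_iff mat2_mult_entries A B using e by (simp add: complex_eq_iff algebra_simps)
qed

text \<open>The traceless parts \<open>(\<i> x, \<beta>)\<close> and \<open>(\<i> y, \<delta>)\<close> live in Minkowski space with the form
  \<open>x\<^sup>2 - \<bar>\<beta>\<bar>\<^sup>2\<close>. For elliptic \<open>A\<close> the first is timelike, the bounded traces say that the reversed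
  Cauchy--Schwarz inequality is an equality, and so the two are parallel.\<close>

lemma elliptic_commutes_if_traces_bounded:
  assumes A: "su11 A" and B: "su11 B" and ell: "\<bar>Re (A $ 1 $ 1)\<bar> < 1"
    and order: "\<And>n. n \<ge> 1 \<Longrightarrow> mat_power A n \<noteq> mat 1"
    and bound: "\<And>n. \<bar>Re ((mat_power A n ** B) $ 1 $ 1)\<bar> \<le> 1"
  shows "A ** B = B ** A"
proof -
  define f x g y b1 b2 d1 d2 where "f = Re (A $ 1 $ 1)" and "x = Im (A $ 1 $ 1)" and "g = Re (B $ 1 $ 1)"
    and "y = Im (B $ 1 $ 1)" and "b1 = Re (A $ 1 $ 2)" and "b2 = Im (A $ 1 $ 2)"
    and "d1 = Re (B $ 1 $ 2)" and "d2 = Im (B $ 1 $ 2)"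
  note defs = f_def x_def g_def y_def b1_def b2_def d1_def d2_def
  have nA: "f\<^sup>2 + x\<^sup>2 = 1 + (b1\<^sup>2 + b2\<^sup>2)" and nB: "g\<^sup>2 + y\<^sup>2 = 1 + (d1\<^sup>2 + d2\<^sup>2)"
    using su11_norm[OF A] su11_norm[OF B] by (simp_all add: cmod_power2 defs)
  define \<theta> where "\<theta> = arccos f"
  have f: "cos \<theta> = f"
    unfolding \<theta>_def using ell by (intro cos_arccos) (auto simp: f_def)
  have "f\<^sup>2 < 1"
    using ell by (simp add: f_def abs_square_less_1)
  then have sin2: "(sin \<theta>)\<^sup>2 = 1 - f\<^sup>2" "sin \<theta> \<noteq> 0"
    using sin_squared_eq[of \<theta>] f by auto
  have formula: "(mat_power A n ** M) $ i $ j = M $ i $ j * of_real (cos (real n * \<theta>))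
      + ((A ** M) $ i $ j - M $ i $ j * of_real (cos \<theta>)) / of_real (sin \<theta>) * of_real (sin (real n * \<theta>))"
    for n i j and M :: "complex^2^2"
    using cosine_recurrence[of "\<lambda>n. (mat_power A n ** M) $ i $ j" \<theta> n] su11_power_recurrence[OF A, of _ M i j] sin2(2)
    by (simp add: f f_def)
  have "\<theta> / (2 * pi) \<notin> \<rat>"
  proof
    assume "\<theta> / (2 * pi) \<in> \<rat>"
    then obtain p q :: int where q: "q > 0" "\<theta> / (2 * pi) = of_int p / of_int q"
      by (elim Rats_cases') auto
    then have "real (nat q) * \<theta> = 2 * pi * of_int p"
      by (simp add: field_simps)
    then have "cos (real (nat q) * \<theta>) = 1" "sin (real (nat q) * \<theta>) = 0"
      by (simp_all only: cos_int_2pin sin_int_2pin)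
    then have "(mat_power A (nat q) ** mat 1) $ i $ j = (mat 1 :: complex^2^2) $ i $ j" for i j
      unfolding formula by simp
    then have "mat_power A (nat q) = mat 1"
      by (simp add: vec_eq_iff)
    then show False
      using order[of "nat q"] q(1) by simp
  qed
  moreover have "Re ((mat_power A n ** B) $ 1 $ 1)
      = g * cos (real n * \<theta>) + (b1 * d1 + b2 * d2 - x * y) / sin \<theta> * sin (real n * \<theta>)" for n
  proof -
    have "Re ((A ** B) $ 1 $ 1) = f * g - x * y + b1 * d1 + b2 * d2"
      using B by (simp add: mat2_mult_entries su11_def defs)
    then have "Re ((A ** B) $ 1 $ 1) - Re (B $ 1 $ 1) * cos \<theta> = b1 * d1 + b2 * d2 - x * y"
      by (simp add: f g_def)
    moreover have "Re (v * of_real p + (w - v * of_real k) / of_real l * of_real m)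
        = Re v * p + (Re w - Re v * k) / l * m" for v w :: complex and p k l m :: real
      by (simp add: Re_divide_of_real)
    ultimately show ?thesis
      unfolding formula by (simp only: g_def)
  qed
  ultimately have "g\<^sup>2 + ((b1 * d1 + b2 * d2 - x * y) / sin \<theta>)\<^sup>2 \<le> 1"
    using irrational_rotation_amplitude bound by metis
  then have "(b1 * d1 + b2 * d2 - x * y)\<^sup>2 \<le> (1 - g\<^sup>2) * (sin \<theta>)\<^sup>2"
    using sin2(2) by (simp add: power_divide field_simps)
  then have le: "(b1 * d1 + b2 * d2 - x * y)\<^sup>2 \<le> (1 - g\<^sup>2) * (1 - f\<^sup>2)"
    by (simp only: sin2(1))
  define E where "E = (b1 * y - x * d1)\<^sup>2 + (b2 * y - x * d2)\<^sup>2"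
  define s where "s = b2 * d1 - b1 * d2"
  have g2: "1 - g\<^sup>2 = y\<^sup>2 - (d1\<^sup>2 + d2\<^sup>2)" and f2: "1 - f\<^sup>2 = x\<^sup>2 - (b1\<^sup>2 + b2\<^sup>2)"
    using nA nB by linarith+
  have "(b1 * d1 + b2 * d2 - x * y)\<^sup>2 - (y\<^sup>2 - (d1\<^sup>2 + d2\<^sup>2)) * (x\<^sup>2 - (b1\<^sup>2 + b2\<^sup>2)) = E - s\<^sup>2"
    by (simp add: E_def s_def power2_eq_square algebra_simps)
  then have "E \<le> s\<^sup>2"
    using le unfolding g2 f2 by linarith
  \<comment> \<open>Cauchy--Schwarz for \<open>(b1, b2)\<close> and the vector \<open>(e1, e2)\<close> whose vanishing is to be shown\<close>
  define e1 e2 where "e1 = b1 * y - x * d1" and "e2 = b2 * y - x * d2"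
  have "x * s = b1 * e2 - b2 * e1"
    by (simp add: s_def e1_def e2_def algebra_simps)
  moreover have "(b1\<^sup>2 + b2\<^sup>2) * (e1\<^sup>2 + e2\<^sup>2) - (b1 * e2 - b2 * e1)\<^sup>2 = (b1 * e1 + b2 * e2)\<^sup>2"
    by (simp add: power2_eq_square algebra_simps)
  ultimately have "(b1\<^sup>2 + b2\<^sup>2) * E - (x * s)\<^sup>2 = (b1 * e1 + b2 * e2)\<^sup>2"
    by (simp add: E_def e1_def e2_def)
  then have "(b1\<^sup>2 + b2\<^sup>2) * E - x\<^sup>2 * s\<^sup>2 \<ge> 0"
    by (simp add: power_mult_distrib)
  then have "x\<^sup>2 * s\<^sup>2 \<le> (b1\<^sup>2 + b2\<^sup>2) * E"
    by simp
  moreover have "x\<^sup>2 * E \<le> x\<^sup>2 * s\<^sup>2"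
    using \<open>E \<le> s\<^sup>2\<close> by (intro mult_left_mono) auto
  ultimately have "(1 - f\<^sup>2) * E \<le> 0"
    unfolding f2 by (simp add: algebra_simps)
  moreover have "E \<ge> 0"
    by (simp add: E_def)
  ultimately have "E = 0"
    using \<open>f\<^sup>2 < 1\<close> by (smt (verit) mult_pos_pos)
  then have e: "b1 * y = x * d1" "b2 * y = x * d2"
    by (simp_all add: E_def sum_power2_eq_zero_iff)
  have "x\<^sup>2 > 0"
    using f2 \<open>f\<^sup>2 < 1\<close> zero_le_power2[of b1] zero_le_power2[of b2] by linarith
  moreover have "x * s = b2 * (x * d1) - b1 * (x * d2)"
    by (simp add: s_def algebra_simps)
  then have "x * s = 0"
    unfolding e[symmetric] by simp
  ultimately have "s = 0"
    by auto
  show ?thesis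
    by (rule su11_commute[OF A B])
      (use e \<open>s = 0\<close> in \<open>simp_all add: complex_eq_iff s_def defs algebra_simps\<close>)
qed

text \<open>Here the traceless parts are lightlike. The trace of \<open>A\<^sup>n B\<close> grows linearly in \<open>n\<close> unless they are orthogonal,
  and orthogonal lightlike vectors are parallel.\<close>

lemma parabolics_commute_if_traces_bounded:
  assumes A: "su11 A" and B: "su11 B" and par: "\<bar>Re (A $ 1 $ 1)\<bar> = 1" "\<bar>Re (B $ 1 $ 1)\<bar> = 1"
    and bound: "\<And>n. \<bar>Re ((mat_power A n ** B) $ 1 $ 1)\<bar> \<le> 1"
  shows "A ** B = B ** A"
proof -
  define f x g y b1 b2 d1 d2 where "f = Re (A $ 1 $ 1)" and "x = Im (A $ 1 $ 1)" and "g = Re (B $ 1 $ 1)"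
    and "y = Im (B $ 1 $ 1)" and "b1 = Re (A $ 1 $ 2)" and "b2 = Im (A $ 1 $ 2)"
    and "d1 = Re (B $ 1 $ 2)" and "d2 = Im (B $ 1 $ 2)"
  note defs = f_def x_def g_def y_def b1_def b2_def d1_def d2_def
  have f2: "f * f = 1" and g2: "g * g = 1"
    using par by (auto simp: f_def g_def abs_if split: if_splits)
  have nA: "x\<^sup>2 = b1\<^sup>2 + b2\<^sup>2" and nB: "y\<^sup>2 = d1\<^sup>2 + d2\<^sup>2"
  proof -
    have "f\<^sup>2 + x\<^sup>2 = 1 + (b1\<^sup>2 + b2\<^sup>2)" "g\<^sup>2 + y\<^sup>2 = 1 + (d1\<^sup>2 + d2\<^sup>2)"
      using su11_norm[OF A] su11_norm[OF B] by (simp_all add: cmod_power2 defs)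
    then show "x\<^sup>2 = b1\<^sup>2 + b2\<^sup>2" "y\<^sup>2 = d1\<^sup>2 + d2\<^sup>2"
      using f2 g2 by (simp_all add: power2_eq_square)
  qed
  define r where "r = b1 * d1 + b2 * d2 - x * y"
  define u where "u = (\<lambda>n. Re ((mat_power A n ** B) $ 1 $ 1))"
  have u0: "u 0 = g"
    by (simp add: u_def g_def)
  have u1: "u 1 = f * g + r"
    using B by (simp add: u_def mat2_mult_entries su11_def defs r_def)
  have rec: "u (Suc (Suc n)) = 2 * f * u (Suc n) - u n" for n
    using su11_power_recurrence[OF A, of n B 1 1] by (simp add: u_def f_def)
  have u: "f ^ n * u n = g + real n * (f * r)" for n
  proof -
    have "f ^ n * u n = g + real n * (f * r) \<and> f ^ Suc n * u (Suc n) = g + real (Suc n) * (f * r)"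
    proof (induction n)
      case 0
      have "f * u 1 = f * f * g + f * r"
        unfolding u1 by (simp add: algebra_simps)
      then show ?case using u0 f2 by simp
    next
      case (Suc n)
      have "f ^ Suc (Suc n) * u (Suc (Suc n)) = 2 * (f * f) * (f ^ Suc n * u (Suc n)) - (f * f) * (f ^ n * u n)"
        unfolding rec by (simp add: algebra_simps)
      also have "\<dots> = 2 * (f ^ Suc n * u (Suc n)) - f ^ n * u n"
        by (simp only: f2 mult_1_right mult_1)
      also have "\<dots> = g + real (Suc (Suc n)) * (f * r)"
        using Suc by (simp only:) (simp add: algebra_simps)
      finally show ?case using Suc by simp
    qed
    then show ?thesis by blast
  qed
  have "\<bar>g + real n * (f * r)\<bar> \<le> 1" for n
  proof -
    have "\<bar>f ^ n * u n\<bar> = \<bar>u n\<bar>"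
      using par(1) by (simp add: abs_mult power_abs f_def)
    then show ?thesis
      using bound[of n] unfolding u[symmetric] by (simp add: u_def)
  qed
  note growth = this
  have lin: "real n * \<bar>f * r\<bar> \<le> 2" for n
  proof -
    have "real n * \<bar>f * r\<bar> = \<bar>real n * (f * r)\<bar>"
      by (simp add: abs_mult)
    then show ?thesis
      using growth[of n] par(2) unfolding g_def by linarith
  qed
  have "f * r = 0"
  proof (rule ccontr)
    assume "f * r \<noteq> 0"
    then obtain n where "2 < real n * \<bar>f * r\<bar>"
      using reals_Archimedean3[of "\<bar>f * r\<bar>"] by auto
    then show False
      using lin[of n] by simp
  qed
  then have r: "b1 * d1 + b2 * d2 = x * y"
    using f2 by (auto simp: r_def)
  define s where "s = b2 * d1 - b1 * d2"
  have "(b1\<^sup>2 + b2\<^sup>2) * (d1\<^sup>2 + d2\<^sup>2) = (b1 * d1 + b2 * d2)\<^sup>2 + s\<^sup>2"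
    by (simp add: s_def power2_eq_square algebra_simps)
  then have "s\<^sup>2 = 0"
    unfolding r nA[symmetric] nB[symmetric] by (simp add: power_mult_distrib)
  then have "s = 0" by simp
  have "(b1 * y - x * d1)\<^sup>2 + (b2 * y - x * d2)\<^sup>2
      = (b1\<^sup>2 + b2\<^sup>2) * y\<^sup>2 - 2 * (x * y) * (b1 * d1 + b2 * d2) + x\<^sup>2 * (d1\<^sup>2 + d2\<^sup>2)"
    by (simp add: power2_eq_square algebra_simps)
  also have "\<dots> = 0"
    unfolding r nA[symmetric] nB[symmetric] by (simp add: power2_eq_square algebra_simps)
  finally have e: "b1 * y = x * d1" "b2 * y = x * d2"
    by (simp_all add: sum_power2_eq_zero_iff)
  show ?thesis
    by (rule su11_commute[OF A B])
      (use e \<open>s = 0\<close> in \<open>simp_all add: complex_eq_iff s_def defs algebra_simps\<close>)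
qed

section \<open>Automorphisms of the component\<close>


text \<open>Cross-multiplying gives a quadratic polynomial in \<open>z\<close> which vanishes on the disc. Its coefficients say that \<open>M = t N\<close>
  for a real number \<open>t\<close>, and \<open>t\<^sup>2 = 1\<close> by the determinants.\<close>

lemma su11_eq_up_to_sign_if_same_moebius:
  assumes M: "su11 M" and N: "su11 N"
    and eq: "\<And>z. norm z < 1 \<Longrightarrow>
      (M $ 1 $ 1 * z + M $ 1 $ 2) / (M $ 2 $ 1 * z + M $ 2 $ 2) = (N $ 1 $ 1 * z + N $ 1 $ 2) / (N $ 2 $ 1 * z + N $ 2 $ 2)"
  shows "M = N \<or> M = - N"
proof -
  define a b c d where "a = M $ 1 $ 1" and "b = M $ 1 $ 2" and "c = N $ 1 $ 1" and "d = N $ 1 $ 2"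
  have Me: "M $ 1 $ 1 = a" "M $ 1 $ 2 = b" "M $ 2 $ 1 = cnj b" "M $ 2 $ 2 = cnj a"
    and Ne: "N $ 1 $ 1 = c" "N $ 1 $ 2 = d" "N $ 2 $ 1 = cnj d" "N $ 2 $ 2 = cnj c"
    using M N by (simp_all add: a_def b_def c_def d_def su11_def)
  have nM: "a * cnj a - b * cnj b = 1" and nN: "c * cnj c - d * cnj d = 1"
    using M N by (simp_all only: su11_def Me Ne)
  have poly: "(a * z + b) * (cnj d * z + cnj c) = (c * z + d) * (cnj b * z + cnj a)" if "norm z < 1" for z
    using eq[OF that] su11_denominator[OF M that] su11_denominator[OF N that]
    unfolding Me Ne by (simp add: frac_eq_eq)
  define p q r where "p = a * cnj d - c * cnj b" and "q = a * cnj c + b * cnj d - c * cnj a - d * cnj b"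
    and "r = b * cnj c - d * cnj a"
  have quad: "p * z\<^sup>2 + q * z + r = 0" if "norm z < 1" for z
    using poly[OF that] by (simp add: p_def q_def r_def power2_eq_square algebra_simps)
  have "r = 0"
    using quad[of 0] by simp
  moreover have "p / 4 + q / 2 + r = 0" "p / 4 - q / 2 + r = 0"
    using quad[of "1/2"] quad[of "-1/2"] by (simp_all add: power2_eq_square)
  ultimately have "q = 0"
    by (simp add: algebra_simps)
  define t where "t = a * cnj c - d * cnj b"
  have "t = cnj t"
    using \<open>q = 0\<close> by (simp add: t_def q_def algebra_simps)
  have r1: "b * cnj c = d * cnj a"
    using \<open>r = 0\<close> by (simp add: r_def)
  then have "cnj (b * cnj c) = cnj (d * cnj a)"
    by (simp only:)
  then have r2: "cnj b * c = cnj d * a"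
    by simp
  note r = r1 r2
  have a: "a = c * t"
  proof -
    have "c * t = a * (c * cnj c) - d * (cnj b * c)"
      by (simp add: t_def algebra_simps)
    also have "\<dots> = a * (c * cnj c - d * cnj d)"
      unfolding r by (simp add: algebra_simps)
    finally show ?thesis using nN by simp
  qed
  have b: "b = d * t"
  proof -
    have "d * t = d * cnj t"
      using \<open>t = cnj t\<close> by simp
    also have "\<dots> = c * (d * cnj a) - d * cnj d * b"
      by (simp add: t_def algebra_simps)
    also have "\<dots> = b * (c * cnj c - d * cnj d)"
      unfolding r(1)[symmetric] by (simp add: algebra_simps)
    finally show ?thesis using nN by simp
  qed
  have "t * cnj t = (t * cnj t) * (c * cnj c - d * cnj d)"
    using nN by simp
  also have "\<dots> = 1"
    using nM unfolding a b by (simp add: algebra_simps)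
  finally have "t * t = 1"
    using \<open>t = cnj t\<close> by simp
  then have "t = 1 \<or> t = -1"
    by (simp add: square_eq_1_iff)
  then show ?thesis
    unfolding mat2_eq_iff by (auto simp: Me Ne a b)
qed

context disc_pair
begin

definition represents :: "(complex \<Rightarrow> complex) \<Rightarrow> complex^2^2 \<Rightarrow> bool" where
  "represents s M \<longleftrightarrow> s ` D \<subseteq> D \<and> su11 M \<and>
     (\<forall>z. norm z < 1 \<longrightarrow> on_disc s z = (M $ 1 $ 1 * z + M $ 1 $ 2) / (M $ 2 $ 1 * z + M $ 2 $ 2))"

lemma represents_id: "represents id (mat 1)"
  using \<eta>(2) by (simp add: represents_def su11_one on_disc_def)

lemma represents_compose:
  assumes s: "represents s M" and t: "represents t N"
  shows "represents (s \<circ> t) (M ** N)"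
proof -
  have sub: "s ` D \<subseteq> D" "t ` D \<subseteq> D" and su: "su11 M" "su11 N"
    using s t by (auto simp: represents_def)
  have "(s \<circ> t) ` D \<subseteq> D"
    using sub unfolding image_comp[symmetric] by blast
  moreover have "on_disc (s \<circ> t) z = ((M ** N) $ 1 $ 1 * z + (M ** N) $ 1 $ 2) / ((M ** N) $ 2 $ 1 * z + (M ** N) $ 2 $ 2)"
    if z: "norm z < 1" for z
  proof -
    define p q where "p = N $ 1 $ 1 * z + N $ 1 $ 2" and "q = N $ 2 $ 1 * z + N $ 2 $ 2"
    have "q \<noteq> 0"
      unfolding q_def by (rule su11_denominator[OF su(2) z])
    have tz: "on_disc t z = p / q"
      using t z by (simp add: represents_def p_def q_def)
    have lt: "norm (on_disc t z) < 1"
      using on_disc_in_ball[OF sub(2), of z] z by simp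
    have "on_disc (s \<circ> t) z = (M $ 1 $ 1 * (p / q) + M $ 1 $ 2) / (M $ 2 $ 1 * (p / q) + M $ 2 $ 2)"
      using on_disc_compose[OF sub(2), of z s] z s lt unfolding represents_def tz[symmetric] by simp
    also have "\<dots> = (M $ 1 $ 1 * p + M $ 1 $ 2 * q) / (M $ 2 $ 1 * p + M $ 2 $ 2 * q)"
    proof -
      have "M $ 1 $ 1 * (p / q) + M $ 1 $ 2 = (M $ 1 $ 1 * p + M $ 1 $ 2 * q) / q"
        "M $ 2 $ 1 * (p / q) + M $ 2 $ 2 = (M $ 2 $ 1 * p + M $ 2 $ 2 * q) / q"
        using \<open>q \<noteq> 0\<close> by (simp_all add: field_simps)
      then show ?thesis
        using \<open>q \<noteq> 0\<close> by simp
    qed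
    finally show ?thesis
      by (simp add: mat2_mult_entries p_def q_def algebra_simps)
  qed
  ultimately show ?thesis
    using su11_mult[OF su] unfolding represents_def by blast
qed

lemma represents_faithful:
  assumes "s \<in> insert id words" "t \<in> insert id words" "represents s M" "represents t N" "M = N \<or> M = - N"
  shows "s = t"
proof (rule entire_eq_if_on_disc_eq)
  show "s holomorphic_on UNIV" "t holomorphic_on UNIV"
    using assms(1,2) words_holomorphic by blast+
  show "s ` D \<subseteq> D" "t ` D \<subseteq> D"
    using assms(3,4) by (simp_all add: represents_def)
  have "(- N $ 1 $ 1 * z + - N $ 1 $ 2) / (- N $ 2 $ 1 * z + - N $ 2 $ 2)
      = (N $ 1 $ 1 * z + N $ 1 $ 2) / (N $ 2 $ 1 * z + N $ 2 $ 2)" for z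
  proof -
    have "- N $ 1 $ 1 * z + - N $ 1 $ 2 = - (N $ 1 $ 1 * z + N $ 1 $ 2)"
      "- N $ 2 $ 1 * z + - N $ 2 $ 2 = - (N $ 2 $ 1 * z + N $ 2 $ 2)"
      by simp_all
    then show ?thesis
      by (simp only: minus_divide_divide)
  qed
  then show "on_disc s z = on_disc t z" if "norm z < 1" for z
    using assms(3-5) that unfolding represents_def by auto
qed

lemma represents_unique:
  assumes "represents s M" "represents s N"
  shows "M = N \<or> M = - N"
  by (rule su11_eq_up_to_sign_if_same_moebius) (use assms in \<open>auto simp: represents_def\<close>)

lemma represents_pair_word:
  assumes "represents a A" "represents b B"
  shows "represents (pair_word a b w) (mat_word A B w)"
proof (induction w)
  case Nil
  show ?case using represents_id by (simp only: pair_word_simps mat_word_simps)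
next
  case (Cons c w)
  have "represents (if c then a else b) (if c then A else B)"
    using assms by simp
  from represents_compose[OF this Cons] show ?case
    by (simp only: pair_word_simps mat_word_simps)
qed

lemma represents_funpow:
  assumes "represents a A"
  shows "represents (a ^^ n) (mat_power A n)"
proof (induction n)
  case 0
  show ?case using represents_id by (simp only: funpow.simps mat_power_simps)
next
  case (Suc n)
  from represents_compose[OF assms this] show ?case
    by (simp only: funpow.simps mat_power_simps)
qed

lemma words_represented_nontrivial:
  assumes "s \<in> words" "represents s M"
  shows "M \<noteq> mat 1 \<and> M \<noteq> - mat 1"
  using represents_faithful[OF _ _ assms(2) represents_id] assms(1) words_not_id by blast

text \<open>A Blaschke product of degree one is \<open>c * disc_factor a\<close>. Distributing a square root \<open>g\<close> of \<open>c\<close> over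
  numerator and denominator and dividing by \<open>R\<close>, where \<open>R\<^sup>2 = 1 - \<bar>a\<bar>\<^sup>2\<close>, puts it into SU(1,1).\<close>

lemma generator_represented_if_degree_1:
  assumes s: "s \<in> {F, G}" and lift: "lift_of s 1 \<beta>"
  obtains M where "represents s M"
proof -
  obtain c as \<gamma> where c: "norm c = 1" and as: "\<And>a. a \<in> set as \<Longrightarrow> norm a < 1"
    and form: "\<And>z. norm z < 1 \<Longrightarrow> on_disc s z = c * (\<Prod>a\<leftarrow>as. disc_factor a z)" and lift': "lift_of s (length as) \<gamma>"
    by (rule generator_Blaschke_form[OF s]) (rule that)
  have "length as = 1"
    using lift_of_unique[OF lift' lift] by metis
  then obtain a where a_list: "as = [a]"
    by (metis One_nat_def length_0_conv length_Suc_conv)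
  have a: "norm a < 1"
    using as a_list by simp
  obtain t where t: "c = cis t"
    using c by (metis complex_norm_eq_1_exp cis_conv_exp)
  define g where "g = cis (t / 2)"
  have g: "g * cnj g = 1" "g * g = c" "g \<noteq> 0" "cnj g \<noteq> 0"
    by (simp_all add: g_def t cis_mult cis_cnj)
  define \<rho> where "\<rho> = sqrt (1 - (norm a)\<^sup>2)"
  have "(norm a)\<^sup>2 < 1"
    using a by (simp add: abs_square_less_1)
  then have \<rho>: "\<rho> > 0" "\<rho> * \<rho> = 1 - (norm a)\<^sup>2"
    by (simp_all add: \<rho>_def)
  define R where "R = complex_of_real \<rho>"
  have R: "R \<noteq> 0" "cnj R = R" "R * R = 1 - a * cnj a"
    using \<rho> by (simp_all add: R_def complex_norm_square[symmetric] flip: of_real_mult)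
  define M where "M = mat2 (g / R) (- g * a / R) (cnj (- g * a / R)) (cnj (g / R))"
  have "su11 M"
  proof -
    have "g / R * cnj (g / R) - (- g * a / R) * cnj (- g * a / R) = (g * cnj g) * (1 - a * cnj a) / (R * R)"
      using R(1) by (simp add: R(2) field_simps)
    also have "\<dots> = 1"
      using R g by (metis divide_self mult_1 mult_eq_0_iff)
    finally show ?thesis
      by (simp add: su11_def M_def)
  qed
  moreover have "on_disc s z = (M $ 1 $ 1 * z + M $ 1 $ 2) / (M $ 2 $ 1 * z + M $ 2 $ 2)" if z: "norm z < 1" for z
  proof -
    have den: "1 - cnj a * z \<noteq> 0"
      using disc_factor_denominator[OF a] z by simp
    have num: "M $ 1 $ 1 * z + M $ 1 $ 2 = g / R * (z - a)"
      by (simp add: M_def right_diff_distrib diff_divide_distrib)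
    have dn: "M $ 2 $ 1 * z + M $ 2 $ 2 = cnj g / R * (1 - cnj a * z)"
      by (simp add: M_def R(2) right_diff_distrib diff_divide_distrib)
    have "(M $ 1 $ 1 * z + M $ 1 $ 2) / (M $ 2 $ 1 * z + M $ 2 $ 2) = g / cnj g * ((z - a) / (1 - cnj a * z))"
      unfolding num dn using R(1) g(4) den by (simp add: field_simps)
    also have "g / cnj g = c"
      using g by (metis mult.commute mult.left_commute nonzero_eq_divide_eq mult_1)
    finally show ?thesis
      using form[OF z] by (simp add: a_list Moebius_function_simple)
  qed
  moreover have "s ` D \<subseteq> D"
    using s maps_D by auto
  ultimately show ?thesis
    using that unfolding represents_def by blast
qed

end

locale moebius_pair = disc_pair +
  fixes MF MG :: "complex^2^2"
  assumes MF: "represents F MF" and MG: "represents G MG"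
begin

lemma commute_if_matrices_commute:
  assumes "MF ** MG = MG ** MF"
  shows "F \<circ> G = G \<circ> F"
proof (rule represents_faithful)
  show "represents (F \<circ> G) (MF ** MG)" "represents (G \<circ> F) (MG ** MF)"
    by (intro represents_compose MF MG)+
qed (use assms words_compose words_F words_G in blast)+

text \<open>No free subsemigroup, seen through a matrix representation in any basis.\<close>

lemma conjugated_word_collision:
  assumes a: "a \<in> words" "represents a A" and b: "b \<in> words" "represents b B"
    and P: "P ** P' = mat 1" "P' ** P = mat 1"
    and A': "A' = P ** A ** P'" and B': "B' = P ** B ** P'"
  shows "\<And>x. x \<noteq> [] \<Longrightarrow> mat_word A' B' x \<noteq> mat 1 \<and> mat_word A' B' x \<noteq> - mat 1"
    and "\<exists>v w. v \<noteq> w \<and> (mat_word A' B' v = mat_word A' B' w \<or> mat_word A' B' v = - mat_word A' B' w)"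
proof -
  have word: "mat_word A' B' x = P ** mat_word A B x ** P'" for x
    unfolding A' B' by (rule conjugate_word[OF P])
  have one: "P ** mat 1 ** P' = mat 1" "P ** (- mat 1) ** P' = - mat 1"
    using P by (simp_all add: mat2_mult_minus)
  fix x :: "bool list" assume "x \<noteq> []"
  then have "mat_word A B x \<noteq> mat 1 \<and> mat_word A B x \<noteq> - mat 1"
    by (intro words_represented_nontrivial[of "pair_word a b x"] words_pair_word a b represents_pair_word)
  then show "mat_word A' B' x \<noteq> mat 1 \<and> mat_word A' B' x \<noteq> - mat 1"
    unfolding word using conjugate_cancel[OF P(2)] one by metis
next
  have word: "mat_word A' B' x = P ** mat_word A B x ** P'" for x
    unfolding A' B' by (rule conjugate_word[OF P])
  obtain v w where vw: "v \<noteq> w" "pair_word a b v = pair_word a b w"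
    using words_pair_word_collision[OF a(1) b(1)] by metis
  have "mat_word A B v = mat_word A B w \<or> mat_word A B v = - mat_word A B w"
    using represents_unique[of "pair_word a b v"] represents_pair_word[OF a(2) b(2), of v]
      represents_pair_word[OF a(2) b(2), of w] vw(2) by simp
  then have "mat_word A' B' v = mat_word A' B' w \<or> mat_word A' B' v = - mat_word A' B' w"
    unfolding word by (auto simp: mat2_mult_minus)
  then show "\<exists>v w. v \<noteq> w \<and> (mat_word A' B' v = mat_word A' B' w \<or> mat_word A' B' v = - mat_word A' B' w)"
    using vw(1) by blast
qed

text \<open>In an eigenbasis of the loxodromic matrix \<open>H\<close> the matrix of any word must be diagonal. If its entries
  at (1,1) and (2,1) are both nonzero, then powers of \<open>h\<close> play ping-pong on column vectors with \<open>t \<circ> h\<^sup>N\<close>;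
  for (1,1) and (1,2) they do so on row vectors with \<open>h\<^sup>N \<circ> t\<close>. If the entry at (1,1) is zero, the square of the word is used instead:
  it is either of the type just excluded or minus the identity, and the latter would make the square of the word the identity map.\<close>

lemma commute_if_loxodromic:
  assumes h: "h \<in> words" "represents h H" and lox: "\<bar>Re (H $ 1 $ 1)\<bar> > 1"
  shows "F \<circ> G = G \<circ> F"
proof -
  define f a b where "f = Re (H $ 1 $ 1)" and "a = H $ 1 $ 1" and "b = H $ 1 $ 2"
  have H: "H $ 1 $ 1 = a" "H $ 1 $ 2 = b" "H $ 2 $ 1 = cnj b" "H $ 2 $ 2 = cnj a" and nH: "a * cnj a - b * cnj b = 1"
    using h(2) by (simp_all add: represents_def su11_def a_def b_def)
  have f2: "f\<^sup>2 > 1"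
    using lox unfolding f_def by (metis abs_square_le_1 not_le)
  \<comment> \<open>the eigenvalues of \<open>H\<close>, the sign of \<open>f\<close> making \<open>\<kappa>1\<close> the larger one in modulus\<close>
  define \<kappa>1 \<kappa>2 where "\<kappa>1 = f + sgn f * sqrt (f\<^sup>2 - 1)" and "\<kappa>2 = f - sgn f * sqrt (f\<^sup>2 - 1)"
  have sgn: "sgn f * sgn f = 1"
    using f2 by (auto simp: sgn_if)
  have prod: "\<kappa>1 * \<kappa>2 = 1"
  proof -
    have "\<kappa>1 * \<kappa>2 = f\<^sup>2 - (sgn f * sgn f) * (sqrt (f\<^sup>2 - 1))\<^sup>2"
      by (simp add: \<kappa>1_def \<kappa>2_def power2_eq_square algebra_simps)
    then show ?thesis
      using f2 sgn by simp
  qed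
  have sum: "\<kappa>1 + \<kappa>2 = 2 * f"
    by (simp add: \<kappa>1_def \<kappa>2_def)
  have "\<bar>\<kappa>1\<bar> > 1"
  proof -
    define l where "l = sqrt (f\<^sup>2 - 1)"
    have "l > 0"
      using f2 by (simp add: l_def)
    then have "\<bar>f\<bar> < \<bar>f + sgn f * l\<bar>"
      using sgn by (cases "f > 0") (auto simp: sgn_if abs_if split: if_splits)
    then have "\<bar>f\<bar> < \<bar>\<kappa>1\<bar>"
      by (simp only: \<kappa>1_def l_def)
    then show ?thesis
      using lox by (simp add: f_def)
  qed
  have "\<bar>\<kappa>2\<bar> < 1"
  proof -
    have "\<bar>\<kappa>1\<bar> * \<bar>\<kappa>2\<bar> = 1"
      using prod by (simp flip: abs_mult)
    moreover have "\<bar>\<kappa>1\<bar> * 1 \<le> \<bar>\<kappa>1\<bar> * \<bar>\<kappa>2\<bar>" if "1 \<le> \<bar>\<kappa>2\<bar>"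
      using that by (intro mult_left_mono) auto
    ultimately show ?thesis
      using \<open>\<bar>\<kappa>1\<bar> > 1\<close> by linarith
  qed
  have \<kappa>: "norm (complex_of_real \<kappa>2) < norm (complex_of_real \<kappa>1)" "complex_of_real \<kappa>2 \<noteq> 0"
    using \<open>\<bar>\<kappa>1\<bar> > 1\<close> \<open>\<bar>\<kappa>2\<bar> < 1\<close> prod by (simp, force)
  have char: "of_real k * of_real k - (a + cnj a) * of_real k + 1 = 0" if "k \<in> {\<kappa>1, \<kappa>2}" for k :: real
  proof -
    have "k * k - 2 * f * k + 1 = 0"
      using that prod unfolding sum[symmetric] by (auto simp: algebra_simps)
    then have "complex_of_real (k * k - 2 * f * k + 1) = 0"
      by simp
    moreover have "a + cnj a = of_real (2 * f)"
      by (simp add: complex_add_cnj f_def a_def)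
    ultimately show ?thesis
      by (simp add: algebra_simps)
  qed
  have "b \<noteq> 0"
  proof
    assume "b = 0"
    then have "(norm a)\<^sup>2 = 1"
      using su11_norm[of H] h(2) by (simp add: represents_def a_def b_def)
    moreover have "f\<^sup>2 \<le> (norm a)\<^sup>2"
      using complex_Re_le_cmod abs_Re_le_cmod[of a] unfolding f_def a_def by (simp add: abs_le_square_iff[symmetric])
    ultimately show False
      using f2 by simp
  qed
  \<comment> \<open>the rows are left eigenvectors of \<open>H\<close>\<close>
  define P where "P = mat2 (cnj b) (of_real \<kappa>1 - a) (cnj b) (of_real \<kappa>2 - a)"
  define \<Lambda> where "\<Lambda> = mat2 (of_real \<kappa>1) 0 0 (of_real \<kappa>2)"
  have "det P = cnj b * (of_real \<kappa>2 - of_real \<kappa>1)"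
    by (simp add: P_def det_2 algebra_simps)
  then have "det P \<noteq> 0"
    using \<open>b \<noteq> 0\<close> \<kappa>(1) by auto
  then obtain P' where P: "P ** P' = mat 1" "P' ** P = mat 1"
    using invertible_det_nz[of P] unfolding invertible_def by blast
  have eig: "cnj b * b + (of_real k - a) * cnj a = of_real k * (of_real k - a)" if "k \<in> {\<kappa>1, \<kappa>2}" for k :: real
  proof -
    have nb: "cnj b * b = a * cnj a - 1"
      using nH by (simp add: algebra_simps)
    have kk: "of_real k * of_real k = (a + cnj a) * of_real k - 1"
      using char[OF that] by (simp add: algebra_simps)
    have "cnj b * b + (of_real k - a) * cnj a = of_real k * cnj a - 1"
      unfolding nb by (simp add: algebra_simps)
    also have "\<dots> = of_real k * of_real k - a * of_real k"
      unfolding kk by (simp add: algebra_simps)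
    finally show ?thesis
      by (simp add: algebra_simps)
  qed
  have "P ** H = \<Lambda> ** P"
    unfolding mat2_eq_iff using eig[of \<kappa>1] eig[of \<kappa>2]
    by (simp add: mat2_mult_entries P_def \<Lambda>_def H algebra_simps)
  define hat where "hat = (\<lambda>M. P ** M ** P')"
  have hatH: "hat H = \<Lambda>"
  proof -
    have "hat H = \<Lambda> ** (P ** P')"
      unfolding hat_def \<open>P ** H = \<Lambda> ** P\<close> by (simp only: matrix_mul_assoc)
    then show ?thesis
      by (simp only: P matrix_mul_rid)
  qed
  have hat_mult: "hat (M ** N) = hat M ** hat N" for M N
    unfolding hat_def by (rule conjugate_mult[OF P(2), symmetric])
  have hat_power: "hat (mat_power M n) = mat_power (hat M) n" for M n
    unfolding hat_def by (rule conjugate_power[OF P, symmetric])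
  have hat_det: "det (hat M) = 1" if "su11 M" for M
  proof -
    have "det (hat M) = det P * det P' * det M"
      by (simp add: hat_def det_mul)
    also have "det P * det P' = 1"
      using P(1) det_mul[of P P'] by simp
    finally show ?thesis
      using su11_det[OF that] by simp
  qed
  have hat_inj: "M = N" if "hat M = hat N" for M N
    using that conjugate_cancel[OF P(2)] unfolding hat_def by blast
  have lower: "hat T $ 2 $ 1 = 0" if t: "t \<in> words" "represents t T" and T: "hat T $ 1 $ 1 \<noteq> 0" for t T
  proof (rule ccontr)
    assume nz: "hat T $ 2 $ 1 \<noteq> 0"
    have "det (hat T) \<noteq> 0"
      using hat_det t(2) by (simp add: represents_def)
    then obtain N U where N: "N \<ge> 1" "U = mat_power \<Lambda> N"
      and pp: "\<And>v w. \<lbrakk>\<And>x. x \<noteq> [] \<Longrightarrow> mat_word U (hat T ** U) x \<noteq> mat 1 \<and> mat_word U (hat T ** U) x \<noteq> - mat 1; v \<noteq> w\<rbrakk>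
        \<Longrightarrow> mat_word U (hat T ** U) v \<noteq> mat_word U (hat T ** U) w \<and> mat_word U (hat T ** U) v \<noteq> - mat_word U (hat T ** U) w"
      using diagonal_ping_pong[OF \<kappa> _ T nz] unfolding \<Lambda>_def by blast
    have hN: "h ^^ N \<in> words" "represents (h ^^ N) (mat_power H N)"
      using words_funpow[OF h(1) N(1)] represents_funpow[OF h(2)] by auto
    have thN: "t \<circ> (h ^^ N) \<in> words" "represents (t \<circ> (h ^^ N)) (T ** mat_power H N)"
      using words_compose[OF t(1) hN(1)] represents_compose[OF t(2) hN(2)] by blast+
    have U: "U = P ** mat_power H N ** P'" "hat T ** U = P ** (T ** mat_power H N) ** P'"
    proof -
      have "U = hat (mat_power H N)"
        by (simp only: N(2) hat_power hatH)
      then show "U = P ** mat_power H N ** P'" "hat T ** U = P ** (T ** mat_power H N) ** P'"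
        using hat_mult[of T "mat_power H N"] by (simp_all only: hat_def)
    qed
    show False
      using conjugated_word_collision[OF hN thN P U] pp by blast
  qed
  have upper: "hat T $ 1 $ 2 = 0" if t: "t \<in> words" "represents t T" and T: "hat T $ 1 $ 1 \<noteq> 0" for t T
  proof (rule ccontr)
    assume nz: "hat T $ 1 $ 2 \<noteq> 0"
    define B where "B = transpose (hat T)"
    have "det B = 1"
      using hat_det t(2) by (simp add: represents_def B_def det_transpose)
    then have "det B \<noteq> 0"
      by simp
    moreover have "B $ 1 $ 1 \<noteq> 0" "B $ 2 $ 1 \<noteq> 0"
      using T nz by (simp_all add: B_def transpose_def)
    ultimately obtain N U where N: "N \<ge> 1" "U = mat_power \<Lambda> N"
      and pp: "\<And>v w. \<lbrakk>\<And>x. x \<noteq> [] \<Longrightarrow> mat_word U (B ** U) x \<noteq> mat 1 \<and> mat_word U (B ** U) x \<noteq> - mat 1; v \<noteq> w\<rbrakk>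
        \<Longrightarrow> mat_word U (B ** U) v \<noteq> mat_word U (B ** U) w \<and> mat_word U (B ** U) v \<noteq> - mat_word U (B ** U) w"
      using diagonal_ping_pong[OF \<kappa>, of B] unfolding \<Lambda>_def by blast
    have hN: "h ^^ N \<in> words" "represents (h ^^ N) (mat_power H N)"
      using words_funpow[OF h(1) N(1)] represents_funpow[OF h(2)] by auto
    have hNt: "(h ^^ N) \<circ> t \<in> words" "represents ((h ^^ N) \<circ> t) (mat_power H N ** T)"
      using words_compose[OF hN(1) t(1)] represents_compose[OF hN(2) t(2)] by blast+
    have U: "U = P ** mat_power H N ** P'" "U ** hat T = P ** (mat_power H N ** T) ** P'"
    proof -
      have "U = hat (mat_power H N)"
        by (simp only: N(2) hat_power hatH)
      then show "U = P ** mat_power H N ** P'" "U ** hat T = P ** (mat_power H N ** T) ** P'"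
        using hat_mult[of "mat_power H N" T] by (simp_all only: hat_def)
    qed
    have tU: "transpose U = U"
      unfolding N(2) \<Lambda>_def mat_power_diagonal by (simp add: mat2_eq_iff transpose_def)
    have tr: "mat_word U (B ** U) x = transpose (mat_word U (U ** hat T) (rev x))" for x
      by (simp add: mat_word_transpose matrix_transpose_mul tU B_def)
    have tr_minus: "transpose (- X) = - transpose X" for X :: "complex^2^2"
      by (simp add: mat2_eq_iff transpose_def)
    have nt: "mat_word U (B ** U) x \<noteq> mat 1 \<and> mat_word U (B ** U) x \<noteq> - mat 1" if "x \<noteq> []" for x
      using conjugated_word_collision(1)[OF hN hNt P U, of "rev x"] that unfolding tr
      by (metis rev_is_Nil_conv tr_minus transpose_mat transpose_transpose)
    obtain v w where vw: "v \<noteq> w" "mat_word U (U ** hat T) v = mat_word U (U ** hat T) w \<or>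
        mat_word U (U ** hat T) v = - mat_word U (U ** hat T) w"
      using conjugated_word_collision(2)[OF hN hNt P U] by blast
    show False
      using pp[OF nt, of "rev v" "rev w"] vw unfolding tr by (auto simp: tr_minus)
  qed
  have diag: "hat S $ 1 $ 2 = 0 \<and> hat S $ 2 $ 1 = 0" if s: "s \<in> words" "represents s S" for s S
  proof (cases "hat S $ 1 $ 1 = 0")
    case False
    then show ?thesis using lower[OF s] upper[OF s] by blast
  next
    case True
    define \<beta> \<gamma> \<delta> where "\<beta> = hat S $ 1 $ 2" and "\<gamma> = hat S $ 2 $ 1" and "\<delta> = hat S $ 2 $ 2"
    have "det (hat S) = 1"
      using hat_det s(2) by (simp add: represents_def)
    then have bc: "\<beta> * \<gamma> = -1"
      using True by (simp add: det_2 \<beta>_def \<gamma>_def) (metis minus_minus)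
    have sq: "hat (S ** S) $ 1 $ 1 = \<beta> * \<gamma>" "hat (S ** S) $ 1 $ 2 = \<beta> * \<delta>" "hat (S ** S) $ 2 $ 1 = \<delta> * \<gamma>"
      "hat (S ** S) $ 2 $ 2 = \<gamma> * \<beta> + \<delta> * \<delta>"
      using True by (simp_all add: hat_mult mat2_mult_entries \<beta>_def \<gamma>_def \<delta>_def)
    have ss: "s \<circ> s \<in> words" "represents (s \<circ> s) (S ** S)"
      using words_compose s represents_compose by blast+
    have "\<beta> * \<delta> = 0"
      using upper[OF ss] sq bc by simp
    then have "\<delta> = 0"
      using bc by auto
    have "hat (S ** S) = hat (- mat 1)"
    proof -
      have "hat (- mat 1) = - mat 1"
        using P by (simp add: hat_def mat2_mult_minus)
      then show ?thesis
        unfolding mat2_eq_iff using sq bc \<open>\<delta> = 0\<close> by (simp add: mult.commute)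
    qed
    then have "S ** S = - mat 1"
      by (rule hat_inj)
    then show ?thesis
      using words_represented_nontrivial[OF ss] by blast
  qed
  have "hat (MF ** MG) = hat (MG ** MF)"
    unfolding hat_mult mat2_eq_iff using diag[OF words_F MF] diag[OF words_G MG]
    by (simp add: mat2_mult_entries)
  then show ?thesis
    using commute_if_matrices_commute hat_inj by blast
qed

text \<open>Without loxodromic elements the trace of every \<open>A\<^sup>n B\<close> is bounded by two. An elliptic generator commutes with everything, and
  otherwise both generators are parabolic or trivial.\<close>

theorem generators_commute: "F \<circ> G = G \<circ> F"
proof (cases "\<exists>h H. h \<in> words \<and> represents h H \<and> \<bar>Re (H $ 1 $ 1)\<bar> > 1")
  case True
  then show ?thesis using commute_if_loxodromic by blast
next
  case False
  then have le: "\<bar>Re (M $ 1 $ 1)\<bar> \<le> 1" if "s \<in> words" "represents s M" for s M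
    using that by (meson not_le)
  have su: "su11 MF" "su11 MG"
    using MF MG by (simp_all add: represents_def)
  have bound: "\<bar>Re ((mat_power A n ** B) $ 1 $ 1)\<bar> \<le> 1"
    if "a \<in> words" "represents a A" "b \<in> words" "represents b B" for a A b B n
  proof (rule le)
    show "represents ((a ^^ n) \<circ> b) (mat_power A n ** B)"
      by (intro represents_compose represents_funpow that)
    show "(a ^^ n) \<circ> b \<in> words"
    proof (cases "n = 0")
      case True
      then show ?thesis using that(3) by (simp only: funpow.simps id_comp)
    next
      case False
      then show ?thesis by (intro words_compose words_funpow that) simp
    qed
  qed
  have order: "mat_power A n \<noteq> mat 1" if "a \<in> words" "represents a A" "n \<ge> 1" for a A n
    using words_represented_nontrivial[OF words_funpow[OF that(1,3)] represents_funpow[OF that(2)]] by blast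
  have elliptic: "A ** B = B ** A"
    if ab: "a \<in> words" "represents a A" "b \<in> words" "represents b B" and lt: "\<bar>Re (A $ 1 $ 1)\<bar> < 1" for a A b B
    by (rule elliptic_commutes_if_traces_bounded[OF _ _ lt])
      (use ab order[OF ab(1,2)] bound[OF ab] in \<open>auto simp: represents_def\<close>)
  have "MF ** MG = MG ** MF"
  proof (cases "\<bar>Re (MF $ 1 $ 1)\<bar> < 1 \<or> \<bar>Re (MG $ 1 $ 1)\<bar> < 1")
    case True
    then show ?thesis
      using elliptic[OF words_F MF words_G MG] elliptic[OF words_G MG words_F MF] by auto
  next
    case False
    then have "\<bar>Re (MF $ 1 $ 1)\<bar> = 1" "\<bar>Re (MG $ 1 $ 1)\<bar> = 1"
      using le[OF words_F MF] le[OF words_G MG] by linarith+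
    then show ?thesis
      by (rule parabolics_commute_if_traces_bounded[OF su _ _ bound[OF words_F MF words_G MG]])
  qed
  then show ?thesis
    by (rule commute_if_matrices_commute)
qed

end

context disc_pair
begin

theorem preperiodic_points_eq_if_degree_1:
  assumes "lift_of F 1 \<phi>" "lift_of G 1 \<gamma>"
  shows "preperiodic_points F = preperiodic_points G"
proof -
  obtain MF where MF: "represents F MF"
    using generator_represented_if_degree_1[of F] assms(1) by blast
  obtain MG where MG: "represents G MG"
    using generator_represented_if_degree_1[of G] assms(2) by blast
  interpret moebius_pair F G D \<psi> \<eta> MF MG
    by unfold_locales (rule MF MG)+
  show ?thesis
    by (rule preperiodic_points_eq_if_commuting[OF generators_commute])
qed

lemma disc_pair_swap: "disc_pair G F D \<psi> \<eta>"
  by unfold_locales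
    (use entire not_inj no_free no_free_abelian open_D nonempty_D \<psi>_holomorphic \<eta>_holomorphic
      \<psi> \<eta> maps_D proper_on_D in \<open>simp_all add: insert_commute\<close>)

theorem preperiodic_points_eq_on_disc: "preperiodic_points F = preperiodic_points G"
proof -
  obtain d \<phi> where F: "d \<ge> 1" "lift_of F d \<phi>"
    using words_lift[of F] words_F by blast
  obtain e \<gamma> where G: "e \<ge> 1" "lift_of G e \<gamma>"
    using words_lift[of G] words_G by blast
  consider "e \<ge> 2" | "d \<ge> 2" | "d = 1" "e = 1"
    using F(1) G(1) by linarith
  then show ?thesis
  proof cases
    case 1
    then show ?thesis using preperiodic_points_eq_if_degree_ge_2 G(2) by blast
  next
    case 2
    interpret swap: disc_pair G F D \<psi> \<eta>
      by (rule disc_pair_swap)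
    have "swap.lift_of F d \<phi>"
      using F(2) unfolding swap.lift_of_def lift_of_def swap.on_disc_def[abs_def] on_disc_def[abs_def] .
    then show ?thesis
      using swap.preperiodic_points_eq_if_degree_ge_2 2 by blast
  next
    case 3
    then show ?thesis using preperiodic_points_eq_if_degree_1 F(2) G(2) by blast
  qed
qed

end

section \<open>Maps sharing a bounded periodic Fatou component\<close>

theorem theorem11:
  fixes f g :: "complex \<Rightarrow> complex" and D :: "complex set"
  assumes "f holomorphic_on UNIV" and "g holomorphic_on UNIV"
    and "\<not> inj f" and "\<not> inj g"
    and "bounded D"
    and "periodic_Fatou_component f D" and "periodic_Fatou_component g D"
    and "\<not> (\<exists>T \<subseteq> generated_semigroup {f, g}. free_noncyclic T)"
    and "\<not> (\<exists>T \<subseteq> generated_semigroup {f, g}. free_abelian_noncyclic T)"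
  shows "preperiodic_points f = preperiodic_points g"
proof -
  obtain p where p: "p \<ge> 1" "(f ^^ p) ` D \<subseteq> D" "D \<in> components (Fatou_set f)"
    using assms(6) by (auto simp: periodic_Fatou_component_def Fatou_component_def)
  obtain q where q: "q \<ge> 1" "(g ^^ q) ` D \<subseteq> D" "D \<in> components (Fatou_set g)"
    using assms(7) by (auto simp: periodic_Fatou_component_def Fatou_component_def)
  interpret f: bounded_periodic_component f D p
    by unfold_locales (use assms p in auto)
  interpret g: bounded_periodic_component g D q
    by unfold_locales (use assms q in auto)
  have nonconst: "nonconst_entire f" "nonconst_entire g"
    using assms(1,2) f.nonconst g.nonconst by (simp_all add: nonconst_entire_def)
  \<comment> \<open>one exponent that sends \<open>D\<close> into itself for both maps\<close>
  define N where "N = p * q"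
  have N: "N \<ge> 1"
    using p(1) q(1) by (simp add: N_def Suc_le_eq)
  define F where "F = f ^^ N"
  define G where "G = g ^^ N"
  have FG: "F \<in> generated_semigroup {f, g}" "G \<in> generated_semigroup {f, g}"
    unfolding F_def G_def using N
    by (intro funpow_in_generated_semigroup generated_semigroup.generator; simp)+
  have sub: "generated_semigroup {F, G} \<subseteq> generated_semigroup {f, g}"
    using generated_semigroup_mono_closed[of "{F, G}" "{f, g}"] FG by blast
  have gen: "nonconst_entire s" "\<not> inj s" if "s \<in> generated_semigroup {f, g}" for s
    using generated_semigroup_nonconst_entire[OF _ that] generated_semigroup_not_inj[OF _ that] nonconst assms(3,4)
    by blast+
  obtain \<psi> \<eta> where \<psi>: "\<psi> holomorphic_on D" "\<eta> holomorphic_on ball 0 1"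
    "\<forall>z\<in>D. \<psi> z \<in> ball 0 1 \<and> \<eta> (\<psi> z) = z" "\<forall>z\<in>ball 0 1. \<eta> z \<in> D \<and> \<psi> (\<eta> z) = z"
  proof -
    have "D \<noteq> UNIV"
      using assms(5) not_bounded_UNIV by blast
    then show ?thesis
      using Riemann_mapping_theorem[of D] f.component_open f.simply_connected_component f.nonempty that by blast
  qed
  interpret disc_pair F G D \<psi> \<eta>
  proof unfold_locales
    show "nonconst_entire F" "nonconst_entire G" "\<not> inj F" "\<not> inj G"
      using gen FG by blast+
    show "\<not> (\<exists>T \<subseteq> generated_semigroup {F, G}. free_noncyclic T)"
      "\<not> (\<exists>T \<subseteq> generated_semigroup {F, G}. free_abelian_noncyclic T)"
      using sub assms(8,9) by (meson subset_trans)+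
    show "open D" "D \<noteq> {}"
      by (rule f.component_open f.nonempty)+
    show "F ` D \<subseteq> D"
      unfolding F_def N_def by (rule f.funpow_multiple_maps)
    show "G ` D \<subseteq> D"
      unfolding G_def N_def by (subst mult.commute) (rule g.funpow_multiple_maps)
    show "compact {z \<in> D. F z \<in> K}" "compact {z \<in> D. G z \<in> K}" if "compact K" "K \<subseteq> D" for K
      unfolding F_def G_def by (intro f.iterate_proper_on_component g.iterate_proper_on_component that)+
  qed (use \<psi> in auto)
  have "preperiodic_points F = preperiodic_points G"
    by (rule preperiodic_points_eq_on_disc)
  then show ?thesis
    unfolding F_def G_def using N by (simp add: preperiodic_points_funpow)
qed

end
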